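(* Let $k\ge1$, let $N_1,N_2,\ldots,N_k\ge2$ be integers, and let $\mathbf N=(N_1,\ldots,N_k)$ be such that $\Phi_{\mathbf N}\ge4$. Then the series $\mathbf z_{\mathbf N}(q)$ can be analytically continued to a domain that contains the half-open segment $[0,\mathbf q_{\mathbf N}(1/C_{\mathbf N}))$. Moreover, this domain can be chosen so that it contains as well a right slit neighbourhood $\Delta\big(\mathbf q_{\mathbf N}(1/C_{\mathbf N});r,\varepsilon\big)$ of $\mathbf q_{\mathbf N}(1/C_{\mathbf N})$, where the parameter $\varepsilon>0$ controlling the angle of the slit can be chosen arbitrarily small (with some $r>0$).
   Context: For an integer $N\ge 2$ let $r_1,\ldots,r_{\varphi(N)}$ be the integers in $\{1,\ldots,N\}$ coprime to $N$ ($\varphi$ is Euler's totient), and put $C_N:=N^{\varphi(N)}\prod_{p\mid N}p^{\varphi(N)/(p-1)}$ (product over primes $p$ dividing $N$). With $(\alpha)_m=\alpha(\alpha+1)\cdots(\alpha+m-1)$, $(\alpha)_0=1$, and $H(x,m)=\sum_{n=0}^{m-1}\frac1{x+n}$, define for $m\ge0$ $$\mathbf B_N(m)=C_N^m\prod_{j=1}^{\varphi(N)}\frac{(r_j/N)_m}{m!},\qquad \mathbf H_N(m)=\sum_{j=1}^{\varphi(N)}H(r_j/N,m)-\varphi(N)H(1,m).$$ For $\mathbf N=(N_1,\ldots,N_k)$ put $C_{\mathbf N}=\prod_{j=1}^kC_{N_j}$, $\Phi_{\mathbf N}=\sum_{j=1}^k\varphi(N_j)$, $\mathbf B_{\mathbf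 N}(m)=\prod_{j=1}^k\mathbf B_{N_j}(m)$, $\mathbf H_{\mathbf N}(m)=\sum_{j=1}^k\mathbf H_{N_j}(m)$, and $$\mathbf F_{\mathbf N}(z)=\sum_{m\ge0}\mathbf B_{\mathbf N}(m)z^m,\qquad \mathbf G_{\mathbf N}(z)=\sum_{m\ge1}\mathbf H_{\mathbf N}(m)\mathbf B_{\mathbf N}(m)z^m.$$ The canonical coordinate is the power series $\mathbf q_{\mathbf N}(z)=z\exp\big(\mathbf G_{\mathbf N}(z)/\mathbf F_{\mathbf N}(z)\big)$; its Taylor series at $0$ converges at $z=1/C_{\mathbf N}$, and $\mathbf q_{\mathbf N}(1/C_{\mathbf N})$ denotes its sum there. The mirror map $\mathbf z_{\mathbf N}(q)$ is the compositional inverse of $\mathbf q_{\mathbf N}(z)$ (as power series, with $\mathbf z_{\mathbf N}(0)=0$), which converges in a neighbourhood of $q=0$. A right slit neighbourhood of $z_0$ is a domain of the form $\Delta(z_0;r,\varepsilon)=\{z:|z-z_0|<r\text{ and }|\arg(z-z_0)|>\varepsilon\}$ for some $r,\varepsilon>0$, where $\arg$ takes values in $(-\pi,\pi]$. *)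

theory Defs
  imports "HOL-Complex_Analysis.Complex_Analysis" "HOL-Number_Theory.Number_Theory"
begin

text \<open>
  The tuple \<open>(N\<^sub>1, \<dots>, N\<^sub>k)\<close> is a list \<open>Ns :: nat list\<close>. The names ending in \<open>1\<close> are the quantities
  attached to a single integer \<open>N\<close>, those without suffix the ones attached to a tuple. The integers
  \<open>r\<^sub>1, \<dots>, r\<^sub>\<phi>\<^sub>(\<^sub>N\<^sub>)\<close> are the elements of \<^term>\<open>totatives N\<close>.
\<close>

definition C1 :: "nat \<Rightarrow> real" where
  "C1 N = real N ^ totient N *
     (\<Prod>p\<in>prime_factors N. real p powr (real (totient N) / (real p - 1)))"

definition harm_shift :: "real \<Rightarrow> nat \<Rightarrow> real" where
  "harm_shift x m = (\<Sum>n<m. 1 / (x + real n))"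

definition B1 :: "nat \<Rightarrow> nat \<Rightarrow> real" where
  "B1 N m = C1 N ^ m * (\<Prod>r\<in>totatives N. pochhammer (real r / real N) m / fact m)"

definition H1 :: "nat \<Rightarrow> nat \<Rightarrow> real" where
  "H1 N m = (\<Sum>r\<in>totatives N. harm_shift (real r / real N) m)
              - real (totient N) * harm_shift 1 m"

definition C_const :: "nat list \<Rightarrow> real" where
  "C_const Ns = (\<Prod>N\<leftarrow>Ns. C1 N)"

definition Phi :: "nat list \<Rightarrow> nat" where
  "Phi Ns = (\<Sum>N\<leftarrow>Ns. totient N)"

definition B_coeff :: "nat list \<Rightarrow> nat \<Rightarrow> real" where
  "B_coeff Ns m = (\<Prod>N\<leftarrow>Ns. B1 N m)"

definition H_coeff :: "nat list \<Rightarrow> nat \<Rightarrow> real" where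
  "H_coeff Ns m = (\<Sum>N\<leftarrow>Ns. H1 N m)"

definition F_series :: "nat list \<Rightarrow> complex fps" where
  "F_series Ns = Abs_fps (\<lambda>m. complex_of_real (B_coeff Ns m))"

definition G_series :: "nat list \<Rightarrow> complex fps" where
  "G_series Ns =
     Abs_fps (\<lambda>m. if m = 0 then 0 else complex_of_real (H_coeff Ns m * B_coeff Ns m))"

text \<open>
  The quotient is formed in the ring of formal power series (\<open>F_series Ns\<close> has constant term \<open>1\<close>),
  and the exponential is formal composition (the quotient has constant term \<open>0\<close>).
\<close>

definition canonical_coord :: "nat list \<Rightarrow> complex fps" where
  "canonical_coord Ns = fps_X * (fps_exp 1 oo (G_series Ns / F_series Ns))"

definition mirror_map :: "nat list \<Rightarrow> complex fps" where
  "mirror_map Ns = fps_inv (canonical_coord Ns)"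

text \<open>
  The sum of the Taylor series at \<open>1/C\<close>, which may lie on the boundary of the disc of convergence:
  \<^const>\<open>eval_fps\<close> is the sum of the series itself, not the value of a continuation.
\<close>

definition q_crit :: "nat list \<Rightarrow> complex" where
  "q_crit Ns = eval_fps (canonical_coord Ns) (complex_of_real (1 / C_const Ns))"

definition right_slit_nbhd :: "complex \<Rightarrow> real \<Rightarrow> real \<Rightarrow> complex set" where
  "right_slit_nbhd z0 r \<epsilon> = {z. cmod (z - z0) < r \<and> \<bar>Arg (z - z0)\<bar> > \<epsilon>}"

definition continuable_to :: "complex fps \<Rightarrow> complex set \<Rightarrow> bool" where
  "continuable_to S D \<longleftrightarrow>
     open D \<and> connected D \<and> 0 \<in> D \<and> (\<exists>f. f holomorphic_on D \<and> f has_fps_expansion S)"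

text \<open>
  The series that enter the definitions have the normalisations under which division, composition
  and \<^const>\<open>fps_inv\<close> have their intended meaning.
\<close>

lemma fps_nth_F_series_0: "fps_nth (F_series Ns) 0 = 1"
proof -
  have "B1 N 0 = 1" for N by (simp add: B1_def)
  then have "B_coeff Ns 0 = 1" by (induction Ns) (simp_all add: B_coeff_def)
  then show ?thesis by (simp add: F_series_def)
qed

lemma fps_nth_G_div_F_0: "fps_nth (G_series Ns / F_series Ns) 0 = 0"
  by (simp add: fps_divide_unit fps_nth_F_series_0 G_series_def)

lemma fps_nth_canonical_coord_0: "fps_nth (canonical_coord Ns) 0 = 0"
  by (simp add: canonical_coord_def)

lemma fps_nth_canonical_coord_1: "fps_nth (canonical_coord Ns) 1 = 1"
  by (simp add: canonical_coord_def)

lemma mirror_map_inverse: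
  "mirror_map Ns oo canonical_coord Ns = fps_X"
  "canonical_coord Ns oo mirror_map Ns = fps_X"
  using fps_nth_canonical_coord_0[of Ns] fps_nth_canonical_coord_1[of Ns]
  by (simp_all add: mirror_map_def fps_inv fps_inv_right)

end

theory Submission
  imports Defs "HOL-Real_Asymp.Real_Asymp"
begin

text \<open>
  Put \<open>x = C z\<close> and let \<open>\<alpha>\<close> run through the \<open>\<Phi>\<close> fractions \<open>r / N\<close>. The coefficients
  \<open>a\<^sub>m = \<Prod> (\<alpha>)\<^sub>m / m!\<close> are the moments \<open>\<integral> t\<^sup>m dM\<close> of a probability measure on \<open>(0, 1)\<close>, the law of a
  product of independent Beta variables, and \<open>\<integral> t\<^sup>m ln t dM = a\<^sub>m (h\<^sub>m + l)\<close>, where \<open>h\<^sub>m\<close> is the harmonic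
  factor of the series \<open>G\<close> and \<open>l = \<integral> ln t dM\<close> (\<open>ex_log_moments\<close>). Hence
  \<open>F(z) = \<integral> dM / (1 - x t)\<close> and \<open>G(z) = \<integral> (ln t - l) / (1 - x t) dM\<close>, and
  \<open>q(z) = z exp (G(z) / F(z))\<close> is holomorphic on the plane cut along \<open>[1/C, \<infinity>)\<close>, since \<open>F\<close> has no zero
  there (\<open>J_1_nonzero\<close>). It remains to invert \<open>q\<close> along \<open>[0, 1/C)\<close> and near \<open>1/C\<close>.

  On the segment positivity is enough. The \<open>a\<^sub>m\<close> are log-convex and the \<open>h\<^sub>m\<close> increase, so by Kaluza's
  argument \<open>G / F\<close>, and therefore \<open>q\<close>, has nonnegative Taylor coefficients (\<open>kaluza_quotient\<close>). So
  \<open>q(b) - q(a) \<ge> b - a\<close> on \<open>[0, 1/C)\<close>, the Taylor series converges at \<open>1/C\<close>, and its sum is the limit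
  \<open>q\<^sub>1\<close> of \<open>q\<close> from the left (\<open>nonneg_power_series_boundary\<close>).

  Near \<open>1/C\<close> the condition \<open>\<Phi> \<ge> 4\<close> enters: it gives \<open>a\<^sub>m \<le> 1 / (m + 1)\<^sup>2\<close>. Write \<open>u = 1 - x\<close> and
  \<open>gap u = 1 - q / q\<^sub>1\<close>. In every sector \<open>\<bar>arg u\<bar> < \<pi> - \<epsilon>\<close> one has \<open>u gap'(u) / gap(u) \<rightarrow> 1\<close>
  (\<open>gap_asymptotics\<close>): if \<open>t / (1 - t)\<^sup>2\<close> is integrable, \<open>gap'\<close> has a positive limit; otherwise \<open>gap'\<close>
  tends to infinity, but so slowly that division by a real function of \<open>\<bar>u\<bar>\<close> again produces a positive
  limit. In the coordinates \<open>u = exp s\<close>, \<open>gap u = exp T\<close> this says that \<open>T'(s) \<rightarrow> 1\<close> on a half strip. A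
  half strip is convex, so \<open>T\<close> is injective far to the left, and a fixed point argument shows that it
  covers every slightly narrower half strip (\<open>sector_inverse\<close>). Thus \<open>q\<close> has a holomorphic inverse on
  slit neighbourhoods of \<open>q\<^sub>1\<close>.

  All these local inverses restrict to the real inverse function on the real axis, and any two of their
  domains meet in the intersection of two discs centred there, so they glue
  (\<open>inverse_continues_to_slit_nbhd\<close>).
\<close>

section \<open>Measures on (0,1) with given moments and logarithmic moments\<close>

lemma beta_integrable:
  fixes a b :: real
  assumes "a > 0" "b > 0"
  shows "integrable lborel (\<lambda>t. indicator {0<..<1} t * (t powr (a - 1) * (1 - t) powr (b - 1)))"
    and "(\<integral>t. indicator {0<..<1} t * (t powr (a - 1) * (1 - t) powr (b - 1)) \<partial>lborel) = Beta a b"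
proof -
  define f where "f = (\<lambda>t. indicator {0<..<1} t * (t powr (a - 1) * (1 - t) powr (b - 1)) :: real)"
  have "((\<lambda>t. t powr (a - 1) * (1 - t) powr (b - 1)) has_integral Beta a b) {0<..<1}"
    using has_integral_Beta_real[OF assms] by (simp add: has_integral_Icc_iff_Ioo)
  hence hi: "(f has_integral Beta a b) UNIV"
    unfolding f_def by (subst (asm) has_integral_restrict_UNIV[symmetric], elim has_integral_eq[rotated]) (auto simp: indicator_def)
  have nn: "0 \<le> f t" for t by (simp add: f_def)
  have m: "f \<in> borel_measurable borel" unfolding f_def by measurable
  have B: "0 \<le> Beta a b" by (rule has_integral_nonneg[OF hi]) (rule nn)
  have "(\<integral>\<^sup>+ t. ennreal (f t) \<partial>lborel) = ennreal (Beta a b)" by (rule nn_integral_has_integral_lborel[OF m nn hi])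
  hence "integrable lborel f \<and> (\<integral>t. f t \<partial>lborel) = Beta a b"
    by (subst (asm) nn_integral_eq_integrable) (use m nn B in auto)
  thus "integrable lborel (\<lambda>t. indicator {0<..<1} t * (t powr (a - 1) * (1 - t) powr (b - 1)))"
    and "(\<integral>t. indicator {0<..<1} t * (t powr (a - 1) * (1 - t) powr (b - 1)) \<partial>lborel) = Beta a b"
    by (simp_all add: f_def)
qed

text \<open>
  The quotient \<open>\<integral> t\<^sup>m ln t dM / \<integral> t\<^sup>m dM\<close> is the logarithmic derivative of the moments with respect to
  \<open>m\<close>. It is recorded up to an additive constant only, which the normalisation \<open>h 0 = 0\<close> forces to be the
  mean of \<open>ln\<close>.
\<close>

definition log_moments :: "real measure \<Rightarrow> (nat \<Rightarrow> real) \<Rightarrow> (nat \<Rightarrow> real) \<Rightarrow> bool" where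
  "log_moments M a h \<longleftrightarrow> finite_measure M \<and> sets M = sets borel \<and> (AE t in M. 0 < t \<and> t < 1) \<and>
     integrable M ln \<and> a 0 = 1 \<and> h 0 = 0 \<and> (\<forall>m. (\<integral>t. t ^ m \<partial>M) = a m) \<and>
     (\<forall>m. (\<integral>t. ln t * t ^ m \<partial>M) = a m * (h m + (\<integral>t. ln t \<partial>M)))"

text \<open>
  The image of a product measure under multiplication is the law of a product of independent variables:
  moments multiply and logarithms add.
\<close>

lemma log_moments_convolution:
  assumes 1: "log_moments M1 a1 h1" and 2: "log_moments M2 a2 h2"
  shows "log_moments (distr (M1 \<Otimes>\<^sub>M M2) borel (\<lambda>(s, t). s * t)) (\<lambda>m. a1 m * a2 m) (\<lambda>m. h1 m + h2 m)"
    (is "log_moments ?M _ _")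
proof -
  interpret M1: finite_measure M1 using 1 by (simp add: log_moments_def)
  interpret M2: finite_measure M2 using 2 by (simp add: log_moments_def)
  interpret P: pair_sigma_finite M1 M2 ..
  have s[measurable_cong]: "sets M1 = sets borel" "sets M2 = sets borel" using 1 2 by (auto simp: log_moments_def)
  have supp1: "AE t in M1. 0 < t \<and> t < 1" and supp2: "AE t in M2. 0 < t \<and> t < 1"
    using 1 2 by (auto simp: log_moments_def)
  have l1: "integrable M1 ln" and l2: "integrable M2 ln" using 1 2 by (auto simp: log_moments_def)
  have a0: "a1 0 = 1" "a2 0 = 1" "h1 0 = 0" "h2 0 = 0" using 1 2 by (auto simp: log_moments_def)
  have m1: "(\<integral>t. t ^ m \<partial>M1) = a1 m" and m2: "(\<integral>t. t ^ m \<partial>M2) = a2 m" for m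
    using 1 2 by (auto simp: log_moments_def)
  have lm1: "(\<integral>t. ln t * t ^ m \<partial>M1) = a1 m * (h1 m + (\<integral>t. ln t \<partial>M1))"
    and lm2: "(\<integral>t. ln t * t ^ m \<partial>M2) = a2 m * (h2 m + (\<integral>t. ln t \<partial>M2))" for m
    using 1 2 by (auto simp: log_moments_def)
  have pw: "integrable M (\<lambda>t. w t * t ^ m)"
    if "AE t in M. 0 < t \<and> t < (1::real)" "sets M = sets borel" "integrable M w" for M m and w :: "real \<Rightarrow> real"
  proof (rule Bochner_Integration.integrable_bound[OF that(3)])
    have [measurable_cong]: "sets M = sets borel" by fact
    have [measurable]: "w \<in> borel_measurable M" using that(3) by measurable
    show "(\<lambda>t. w t * t ^ m) \<in> borel_measurable M" by measurable
    show "AE t in M. norm (w t * t ^ m) \<le> norm (w t)"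
      using that(1) by eventually_elim (simp add: abs_mult mult_left_le power_le_one)
  qed
  have prod: "integrable (M1 \<Otimes>\<^sub>M M2) (\<lambda>(s, t). f s * g t)"
      "(\<integral>(s, t). f s * g t \<partial>(M1 \<Otimes>\<^sub>M M2)) = (\<integral>s. f s \<partial>M1) * (\<integral>t. g t \<partial>M2)"
    if f: "integrable M1 f" and g: "integrable M2 g" for f g :: "real \<Rightarrow> real"
  proof -
    have [measurable]: "f \<in> borel_measurable M1" "g \<in> borel_measurable M2" using f g by auto
    show i: "integrable (M1 \<Otimes>\<^sub>M M2) (\<lambda>(s, t). f s * g t)"
    proof (rule P.Fubini_integrable)
      show "integrable M1 (\<lambda>x. \<integral>y. norm (case (x, y) of (s, t) \<Rightarrow> f s * g t) \<partial>M2)"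
        using f by (simp add: abs_mult)
      show "AE x in M1. integrable M2 (\<lambda>y. case (x, y) of (s, t) \<Rightarrow> f s * g t)"
        using g by simp
    qed measurable
    show "(\<integral>(s, t). f s * g t \<partial>(M1 \<Otimes>\<^sub>M M2)) = (\<integral>s. f s \<partial>M1) * (\<integral>t. g t \<partial>M2)"
      using P.integral_fst[OF i] by simp
  qed
  have c1: "integrable M1 (\<lambda>t. t ^ m)" for m
    using pw[OF supp1 s(1), of "\<lambda>_. 1" m] by simp
  have c2: "integrable M2 (\<lambda>t. t ^ m)" for m
    using pw[OF supp2 s(2), of "\<lambda>_. 1" m] by simp
  note L1 = pw[OF supp1 s(1) l1] and L2 = pw[OF supp2 s(2) l2]
  have suppP: "AE x in M1 \<Otimes>\<^sub>M M2. 0 < fst x \<and> fst x < 1 \<and> 0 < snd x \<and> snd x < 1"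
  proof (rule P.AE_pair_measure)
    show "{x \<in> space (M1 \<Otimes>\<^sub>M M2). 0 < fst x \<and> fst x < 1 \<and> 0 < snd x \<and> snd x < 1} \<in> sets (M1 \<Otimes>\<^sub>M M2)" by measurable
    show "AE x in M1. AE y in M2. 0 < fst (x, y) \<and> fst (x, y) < 1 \<and> 0 < snd (x, y) \<and> snd (x, y) < 1"
      using supp1 by eventually_elim (use supp2 in auto)
  qed
  have meas: "(\<lambda>(s, t). s * t) \<in> M1 \<Otimes>\<^sub>M M2 \<rightarrow>\<^sub>M (borel :: real measure)" by measurable
  have log_eq: "AE x in M1 \<Otimes>\<^sub>M M2. (case x of (s, t) \<Rightarrow> ln s * s ^ m * t ^ m + s ^ m * (ln t * t ^ m)) =
      (case x of (s, t) \<Rightarrow> ln (s * t) * (s * t) ^ m)" for m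
    using suppP
  proof eventually_elim
    case (elim x)
    thus ?case by (cases x) (simp add: ln_mult power_mult_distrib algebra_simps)
  qed
  have li: "integrable (M1 \<Otimes>\<^sub>M M2) (\<lambda>x. (case x of (s, t) \<Rightarrow> ln s * s ^ m * t ^ m + s ^ m * (ln t * t ^ m)))" (is ?I)
    and lv: "(\<integral>x. (case x of (s, t) \<Rightarrow> ln s * s ^ m * t ^ m + s ^ m * (ln t * t ^ m)) \<partial>(M1 \<Otimes>\<^sub>M M2)) =
       a1 m * (h1 m + (\<integral>t. ln t \<partial>M1)) * a2 m + a1 m * (a2 m * (h2 m + (\<integral>t. ln t \<partial>M2)))" (is ?V) for m
  proof -
    note i = prod(1)[OF L1 c2, of m m] prod(1)[OF c1 L2, of m m]
    have eq: "(\<lambda>x. (case x of (s, t) \<Rightarrow> ln s * s ^ m * t ^ m + s ^ m * (ln t * t ^ m))) =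
       (\<lambda>x. (case x of (s, t) \<Rightarrow> ln s * s ^ m * t ^ m) + (case x of (s, t) \<Rightarrow> s ^ m * (ln t * t ^ m)))"
      by (auto simp: fun_eq_iff)
    show ?I unfolding eq by (rule Bochner_Integration.integrable_add[OF i])
    show ?V unfolding eq Bochner_Integration.integral_add[OF i] prod(2)[OF L1 c2] prod(2)[OF c1 L2] m1 m2 lm1 lm2 ..
  qed
  have lni: "integrable ?M (\<lambda>t. ln t * t ^ m)" and
    lnv: "(\<integral>t. ln t * t ^ m \<partial>?M) = a1 m * (h1 m + (\<integral>t. ln t \<partial>M1)) * a2 m + a1 m * (a2 m * (h2 m + (\<integral>t. ln t \<partial>M2)))" for m
  proof -
    have mm: "(\<lambda>x. (case x of (s, t) \<Rightarrow> ln s * s ^ m * t ^ m + s ^ m * (ln t * t ^ m))) \<in> borel_measurable (M1 \<Otimes>\<^sub>M M2)"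
      "(\<lambda>x. (case x of (s, t) \<Rightarrow> ln (s * t) * (s * t) ^ m)) \<in> borel_measurable (M1 \<Otimes>\<^sub>M M2)"
      by measurable
    have d: "(\<lambda>x :: real \<times> real. ln (case x of (s, t) \<Rightarrow> s * t) * (case x of (s, t) \<Rightarrow> s * t) ^ m) = (\<lambda>x. (case x of (s, t) \<Rightarrow> ln (s * t) * (s * t) ^ m))"
      by (auto simp: fun_eq_iff)
    have lm: "(\<lambda>t. ln t * t ^ m) \<in> borel_measurable (borel :: real measure)" by measurable
    show "integrable ?M (\<lambda>t. ln t * t ^ m)"
      unfolding integrable_distr_eq[OF meas lm] d using li[of m] integrable_cong_AE[OF mm log_eq] by simp
    show "(\<integral>t. ln t * t ^ m \<partial>?M) = a1 m * (h1 m + (\<integral>t. ln t \<partial>M1)) * a2 m + a1 m * (a2 m * (h2 m + (\<integral>t. ln t \<partial>M2)))"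
      unfolding integral_distr[OF meas lm] d using lv[of m] integral_cong_AE[OF mm log_eq] by simp
  qed
  show ?thesis unfolding log_moments_def
  proof (intro conjI allI)
    show "finite_measure ?M"
      by (rule finite_measure.finite_measure_distr[OF _ meas], rule finite_measureI)
         (simp add: space_pair_measure M2.emeasure_pair_measure_Times ennreal_mult_eq_top_iff M1.emeasure_eq_measure M2.emeasure_eq_measure)
    show "AE t in ?M. 0 < t \<and> t < 1"
    proof (subst AE_distr_iff[OF meas])
      show "AE x in M1 \<Otimes>\<^sub>M M2. 0 < (case x of (s, t) \<Rightarrow> s * t) \<and> (case x of (s, t) \<Rightarrow> s * t) < 1"
        using suppP
      proof eventually_elim
        case (elim x)
        obtain s t where x: "x = (s, t)" by (cases x)
        have st: "0 < s" "s < 1" "0 < t" "t < 1" using elim x by auto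
        have "s * t < s * 1" using st by (intro mult_strict_left_mono) auto
        hence "s * t < 1" using st by linarith
        thus ?case using st x by simp
      qed
    qed measurable
    show "integrable ?M ln" using lni[of 0] by simp
    show "(\<integral>t. t ^ m \<partial>?M) = a1 m * a2 m" for m
    proof -
      have pm: "(\<lambda>t. t ^ m) \<in> borel_measurable (borel :: real measure)" by measurable
      have "(\<lambda>x :: real \<times> real. (case x of (s, t) \<Rightarrow> s * t) ^ m) = (\<lambda>x. (case x of (s, t) \<Rightarrow> s ^ m * t ^ m))"
        by (auto simp: fun_eq_iff power_mult_distrib)
      thus ?thesis using prod(2)[OF c1 c2, of m m] by (simp add: integral_distr[OF meas pm] m1 m2)
    qed
    show "(\<integral>t. ln t * t ^ m \<partial>?M) = a1 m * a2 m * (h1 m + h2 m + (\<integral>t. ln t \<partial>?M))" for m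
      using lnv[of 0] lnv[of m] a0 by (simp add: algebra_simps)
  qed (use a0 in auto)
qed

context
  fixes \<alpha> :: real
  assumes \<alpha>: "0 < \<alpha>" "\<alpha> < 1"
begin

definition beta_density :: "real \<Rightarrow> real" where
  "beta_density t = indicator {0<..<1} t * (t powr (\<alpha> - 1) * (1 - t) powr (- \<alpha>)) / Beta \<alpha> (1 - \<alpha>)"

definition beta_measure :: "real measure" where
  "beta_measure = density lborel (\<lambda>t. ennreal (beta_density t))"

lemma Beta_pos: "Beta \<alpha> (1 - \<alpha>) > 0"
  using \<alpha> by (simp add: Beta_def Gamma_real_pos)

lemma beta_density_nonneg: "0 \<le> beta_density t"
  using Beta_pos by (simp add: beta_density_def)

lemma beta_density_meas [measurable]: "beta_density \<in> borel_measurable borel"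
  unfolding beta_density_def by measurable

lemma beta_measure_integral:
  fixes g :: "real \<Rightarrow> real"
  assumes [measurable]: "g \<in> borel_measurable borel"
  shows "integrable beta_measure g \<longleftrightarrow> integrable lborel (\<lambda>t. beta_density t * g t)"
    and "(\<integral>t. g t \<partial>beta_measure) = (\<integral>t. beta_density t * g t \<partial>lborel)"
proof -
  have nn: "AE t in lborel. 0 \<le> beta_density t" using beta_density_nonneg by simp
  have m: "g \<in> borel_measurable lborel" "beta_density \<in> borel_measurable lborel" by measurable
  show "integrable beta_measure g \<longleftrightarrow> integrable lborel (\<lambda>t. beta_density t * g t)"
    unfolding beta_measure_def using integrable_density[OF m nn] by simp
  show "(\<integral>t. g t \<partial>beta_measure) = (\<integral>t. beta_density t * g t \<partial>lborel)"
    unfolding beta_measure_def using integral_density[OF m nn] by simp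
qed

lemma beta_measure_moment:
  "integrable beta_measure (\<lambda>t. t ^ m)"
  "(\<integral>t. t ^ m \<partial>beta_measure) = pochhammer \<alpha> m / fact m"
proof -
  have m: "(\<lambda>t. t ^ m) \<in> borel_measurable (borel :: real measure)" by measurable
  have eq: "beta_density t * t ^ m =
     indicator {0<..<1} t * (t powr (\<alpha> + real m - 1) * (1 - t) powr (1 - \<alpha> - 1)) / Beta \<alpha> (1 - \<alpha>)" for t
  proof (cases "0 < t")
    case True
    have "t powr (\<alpha> + real m - 1) = t powr (\<alpha> - 1) * t ^ m"
      using True by (simp add: powr_realpow[symmetric] powr_add[symmetric] algebra_simps)
    thus ?thesis by (simp add: beta_density_def mult_ac)
  qed (simp add: beta_density_def)
  have ab: "\<alpha> + real m > 0" "1 - \<alpha> > 0" using \<alpha> by auto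
  show "integrable beta_measure (\<lambda>t. t ^ m)"
    unfolding beta_measure_integral(1)[OF m] eq using beta_integrable(1)[OF ab] by simp
  have "(\<integral>t. t ^ m \<partial>beta_measure) = Beta (\<alpha> + real m) (1 - \<alpha>) / Beta \<alpha> (1 - \<alpha>)"
    unfolding beta_measure_integral(2)[OF m] eq using beta_integrable(2)[OF ab] by simp
  also have "\<dots> = pochhammer \<alpha> m / fact m"
  proof -
    have g: "Gamma \<alpha> > 0" "Gamma (1 - \<alpha>) > 0" using \<alpha> by (auto intro: Gamma_real_pos)
    have "\<alpha> \<notin> \<int>\<^sub>\<le>\<^sub>0" using \<alpha> nonpos_Ints_nonpos by force
    hence "pochhammer \<alpha> m = Gamma (\<alpha> + real m) / Gamma \<alpha>" by (rule pochhammer_Gamma)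
    moreover have "Gamma (1 + real m) = fact m" by (rule Gamma_fact)
    ultimately show ?thesis using g by (simp add: Beta_def algebra_simps)
  qed
  finally show "(\<integral>t. t ^ m \<partial>beta_measure) = pochhammer \<alpha> m / fact m" .
qed

text \<open>
  Near 0 the bound \<open>- ln t \<le> (2 / \<alpha>) t\<^sup>-\<^sup>\<alpha>\<^sup>/\<^sup>2\<close> only changes the exponent \<open>\<alpha> - 1\<close> of the density to
  \<open>\<alpha> / 2 - 1 > - 1\<close>.
\<close>

lemma beta_measure_ln:
  "integrable beta_measure (\<lambda>t. ln t * t ^ m)"
proof -
  have ab: "\<alpha> / 2 > 0" "1 - \<alpha> > 0" using \<alpha> by auto
  have meas: "(\<lambda>t. ln t * t ^ m) \<in> borel_measurable (borel :: real measure)" by measurable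
  show ?thesis unfolding beta_measure_integral(1)[OF meas]
  proof (rule Bochner_Integration.integrable_bound)
    show "integrable lborel (\<lambda>t. 2 / \<alpha> / Beta \<alpha> (1 - \<alpha>) * (indicator {0<..<1} t * (t powr (\<alpha> / 2 - 1) * (1 - t) powr (1 - \<alpha> - 1))))"
      by (intro integrable_mult_right beta_integrable ab)
    show "AE t in lborel. norm (beta_density t * (ln t * t ^ m)) \<le>
       norm (2 / \<alpha> / Beta \<alpha> (1 - \<alpha>) * (indicator {0<..<1} t * (t powr (\<alpha> / 2 - 1) * (1 - t) powr (1 - \<alpha> - 1))))"
    proof (intro always_eventually allI)
      fix t :: real
      show "norm (beta_density t * (ln t * t ^ m)) \<le>
       norm (2 / \<alpha> / Beta \<alpha> (1 - \<alpha>) * (indicator {0<..<1} t * (t powr (\<alpha> / 2 - 1) * (1 - t) powr (1 - \<alpha> - 1))))"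
      proof (cases "0 < t \<and> t < 1")
        case True
        have "ln (t powr (- \<alpha> / 2)) \<le> t powr (- \<alpha> / 2) - 1" using True by (intro ln_le_minus_one) auto
        moreover have "ln (t powr (- \<alpha> / 2)) = - (\<alpha> / 2) * ln t" using True by (simp add: ln_powr)
        ultimately have "\<alpha> / 2 * (- ln t) \<le> t powr (- \<alpha> / 2)" by linarith
        hence "2 / \<alpha> * (\<alpha> / 2 * (- ln t)) \<le> 2 / \<alpha> * t powr (- \<alpha> / 2)"
          using \<alpha> by (intro mult_left_mono) auto
        hence "- ln t \<le> 2 / \<alpha> * t powr (- \<alpha> / 2)" using \<alpha> by simp
        moreover have "\<bar>ln t\<bar> = - ln t" using True by simp
        ultimately have ln: "\<bar>ln t\<bar> \<le> 2 / \<alpha> * t powr (- \<alpha> / 2)" by simp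
        have "norm (beta_density t * (ln t * t ^ m)) = beta_density t * (\<bar>ln t\<bar> * t ^ m)"
          using True beta_density_nonneg[of t] by (simp add: abs_mult)
        also have "\<dots> \<le> beta_density t * ((2 / \<alpha> * t powr (- \<alpha> / 2)) * 1)"
          using True ln \<alpha> by (intro mult_left_mono mult_mono beta_density_nonneg power_le_one) auto
        also have "\<dots> = 2 / \<alpha> / Beta \<alpha> (1 - \<alpha>) * (t powr (\<alpha> - 1) * t powr (- \<alpha> / 2) * (1 - t) powr (1 - \<alpha> - 1))"
          using True by (simp add: beta_density_def mult_ac)
        also have "t powr (\<alpha> - 1) * t powr (- \<alpha> / 2) = t powr (\<alpha> / 2 - 1)"
          by (simp add: powr_add[symmetric] field_simps)
        also have "2 / \<alpha> / Beta \<alpha> (1 - \<alpha>) * (t powr (\<alpha> / 2 - 1) * (1 - t) powr (1 - \<alpha> - 1)) =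
           norm (2 / \<alpha> / Beta \<alpha> (1 - \<alpha>) * (indicator {0<..<1} t * (t powr (\<alpha> / 2 - 1) * (1 - t) powr (1 - \<alpha> - 1))))"
          using True \<alpha> Beta_pos by (simp add: abs_mult)
        finally show ?thesis .
      qed (auto simp: beta_density_def)
    qed
  qed measurable
qed

text \<open>
  Up to the factor \<open>1 / Beta \<alpha> (1 - \<alpha>)\<close>, the left-hand side is the integral over \<open>(0, 1)\<close> of the derivative
  of \<open>t\<^sup>\<alpha>\<^sup>+\<^sup>m (1 - t)\<^sup>1\<^sup>-\<^sup>\<alpha> ln t\<close>, which vanishes at both ends. It determines the logarithmic moments
  recursively.
\<close>

lemma beta_measure_ln_step:
  "(\<alpha> + real m) * (\<integral>t. ln t * t ^ m \<partial>beta_measure) - (real m + 1) * (\<integral>t. ln t * t ^ Suc m \<partial>beta_measure)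
     + (\<integral>t. t ^ m \<partial>beta_measure) - (\<integral>t. t ^ Suc m \<partial>beta_measure) = 0"
proof -
  define p where "p = (\<lambda>t. (\<alpha> + real m) * (ln t * t ^ m) - (real m + 1) * (ln t * t ^ Suc m) + t ^ m - t ^ Suc m)"
  have pm: "p \<in> borel_measurable borel" unfolding p_def by measurable
  note ints = integrable_mult_right[OF beta_measure_ln[of m], of "\<alpha> + real m"]
    integrable_mult_right[OF beta_measure_ln[of "Suc m"], of "real m + 1"]
    beta_measure_moment(1)[of m] beta_measure_moment(1)[of "Suc m"]
  have pi: "integrable beta_measure p" unfolding p_def using ints by simp
  have pv: "(\<integral>t. p t \<partial>beta_measure) = (\<alpha> + real m) * (\<integral>t. ln t * t ^ m \<partial>beta_measure)
      - (real m + 1) * (\<integral>t. ln t * t ^ Suc m \<partial>beta_measure)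
     + (\<integral>t. t ^ m \<partial>beta_measure) - (\<integral>t. t ^ Suc m \<partial>beta_measure)"
    unfolding p_def using ints by simp
  define b where "b t = t powr (\<alpha> - 1) * (1 - t) powr (- \<alpha>) * p t" for t
  define F where "F t = t powr (\<alpha> + real m) * (1 - t) powr (1 - \<alpha>) * ln t" for t
  have dens: "beta_density t * p t = indicator {0<..<1} t * b t / Beta \<alpha> (1 - \<alpha>)" for t
    by (simp add: beta_density_def b_def)
  have bi: "integrable lborel (\<lambda>t. indicator {0<..<1} t * b t)"
  proof -
    have "integrable lborel (\<lambda>t. Beta \<alpha> (1 - \<alpha>) * (beta_density t * p t))"
      using pi unfolding beta_measure_integral(1)[OF pm] by (rule integrable_mult_right)
    thus ?thesis using Beta_pos by (simp add: dens)
  qed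
  have ein: "einterval 0 1 = {0<..<(1::real)}" by (auto simp: einterval_def zero_ereal_def one_ereal_def)
  have "(LBINT t=0..1. b t) = 0 - 0"
  proof (rule interval_integral_FTC_integrable[where F = F])
    show "(F has_vector_derivative b t) (at t)" if "0 < ereal t" "ereal t < 1" for t
    proof -
      have t: "0 < t" "t < 1" using that by (auto simp: zero_ereal_def one_ereal_def)
      have 1: "t powr (\<alpha> + real m - 1) = t powr (\<alpha> - 1) * t ^ m"
        using t by (simp add: powr_realpow[symmetric] powr_add[symmetric] algebra_simps)
      have 2: "t powr (\<alpha> + real m) = t powr (\<alpha> - 1) * t ^ Suc m"
        using t by (simp add: powr_realpow[symmetric] powr_add[symmetric] algebra_simps del: power_Suc)
      have 3: "(1 - t) powr (1 - \<alpha>) = (1 - t) powr (- \<alpha>) * (1 - t)"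
        using t powr_add[of "1 - t" "- \<alpha>" 1] by simp
      have "(F has_real_derivative
          ((\<alpha> + real m) * t powr (\<alpha> + real m - 1) * (1 - t) powr (1 - \<alpha>) * ln t
           + t powr (\<alpha> + real m) * (- ((1 - \<alpha>) * (1 - t) powr (- \<alpha>))) * ln t
           + t powr (\<alpha> + real m) * (1 - t) powr (1 - \<alpha>) * (1 / t))) (at t)"
        unfolding F_def using t by (auto intro!: derivative_eq_intros simp: algebra_simps)
      moreover have "(\<alpha> + real m) * t powr (\<alpha> + real m - 1) * (1 - t) powr (1 - \<alpha>) * ln t
           + t powr (\<alpha> + real m) * (- ((1 - \<alpha>) * (1 - t) powr (- \<alpha>))) * ln t
           + t powr (\<alpha> + real m) * (1 - t) powr (1 - \<alpha>) * (1 / t) = b t"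
        unfolding b_def p_def 1 2 3 using t by (simp add: field_simps)
      ultimately show ?thesis by (simp add: has_real_derivative_iff_has_vector_derivative)
    qed
    show "isCont b t" if "0 < ereal t" "ereal t < 1" for t
    proof -
      have t: "0 < t" "t < 1" using that by (auto simp: zero_ereal_def one_ereal_def)
      show ?thesis unfolding b_def p_def using t by (auto intro!: continuous_intros)
    qed
    show "set_integrable lborel (einterval 0 1) b" unfolding set_integrable_def ein using bi by simp
    have am: "\<alpha> + real m > 0" using \<alpha> by simp
    show "((F \<circ> real_of_ereal) \<longlongrightarrow> 0) (at_right 0)"
    proof -
      have "((\<lambda>t. t powr (\<alpha> + real m) * ln t) \<longlongrightarrow> 0) (at_right 0)" using am by real_asymp
      moreover have "((\<lambda>t. (1 - t) powr (1 - \<alpha>)) \<longlongrightarrow> (1 - 0) powr (1 - \<alpha>)) (at_right (0::real))"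
        by (intro tendsto_intros) auto
      ultimately have "((\<lambda>t. t powr (\<alpha> + real m) * ln t * (1 - t) powr (1 - \<alpha>)) \<longlongrightarrow> 0 * (1 - 0) powr (1 - \<alpha>)) (at_right 0)"
        by (rule tendsto_mult)
      hence "(F \<longlongrightarrow> 0) (at_right 0)" by (simp add: F_def[abs_def] mult_ac)
      thus ?thesis by (simp add: zero_ereal_def ereal_tendsto_simps)
    qed
    show "((F \<circ> real_of_ereal) \<longlongrightarrow> 0) (at_left 1)"
    proof -
      have "((\<lambda>t. (1 - t) powr (1 - \<alpha>)) \<longlongrightarrow> 0) (at_left 1)" using \<alpha> by real_asymp
      moreover have "((\<lambda>t. t powr (\<alpha> + real m) * ln t) \<longlongrightarrow> 1 powr (\<alpha> + real m) * ln 1) (at_left (1::real))"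
        by (intro tendsto_intros) auto
      ultimately have "((\<lambda>t. (1 - t) powr (1 - \<alpha>) * (t powr (\<alpha> + real m) * ln t)) \<longlongrightarrow> 0 * (1 powr (\<alpha> + real m) * ln 1)) (at_left 1)"
        by (rule tendsto_mult)
      hence "(F \<longlongrightarrow> 0) (at_left 1)" by (simp add: F_def[abs_def] mult_ac)
      thus ?thesis by (simp add: one_ereal_def ereal_tendsto_simps)
    qed
  qed (auto simp: zero_ereal_def one_ereal_def)
  hence "(\<integral>t. indicator {0<..<1} t * b t \<partial>lborel) = 0"
    by (simp add: interval_lebesgue_integral_def set_lebesgue_integral_def ein)
  hence "(\<integral>t. p t \<partial>beta_measure) = 0"
    unfolding beta_measure_integral(2)[OF pm] dens by simp
  thus ?thesis unfolding pv .
qed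

lemma log_moments_beta:
  "log_moments beta_measure (\<lambda>m. pochhammer \<alpha> m / fact m) (\<lambda>m. harm_shift \<alpha> m - harm_shift 1 m)"
  unfolding log_moments_def
proof (intro conjI allI)
  have m0: "emeasure beta_measure (space beta_measure) \<noteq> \<infinity>"
    using beta_measure_moment(1)[of 0] by (simp add: integrable_iff_bounded)
  show "finite_measure beta_measure" by (rule finite_measureI[OF m0])
  show "sets beta_measure = sets borel" by (simp add: beta_measure_def)
  show "AE t in beta_measure. 0 < t \<and> t < 1" unfolding beta_measure_def
    by (subst AE_density) (auto simp: beta_density_def indicator_def intro!: always_eventually split: if_splits)
  show "integrable beta_measure ln" using beta_measure_ln[of 0] by simp
  show "(\<integral>t. t ^ m \<partial>beta_measure) = pochhammer \<alpha> m / fact m" for m by (rule beta_measure_moment(2))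
  show "(\<integral>t. ln t * t ^ m \<partial>beta_measure) = pochhammer \<alpha> m / fact m * (harm_shift \<alpha> m - harm_shift 1 m + (\<integral>t. ln t \<partial>beta_measure))" for m
  proof (induction m)
    case 0
    show ?case by (simp add: harm_shift_def)
  next
    case (Suc m)
    define a where "a = (pochhammer \<alpha> m / fact m :: real)"
    define H where "H = harm_shift \<alpha> m - harm_shift 1 m + (\<integral>t. ln t \<partial>beta_measure)"
    have a': "pochhammer \<alpha> (Suc m) / fact (Suc m) = a * (\<alpha> + real m) / (real m + 1)"
      by (simp add: a_def pochhammer_Suc field_simps)
    have H': "harm_shift \<alpha> (Suc m) - harm_shift 1 (Suc m) + (\<integral>t. ln t \<partial>beta_measure) = H + 1 / (\<alpha> + real m) - 1 / (real m + 1)"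
      by (simp add: H_def harm_shift_def add.commute)
    have am: "\<alpha> + real m > 0" "real m + 1 > 0" using \<alpha> by auto
    have "(\<alpha> + real m) * (a * H) - (real m + 1) * (\<integral>t. ln t * t ^ Suc m \<partial>beta_measure) + a - a * (\<alpha> + real m) / (real m + 1) = 0"
      using beta_measure_ln_step[of m] unfolding Suc.IH beta_measure_moment(2) a' a_def[symmetric] H_def[symmetric] .
    hence "(real m + 1) * (\<integral>t. ln t * t ^ Suc m \<partial>beta_measure) = (\<alpha> + real m) * (a * H) + a - a * (\<alpha> + real m) / (real m + 1)"
      by linarith
    hence "(\<integral>t. ln t * t ^ Suc m \<partial>beta_measure) = ((\<alpha> + real m) * (a * H) + a - a * (\<alpha> + real m) / (real m + 1)) / (real m + 1)"
      by (metis am(2) less_irrefl nonzero_mult_div_cancel_left)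
    also have "\<dots> = a * (\<alpha> + real m) / (real m + 1) * (H + 1 / (\<alpha> + real m) - 1 / (real m + 1))"
      using am by (simp add: divide_simps) (simp add: algebra_simps)
    finally show ?case unfolding a' H' .
  qed
qed (auto simp: harm_shift_def)

end

lemma ex_log_moments:
  assumes "as \<noteq> []" "\<forall>\<alpha>\<in>set as. 0 < \<alpha> \<and> \<alpha> < (1::real)"
  shows "\<exists>M. log_moments M (\<lambda>m. \<Prod>\<alpha>\<leftarrow>as. pochhammer \<alpha> m / fact m) (\<lambda>m. \<Sum>\<alpha>\<leftarrow>as. harm_shift \<alpha> m - harm_shift 1 m)"
  using assms
proof (induction as rule: list_nonempty_induct)
  case (single \<alpha>)
  thus ?case using log_moments_beta[of \<alpha>] by auto
next
  case (cons \<alpha> as)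
  then obtain M where "log_moments M (\<lambda>m. \<Prod>\<alpha>\<leftarrow>as. pochhammer \<alpha> m / fact m) (\<lambda>m. \<Sum>\<alpha>\<leftarrow>as. harm_shift \<alpha> m - harm_shift 1 m)"
    by auto
  from log_moments_convolution[OF log_moments_beta[of \<alpha>] this] show ?case using cons by auto
qed

section \<open>The hypergeometric coefficients\<close>

text \<open>
  The involution \<open>r \<mapsto> N - r\<close> of the totatives pairs \<open>r / N\<close> with \<open>1 - r / N\<close>.
\<close>

lemma sum_totatives:
  assumes "N \<ge> 2"
  shows "(\<Sum>r\<in>totatives N. real r / real N) = real (totient N) / 2"
proof -
  have lt: "r < N" "0 < r" if "r \<in> totatives N" for r using totatives_less[OF that] assms that by (auto simp: in_totatives_iff)
  have mem: "N - r \<in> totatives N" if r: "r \<in> totatives N" for r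
  proof -
    have "gcd (N - r) N = gcd r N" using lt[OF r] by (intro gcd_diff2_nat) simp
    also have "\<dots> = 1" using r by (simp add: in_totatives_iff)
    finally have "coprime (N - r) N" by (rule coprime_iff_gcd_eq_1[THEN iffD2])
    thus ?thesis using lt[OF r] by (simp add: in_totatives_iff)
  qed
  have inv: "N - (N - r) = r" if "r \<in> totatives N" for r using lt[OF that] by simp
  have "(\<Sum>r\<in>totatives N. real r / real N) = (\<Sum>r\<in>totatives N. real (N - r) / real N)"
    by (rule sum.reindex_bij_witness[of _ "\<lambda>r. N - r" "\<lambda>r. N - r"]) (simp_all only: inv mem)
  also have "\<dots> = (\<Sum>r\<in>totatives N. 1 - real r / real N)"
    using lt assms by (intro sum.cong) (auto simp: of_nat_diff less_imp_le diff_divide_distrib)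
  also have "\<dots> = real (totient N) - (\<Sum>r\<in>totatives N. real r / real N)"
    by (simp add: sum_subtractf totient_def)
  finally show ?thesis by simp
qed

text \<open>
  Collecting all fractions \<open>r / N\<close> in one list, with multiplicity, replaces the double products and sums
  over \<open>N\<close> and \<open>r\<close> by products and sums over this list.
\<close>

definition alphas :: "nat list \<Rightarrow> real list" where
  "alphas Ns = concat (map (\<lambda>N. map (\<lambda>r. real r / real N) (sorted_list_of_set (totatives N))) Ns)"

lemma sum_list_totatives: "(\<Sum>r\<leftarrow>sorted_list_of_set (totatives N). g r) = (\<Sum>r\<in>totatives N. g r)"
  using sum.distinct_set_conv_list[of "sorted_list_of_set (totatives N)" g] by simp

lemma prod_list_totatives: "(\<Prod>r\<leftarrow>sorted_list_of_set (totatives N). g r) = (\<Prod>r\<in>totatives N. g r)"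
  using prod.distinct_set_conv_list[of "sorted_list_of_set (totatives N)" g] by simp

lemma length_alphas: "length (alphas Ns) = Phi Ns"
  by (induction Ns) (simp_all add: alphas_def Phi_def totient_def)

lemma sum_alphas:
  assumes "\<forall>N\<in>set Ns. N \<ge> 2"
  shows "sum_list (alphas Ns) = real (Phi Ns) / 2"
  using assms
proof (induction Ns)
  case (Cons N Ns)
  thus ?case using sum_totatives[of N]
    by (simp add: alphas_def Phi_def sum_list_totatives add_divide_distrib)
qed (simp add: alphas_def Phi_def)

lemma alphas_bounds:
  assumes "\<forall>N\<in>set Ns. N \<ge> 2" "\<alpha> \<in> set (alphas Ns)"
  shows "0 < \<alpha>" "\<alpha> < 1"
proof -
  obtain N r where *: "N \<in> set Ns" "r \<in> totatives N" "\<alpha> = real r / real N"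
    using assms(2) by (auto simp: alphas_def)
  have "0 < r" "r < N" using * assms totatives_less[of r N] by (auto simp: in_totatives_iff)
  thus "0 < \<alpha>" "\<alpha> < 1" using * by auto
qed

definition poch_ratio :: "real list \<Rightarrow> nat \<Rightarrow> real" where
  "poch_ratio as m = (\<Prod>\<alpha>\<leftarrow>as. pochhammer \<alpha> m / fact m)"

definition harm_diff :: "real list \<Rightarrow> nat \<Rightarrow> real" where
  "harm_diff as m = (\<Sum>\<alpha>\<leftarrow>as. harm_shift \<alpha> m - harm_shift 1 m)"

lemma B_coeff_eq: "B_coeff Ns m = C_const Ns ^ m * poch_ratio (alphas Ns) m"
proof (induction Ns)
  case (Cons N Ns)
  have "B1 N m = C1 N ^ m * (\<Prod>r\<leftarrow>sorted_list_of_set (totatives N). pochhammer (real r / real N) m / fact m)"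
    unfolding prod_list_totatives B1_def ..
  thus ?case using Cons
    by (simp add: B_coeff_def C_const_def poch_ratio_def alphas_def power_mult_distrib o_def mult_ac)
qed (simp add: B_coeff_def C_const_def poch_ratio_def alphas_def)

lemma H_coeff_eq: "H_coeff Ns m = harm_diff (alphas Ns) m"
proof (induction Ns)
  case (Cons N Ns)
  have "H1 N m = (\<Sum>r\<leftarrow>sorted_list_of_set (totatives N). harm_shift (real r / real N) m - harm_shift 1 m)"
    unfolding sum_list_totatives H1_def by (simp add: sum_subtractf totient_def)
  thus ?case using Cons by (simp add: H_coeff_def harm_diff_def alphas_def o_def)
qed (simp add: H_coeff_def harm_diff_def alphas_def)

lemma C_const_pos:
  assumes "\<forall>N\<in>set Ns. N \<ge> 2"
  shows "C_const Ns > 0"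
  using assms
proof (induction Ns)
  case (Cons N Ns)
  have "C1 N > 0" unfolding C1_def
  proof (intro mult_pos_pos prod_pos zero_less_power)
    fix p assume "p \<in> prime_factors N"
    hence "p > 0" by (intro prime_gt_0_nat) auto
    thus "0 < real p powr (real (totient N) / (real p - 1))" by simp
  qed (use Cons.prems in auto)
  thus ?case using Cons by (simp add: C_const_def)
qed (simp add: C_const_def)

lemma poch_ratio_0: "poch_ratio as 0 = 1"
  unfolding poch_ratio_def by (induction as) simp_all

lemma harm_diff_0: "harm_diff as 0 = 0"
  unfolding harm_diff_def by (induction as) (simp_all add: harm_shift_def)

definition step_ratio :: "real list \<Rightarrow> nat \<Rightarrow> real" where
  "step_ratio as m = (\<Prod>\<alpha>\<leftarrow>as. (\<alpha> + real m) / (real m + 1))"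

lemma poch_ratio_Suc: "poch_ratio as (Suc m) = poch_ratio as m * step_ratio as m"
  unfolding poch_ratio_def step_ratio_def
  by (induction as) (simp_all add: pochhammer_Suc add.commute mult_ac)

context
  fixes as :: "real list"
  assumes as: "\<And>\<alpha>. \<alpha> \<in> set as \<Longrightarrow> 0 < \<alpha> \<and> \<alpha> < 1"
begin

lemma poch_ratio_pos: "poch_ratio as m > 0"
  unfolding poch_ratio_def using as
  by (induction as) (auto intro!: mult_pos_pos divide_pos_pos pochhammer_pos)

lemma step_ratio_pos: "step_ratio as m > 0"
  unfolding step_ratio_def using as
proof (induction as)
  case (Cons \<alpha> as)
  have "0 < \<alpha> + real m" using Cons.prems[of \<alpha>] by simp
  thus ?case using Cons by simp
qed simp

text \<open>
  This is the log-convexity of \<^const>\<open>poch_ratio\<close>. It holds factor by factor, because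
  \<open>(\<alpha> + m) / (m + 1) = 1 - (1 - \<alpha>) / (m + 1)\<close>.
\<close>

lemma step_ratio_mono:
  assumes "m \<le> n" shows "step_ratio as m \<le> step_ratio as n"
  unfolding step_ratio_def using as
proof (induction as)
  case (Cons \<alpha> as)
  have \<alpha>: "0 < \<alpha>" "\<alpha> < 1" using Cons.prems[of \<alpha>] by auto
  have "(\<alpha> + real k) / (real k + 1) = 1 - (1 - \<alpha>) / (real k + 1)" for k by (simp add: field_simps)
  moreover have "(1 - \<alpha>) / (real n + 1) \<le> (1 - \<alpha>) / (real m + 1)" using \<alpha> assms by (intro divide_left_mono) auto
  ultimately have 1: "(\<alpha> + real m) / (real m + 1) \<le> (\<alpha> + real n) / (real n + 1)" by simp
  have 2: "(\<Prod>\<alpha>\<leftarrow>as. (\<alpha> + real m) / (real m + 1)) \<le> (\<Prod>\<alpha>\<leftarrow>as. (\<alpha> + real n) / (real n + 1))"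
    using Cons by simp
  have 3: "0 \<le> (\<Prod>\<alpha>\<leftarrow>as. (\<alpha> + real m) / (real m + 1))"
    by (rule prod_list_nonneg) (use Cons.prems in \<open>auto simp: less_imp_le add_nonneg_nonneg\<close>)
  show ?case using mult_mono[OF 1 2 _ 3] \<alpha> by simp
qed simp

lemma step_ratio_le_exp: "step_ratio as m \<le> exp (- (\<Sum>\<alpha>\<leftarrow>as. 1 - \<alpha>) / (real m + 1))"
  unfolding step_ratio_def using as
proof (induction as)
  case (Cons \<alpha> as)
  have \<alpha>: "0 < \<alpha>" "\<alpha> < 1" using Cons.prems[of \<alpha>] by auto
  have "(\<alpha> + real m) / (real m + 1) = 1 + (- (1 - \<alpha>) / (real m + 1))" by (simp add: field_simps)
  also have "\<dots> \<le> exp (- (1 - \<alpha>) / (real m + 1))" by (rule exp_ge_add_one_self)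
  finally have 1: "(\<alpha> + real m) / (real m + 1) \<le> exp (- (1 - \<alpha>) / (real m + 1))" .
  have 2: "(\<Prod>\<alpha>\<leftarrow>as. (\<alpha> + real m) / (real m + 1)) \<le> exp (- (\<Sum>\<alpha>\<leftarrow>as. 1 - \<alpha>) / (real m + 1))"
    using Cons by simp
  have 3: "0 \<le> (\<Prod>\<alpha>\<leftarrow>as. (\<alpha> + real m) / (real m + 1))"
    by (rule prod_list_nonneg) (use Cons.prems in \<open>auto simp: less_imp_le add_nonneg_nonneg\<close>)
  have "(\<Prod>\<alpha>\<leftarrow>\<alpha> # as. (\<alpha> + real m) / (real m + 1)) \<le> exp (- (1 - \<alpha>) / (real m + 1)) * exp (- (\<Sum>\<alpha>\<leftarrow>as. 1 - \<alpha>) / (real m + 1))"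
    using mult_mono[OF 1 2 _ 3] by simp
  also have "\<dots> = exp (- (\<Sum>\<alpha>\<leftarrow>\<alpha> # as. 1 - \<alpha>) / (real m + 1))"
    unfolding exp_add[symmetric] add_divide_distrib[symmetric] by simp
  finally show ?case .
qed simp

text \<open>
  For \<^term>\<open>alphas Ns\<close>, with all entries of \<open>Ns\<close> at least 2, the sum in the hypothesis is \<open>\<Phi> / 2\<close>. Each step multiplies by at most
  \<open>exp (- 2 / (m + 1))\<close>, and \<open>exp (1 / (m + 1)) \<ge> (m + 2) / (m + 1)\<close>.
\<close>

lemma poch_ratio_le:
  assumes two: "(\<Sum>\<alpha>\<leftarrow>as. 1 - \<alpha>) \<ge> 2"
  shows "poch_ratio as m \<le> 1 / (real m + 1)\<^sup>2"
proof (induction m)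
  case 0
  show ?case by (simp add: poch_ratio_0)
next
  case (Suc m)
  define x where "x = 1 / (real m + 1)"
  have x: "x > 0" by (simp add: x_def)
  have "- (\<Sum>\<alpha>\<leftarrow>as. 1 - \<alpha>) / (real m + 1) \<le> - (2 * x)"
    using two unfolding x_def by (simp add: divide_right_mono)
  hence "step_ratio as m \<le> exp (- (2 * x))" using step_ratio_le_exp[of m] by (meson exp_le_cancel_iff order_trans)
  also have "\<dots> = 1 / (exp x)\<^sup>2" by (simp add: exp_minus exp_double inverse_eq_divide)
  also have "\<dots> \<le> 1 / (1 + x)\<^sup>2" using x exp_ge_add_one_self[of x] by (intro divide_left_mono power_mono mult_pos_pos) auto
  finally have "poch_ratio as (Suc m) \<le> 1 / (real m + 1)\<^sup>2 * (1 / (1 + x)\<^sup>2)"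
    unfolding poch_ratio_Suc using Suc step_ratio_pos[of m] by (intro mult_mono) (auto simp: less_imp_le)
  also have "\<dots> = 1 / ((real m + 1) * (1 + x))\<^sup>2" by (simp add: power_mult_distrib)
  also have "(real m + 1) * (1 + x) = real (Suc m) + 1" by (simp add: x_def field_simps)
  finally show ?case .
qed

lemma harm_diff_mono: "mono (harm_diff as)"
proof (rule mono_iff_le_Suc[THEN iffD2], intro allI)
  fix m
  have "(\<Sum>\<alpha>\<leftarrow>as. harm_shift \<alpha> m - harm_shift 1 m) \<le> (\<Sum>\<alpha>\<leftarrow>as. harm_shift \<alpha> (Suc m) - harm_shift 1 (Suc m))"
  proof (rule sum_list_mono)
    fix \<alpha> assume "\<alpha> \<in> set as"
    hence \<alpha>: "0 < \<alpha>" "\<alpha> < 1" using as by auto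
    have "1 / (1 + real m) \<le> 1 / (\<alpha> + real m)" using \<alpha> by (intro divide_left_mono) auto
    thus "harm_shift \<alpha> m - harm_shift 1 m \<le> harm_shift \<alpha> (Suc m) - harm_shift 1 (Suc m)"
      by (simp add: harm_shift_def)
  qed
  thus "harm_diff as m \<le> harm_diff as (Suc m)" by (simp add: harm_diff_def)
qed

end

section \<open>Kaluza's theorem and power series with nonnegative coefficients\<close>

text \<open>
  Let \<open>a\<close> and \<open>c\<close> be the coefficients of \<open>F\<close> and \<open>1 / F\<close>. Subtracting \<open>r = a\<^sub>m\<^sub>+\<^sub>1 / a\<^sub>m\<close> times the relation
  \<open>\<Sum> c\<^sub>i a\<^sub>m\<^sub>-\<^sub>i = 0\<close> from the one for \<open>m + 1\<close> cancels the term with \<open>i = 0\<close>, and what remains expresses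
  \<open>- c\<^sub>m\<^sub>+\<^sub>1\<close> as the sum of \<open>c\<^sub>i (a\<^sub>m\<^sub>+\<^sub>1\<^sub>-\<^sub>i - r a\<^sub>m\<^sub>-\<^sub>i)\<close> over \<open>1 \<le> i \<le> m\<close>. There the first factor is
  nonpositive by induction and the second by log-convexity.
\<close>

lemma kaluza:
  fixes F :: "real fps"
  assumes F0: "fps_nth F 0 = 1" and pos: "\<And>n. fps_nth F n > 0"
    and logconvex: "\<And>m n. m \<le> n \<Longrightarrow> fps_nth F (Suc m) / fps_nth F m \<le> fps_nth F (Suc n) / fps_nth F n"
  shows "n \<ge> 1 \<Longrightarrow> fps_nth (inverse F) n \<le> 0"
proof (induction n rule: less_induct)
  case (less n)
  define c where "c = fps_nth (inverse F)"
  define a where "a = fps_nth F"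
  have c0: "c 0 = 1" by (simp add: c_def F0)
  have conv: "(\<Sum>i=0..m. c i * a (m - i)) = 0" if "m \<ge> 1" for m
  proof -
    have "inverse F * F = 1" by (rule inverse_mult_eq_1) (simp add: F0)
    hence "fps_nth (inverse F * F) m = 0" using that by simp
    thus ?thesis by (simp add: fps_mult_nth c_def a_def)
  qed
  obtain m where m: "n = Suc m" using less.prems by (cases n) auto
  show ?case
  proof (cases "m = 0")
    case True
    have "c 0 * a 1 + c 1 * a 0 = 0" using conv[of 1] by (simp add: atLeast0_atMost_Suc)
    hence "c 1 = - a 1" using c0 F0 by (simp add: a_def)
    moreover have "a 1 > 0" using pos by (simp add: a_def)
    ultimately show ?thesis using m True by (simp add: c_def)
  next
    case False
    define r where "r = a (Suc m) / a m"
    have am: "a m > 0" using pos by (simp add: a_def)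
    have "0 = (\<Sum>i=0..Suc m. c i * a (Suc m - i)) - r * (\<Sum>i=0..m. c i * a (m - i))"
      using conv[of "Suc m"] conv[of m] False by simp
    also have "(\<Sum>i=0..Suc m. c i * a (Suc m - i)) = (\<Sum>i=0..m. c i * a (Suc m - i)) + c (Suc m)"
      using F0 by (simp add: a_def)
    finally have "- c (Suc m) = (\<Sum>i=0..m. c i * a (Suc m - i)) - (\<Sum>i=0..m. r * (c i * a (m - i)))"
      by (simp add: sum_distrib_left)
    also have "\<dots> = (\<Sum>i=0..m. c i * (a (Suc m - i) - r * a (m - i)))"
      unfolding sum_subtractf[symmetric] by (intro sum.cong) (auto simp: algebra_simps)
    also have "\<dots> \<ge> 0"
    proof (rule sum_nonneg)
      fix i assume i: "i \<in> {0..m}"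
      show "0 \<le> c i * (a (Suc m - i) - r * a (m - i))"
      proof (cases "i = 0")
        case True
        thus ?thesis using am by (simp add: r_def)
      next
        case False
        have "c i \<le> 0" unfolding c_def by (rule less.IH) (use False i m in auto)
        moreover have "a (Suc (m - i)) / a (m - i) \<le> r" unfolding r_def a_def by (rule logconvex) simp
        hence "a (Suc m - i) \<le> r * a (m - i)" using i pos[of "m - i"] by (simp add: a_def Suc_diff_le divide_le_eq)
        ultimately show ?thesis by (intro mult_nonpos_nonpos) auto
      qed
    qed
    finally show ?thesis using m by (simp add: c_def)
  qed
qed

text \<open>
  For \<open>n \<ge> 1\<close> the \<open>n\<close>-th coefficient of \<open>F * (1 / F)\<close> vanishes; subtracting \<open>h n\<close> times it from that of
  \<open>G * (1 / F)\<close> leaves terms with the factors \<open>h i - h n\<close> and \<open>(1 / F)\<^sub>n\<^sub>-\<^sub>i\<close>, both nonpositive for \<open>i < n\<close>.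
\<close>

lemma kaluza_quotient:
  fixes F G :: "real fps"
  assumes F0: "fps_nth F 0 = 1" and pos: "\<And>n. fps_nth F n > 0"
    and logconvex: "\<And>m n. m \<le> n \<Longrightarrow> fps_nth F (Suc m) / fps_nth F m \<le> fps_nth F (Suc n) / fps_nth F n"
    and G: "\<And>n. fps_nth G n = h n * fps_nth F n" and h: "mono h" "h 0 = 0"
  shows "fps_nth (G / F) n \<ge> 0"
proof (cases "n = 0")
  case True
  thus ?thesis using F0 G h by (simp add: fps_divide_unit)
next
  case False
  have u: "fps_nth F 0 \<noteq> 0" using F0 by simp
  have inv: "F * inverse F = 1" using inverse_mult_eq_1[OF u] by (simp add: mult.commute)
  have "0 = h n * fps_nth (F * inverse F) n" using inv False by simp
  also have "\<dots> = (\<Sum>i=0..n. h n * (fps_nth F i * fps_nth (inverse F) (n - i)))"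
    by (simp add: fps_mult_nth sum_distrib_left)
  also have "\<dots> \<le> (\<Sum>i=0..n. fps_nth G i * fps_nth (inverse F) (n - i))"
  proof (rule sum_mono)
    fix i assume i: "i \<in> {0..n}"
    show "h n * (fps_nth F i * fps_nth (inverse F) (n - i)) \<le> fps_nth G i * fps_nth (inverse F) (n - i)"
    proof (cases "i = n")
      case False
      have "h i * fps_nth F i \<le> h n * fps_nth F i" using h(1) i pos[of i] by (intro mult_right_mono) (auto dest: monoD)
      moreover have "fps_nth (inverse F) (n - i) \<le> 0" using kaluza[OF F0 pos logconvex, of "n - i"] False i by auto
      ultimately have "h n * fps_nth F i * fps_nth (inverse F) (n - i) \<le> h i * fps_nth F i * fps_nth (inverse F) (n - i)"
        by (rule mult_right_mono_neg)
      thus ?thesis unfolding G by (simp add: mult.assoc)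
    qed (simp add: G)
  qed
  also have "\<dots> = fps_nth (G / F) n" using u by (simp add: fps_divide_unit fps_mult_nth)
  finally show ?thesis .
qed

lemma of_real_fps_divide:
  fixes F G :: "real fps"
  assumes "fps_nth F 0 \<noteq> 0"
  shows "Abs_fps (\<lambda>n. of_real (fps_nth G n)) / Abs_fps (\<lambda>n. of_real (fps_nth F n)) =
         (Abs_fps (\<lambda>n. of_real (fps_nth (G / F) n)) :: complex fps)" (is "?G / ?F = ?H")
proof -
  have F0: "fps_nth ?F 0 \<noteq> 0" using assms by simp
  have "G = (G / F) * F" using assms by (simp add: fps_divide_unit mult.assoc inverse_mult_eq_1)
  hence "fps_nth G n = (\<Sum>i=0..n. fps_nth (G / F) i * fps_nth F (n - i))" for n by (metis fps_mult_nth)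
  hence "?G = ?H * ?F" by (intro fps_ext) (simp add: fps_mult_nth)
  thus ?thesis using F0 by (simp add: fps_divide_unit mult.assoc inverse_mult_eq_1')
qed

lemma nonneg_fps_exp_compose:
  fixes H :: "complex fps"
  assumes "\<And>n. fps_nth H n \<in> \<real>\<^sub>\<ge>\<^sub>0"
  shows "fps_nth (fps_exp 1 oo H) n \<in> \<real>\<^sub>\<ge>\<^sub>0"
proof -
  have sum_nn: "(\<Sum>i\<in>A. g i) \<in> \<real>\<^sub>\<ge>\<^sub>0" if "\<And>i. i \<in> A \<Longrightarrow> g i \<in> \<real>\<^sub>\<ge>\<^sub>0" for A :: "nat set" and g :: "nat \<Rightarrow> complex"
    using that by (induction A rule: infinite_finite_induct) auto
  have pow: "fps_nth (H ^ i) m \<in> \<real>\<^sub>\<ge>\<^sub>0" for i m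
  proof (induction i arbitrary: m)
    case 0
    show ?case by (cases m) auto
  next
    case (Suc i)
    show ?case unfolding power_Suc fps_mult_nth by (intro sum_nn nonneg_Reals_mult_I assms Suc)
  qed
  have exp_nn: "fps_nth (fps_exp 1) i \<in> (\<real>\<^sub>\<ge>\<^sub>0 :: complex set)" for i
  proof -
    have "fps_nth (fps_exp 1) i = complex_of_real (1 / fact i)" by simp
    moreover have "complex_of_real (1 / fact i) \<in> \<real>\<^sub>\<ge>\<^sub>0" by (simp only: nonneg_Reals_of_real_iff) simp
    ultimately show ?thesis by (simp only:)
  qed
  have "fps_nth (fps_exp 1) i * fps_nth (H ^ i) n \<in> \<real>\<^sub>\<ge>\<^sub>0" for i
    using exp_nn[of i] pow[of i n] by (rule nonneg_Reals_mult_I)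
  hence "(\<Sum>i=0..n. fps_nth (fps_exp 1) i * fps_nth (H ^ i) n) \<in> \<real>\<^sub>\<ge>\<^sub>0" by (rule sum_nn)
  thus ?thesis by (simp only: fps_compose_nth)
qed

text \<open>
  With nonnegative coefficients the partial sums at \<open>\<rho>\<close> are limits of partial sums at points \<open>x < \<rho>\<close>, hence
  at most \<open>q1\<close>; conversely every \<open>q(x)\<close> is at most the sum at \<open>\<rho>\<close>. The bound on increments retains only
  the linear term of the series.
\<close>

lemma nonneg_power_series_boundary:
  fixes S :: "complex fps" and q :: "complex \<Rightarrow> complex"
  assumes \<rho>: "\<rho> > 0" and nn: "\<And>n. fps_nth S n \<in> \<real>\<^sub>\<ge>\<^sub>0" and S1: "fps_nth S 1 = 1"
    and q_exp: "q has_fps_expansion S" and hol: "q holomorphic_on ball 0 \<rho>"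
    and lim: "((\<lambda>x. Re (q (of_real x))) \<longlongrightarrow> q1) (at_left \<rho>)"
  shows "\<And>x. 0 \<le> x \<Longrightarrow> x < \<rho> \<Longrightarrow> q (of_real x) \<in> \<real>"
    and "\<And>a b. 0 \<le> a \<Longrightarrow> a \<le> b \<Longrightarrow> b < \<rho> \<Longrightarrow> b - a \<le> Re (q (of_real b)) - Re (q (of_real a))"
    and "eval_fps S (of_real \<rho>) = of_real q1"
proof -
  define s where "s n = Re (fps_nth S n)" for n
  have s: "fps_nth S n = of_real (s n)" "s n \<ge> 0" for n
    using nn[of n] by (auto simp: s_def nonneg_Reals_def)
  have conv: "fps_conv_radius S \<ge> ereal \<rho>"
  proof -
    have "fps_expansion q 0 = S" by (rule fps_expansion_eqI[OF q_exp])
    moreover have "eball 0 (ereal \<rho>) = ball (0 :: complex) \<rho>" by (auto simp: eball_def dist_norm)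
    ultimately show ?thesis using conv_radius_fps_expansion[of q 0 "ereal \<rho>"] hol by simp
  qed
  have sums: "(\<lambda>n. s n * x ^ n) sums Re (q (of_real x))" and csums: "q (of_real x) \<in> \<real>" if x: "0 \<le> x" "x < \<rho>" for x
  proof -
    have "ereal (norm (complex_of_real x)) < ereal \<rho>" using x by simp
    also note conv
    finally have "ereal (norm (complex_of_real x)) < fps_conv_radius S" .
    hence "summable (\<lambda>n. fps_nth S n * of_real x ^ n)" by (rule summable_fps)
    hence "(\<lambda>n. fps_nth S n * of_real x ^ n) sums eval_fps S (of_real x)"
      unfolding eval_fps_def by (rule summable_sums)
    moreover have "eval_fps S (of_real x) = q (of_real x)"
      by (rule has_fps_expansion_imp_eval_fps_eq[OF q_exp _ hol]) (use x in auto)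
    ultimately have *: "(\<lambda>n. of_real (s n * x ^ n)) sums q (of_real x)" by (simp add: s)
    show "(\<lambda>n. s n * x ^ n) sums Re (q (of_real x))" using sums_Re[OF *] by simp
    show "q (of_real x) \<in> \<real>"
      using sums_unique2[OF sums_Im[OF *]] by (simp add: complex_is_Real_iff)
  qed
  show "q (of_real x) \<in> \<real>" if "0 \<le> x" "x < \<rho>" for x by (rule csums[OF that])
  show "b - a \<le> Re (q (of_real b)) - Re (q (of_real a))" if ab: "0 \<le> a" "a \<le> b" "b < \<rho>" for a b
  proof -
    have d: "(\<lambda>n. s n * b ^ n - s n * a ^ n) sums (Re (q (of_real b)) - Re (q (of_real a)))"
      by (intro sums_diff sums) (use ab in auto)
    have nn: "0 \<le> s n * b ^ n - s n * a ^ n" for n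
      using s(2)[of n] power_mono[OF ab(2,1), of n] by (simp add: mult_left_mono)
    have "(\<Sum>n\<in>{1}. s n * b ^ n - s n * a ^ n) \<le> (Re (q (of_real b)) - Re (q (of_real a)))"
      unfolding sums_unique[OF d] by (rule sum_le_suminf[OF sums_summable[OF d]]) (use nn in auto)
    moreover have "s 1 = 1" using S1 by (simp add: s_def)
    ultimately show ?thesis by simp
  qed
  note mono = this
  have le: "Re (q (of_real x)) \<le> q1" if x: "0 \<le> x" "x < \<rho>" for x
  proof (rule tendsto_lowerbound[OF lim])
    show "\<forall>\<^sub>F y in at_left \<rho>. Re (q (of_real x)) \<le> Re (q (of_real y))"
      using eventually_at_left_real[OF x(2)]
    proof eventually_elim
      case (elim y)
      thus ?case using mono[of x y] x by auto
    qed
  qed simp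
  have bound: "(\<Sum>n<m. s n * \<rho> ^ n) \<le> q1" for m
  proof -
    have "((\<lambda>x. \<Sum>n<m. s n * x ^ n) \<longlongrightarrow> (\<Sum>n<m. s n * \<rho> ^ n)) (at_left \<rho>)"
      by (intro tendsto_intros)
    thus ?thesis
    proof (rule tendsto_upperbound)
      show "\<forall>\<^sub>F x in at_left \<rho>. (\<Sum>n<m. s n * x ^ n) \<le> q1"
        using eventually_at_left_real[OF \<rho>]
      proof eventually_elim
        case (elim x)
        hence x: "0 \<le> x" "x < \<rho>" by auto
        have "(\<Sum>n<m. s n * x ^ n) \<le> Re (q (of_real x))"
          unfolding sums_unique[OF sums[OF x]]
          by (rule sum_le_suminf[OF sums_summable[OF sums[OF x]]]) (use s(2) x in auto)
        thus ?case using le[OF x] by simp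
      qed
    qed simp
  qed
  have summ: "summable (\<lambda>n. s n * \<rho> ^ n)"
    by (rule summableI_nonneg_bounded[OF _ bound]) (use s(2) \<rho> in auto)
  have "(\<Sum>n. s n * \<rho> ^ n) \<le> q1" by (rule suminf_le_const[OF summ bound])
  moreover have "q1 \<le> (\<Sum>n. s n * \<rho> ^ n)"
  proof (rule tendsto_upperbound[OF lim])
    show "\<forall>\<^sub>F x in at_left \<rho>. Re (q (of_real x)) \<le> (\<Sum>n. s n * \<rho> ^ n)"
      using eventually_at_left_real[OF \<rho>]
    proof eventually_elim
      case (elim x)
      hence x: "0 \<le> x" "x < \<rho>" by auto
      show ?case unfolding sums_unique[OF sums[OF x]]
        by (rule suminf_le[OF _ sums_summable[OF sums[OF x]] summ]) (use s(2) x in \<open>auto intro!: mult_left_mono power_mono\<close>)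
    qed
  qed simp
  ultimately have "(\<Sum>n. s n * \<rho> ^ n) = q1" by simp
  moreover have "eval_fps S (of_real \<rho>) = (\<Sum>n. complex_of_real (s n * \<rho> ^ n))"
    by (simp add: eval_fps_def s)
  ultimately show "eval_fps S (of_real \<rho>) = of_real q1" using suminf_of_real[OF summ, where 'a = complex] by simp
qed

section \<open>Stieltjes transforms\<close>

lemma integral_dominated_convergence_within:
  fixes g :: "'a::first_countable_topology \<Rightarrow> 'b \<Rightarrow> 'c::{banach, second_countable_topology}"
  assumes D: "integrable M D"
    and meas: "\<And>u. u \<in> S - {a} \<Longrightarrow> g u \<in> borel_measurable M" "g0 \<in> borel_measurable M"
    and lim: "AE t in M. ((\<lambda>u. g u t) \<longlongrightarrow> g0 t) (at a within S)"
    and bound: "\<And>u. u \<in> S - {a} \<Longrightarrow> AE t in M. norm (g u t) \<le> D t"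
  shows "((\<lambda>u. \<integral>t. g u t \<partial>M) \<longlongrightarrow> (\<integral>t. g0 t \<partial>M)) (at a within S)"
  unfolding tendsto_at_iff_sequentially
proof (intro allI impI)
  fix X :: "nat \<Rightarrow> 'a" assume X: "\<forall>i. X i \<in> S - {a}" "X \<longlonglongrightarrow> a"
  have "(\<lambda>i. \<integral>t. g (X i) t \<partial>M) \<longlonglongrightarrow> (\<integral>t. g0 t \<partial>M)"
  proof (rule integral_dominated_convergence[where w = D])
    show "AE t in M. (\<lambda>i. g (X i) t) \<longlonglongrightarrow> g0 t"
      using lim
    proof eventually_elim
      case (elim t)
      thus ?case using X unfolding tendsto_at_iff_sequentially by (auto simp: o_def)
    qed
    show "AE t in M. norm (g (X i) t) \<le> D t" for i using bound X(1) by blast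
    show "g (X i) \<in> borel_measurable M" for i using meas X(1) by blast
  qed (use D meas in auto)
  thus "((\<lambda>u. \<integral>t. g u t \<partial>M) \<circ> X) \<longlonglongrightarrow> (\<integral>t. g0 t \<partial>M)" by (simp add: o_def)
qed

definition slit_plane :: "complex set" where
  "slit_plane = {z. Im z \<noteq> 0 \<or> Re z < 1}"

lemma open_slit_plane: "open slit_plane"
proof -
  have eq: "slit_plane = {z. Im z < 0} \<union> {z. Im z > 0} \<union> {z. Re z < 1}" by (auto simp: slit_plane_def)
  show ?thesis unfolding eq
    by (intro open_Un open_halfspace_Re_lt open_halfspace_Im_lt open_halfspace_Im_gt)
qed

lemma slit_plane_nonzero:
  assumes "x \<in> slit_plane" "0 \<le> t" "t \<le> 1"
  shows "1 - x * of_real t \<noteq> 0"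
proof
  assume "1 - x * of_real t = 0"
  hence *: "Re (x * of_real t) = 1" "Im (x * of_real t) = 0" by (simp_all add: complex_eq_iff)
  hence "t \<noteq> 0" by auto
  hence "Im x = 0" "Re x * t = 1" using * by simp_all
  moreover from this have "Re x < 1" using assms by (simp add: slit_plane_def)
  ultimately show False using \<open>t \<noteq> 0\<close> assms mult_strict_right_mono[of "Re x" 1 t] by simp
qed

text \<open>
  By compactness of \<open>[0, 1]\<close> the kernel \<open>1 / (1 - x t)\<close> is bounded locally uniformly in \<open>x\<close>, which gives
  dominating functions for differentiation under the integral sign.
\<close>

lemma slit_plane_lower_bound:
  assumes x: "x \<in> slit_plane"
  obtains k where "k > 0" "\<And>x' t. dist x' x < k \<Longrightarrow> 0 \<le> t \<Longrightarrow> t \<le> 1 \<Longrightarrow> k \<le> cmod (1 - x' * of_real t)"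
proof -
  have "\<exists>t\<in>{0..1}. \<forall>s\<in>{0..1}. cmod (1 - x * of_real t) \<le> cmod (1 - x * of_real s)"
    by (rule continuous_attains_inf) (auto intro!: continuous_intros)
  then obtain t0 where t0: "t0 \<in> {0..1}" "\<And>s. s \<in> {0..1} \<Longrightarrow> cmod (1 - x * of_real t0) \<le> cmod (1 - x * of_real s)"
    by blast
  define k where "k = cmod (1 - x * of_real t0) / 2"
  have k: "k > 0" using slit_plane_nonzero[OF x, of t0] t0 by (simp add: k_def)
  show ?thesis
  proof (rule that[OF k])
    fix x' t assume *: "dist x' x < k" "0 \<le> t" "t \<le> (1::real)"
    have "1 - x * of_real t = (1 - x' * of_real t) + (x' - x) * of_real t" by (simp add: algebra_simps)
    hence "cmod (1 - x * of_real t) \<le> cmod (1 - x' * of_real t) + cmod ((x' - x) * of_real t)"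
      by (metis norm_triangle_ineq)
    also have "cmod ((x' - x) * of_real t) \<le> cmod (x' - x) * 1"
      unfolding norm_mult using * by (intro mult_left_mono) auto
    finally show "k \<le> cmod (1 - x' * of_real t)" using t0(2)[of t] * by (simp add: k_def dist_norm)
  qed
qed

locale moment_measure =
  fixes M :: "real measure"
  assumes fin: "finite_measure M" and sets_M: "sets M = sets borel"
    and mass: "measure M (space M) = 1"
    and supp: "AE t in M. 0 < t \<and> t < 1"
begin

sublocale finite_measure M by (rule fin)

lemma meas_eq [simp]: "borel_measurable M = borel_measurable borel"
  by (rule measurable_cong_sets) (simp_all add: sets_M)

text \<open>
  The Stieltjes transform of the measure with density \<open>w\<close> with respect to \<open>M\<close>. The function \<open>J' w\<close> is its
  derivative in \<open>x\<close>.
\<close>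

definition J :: "(real \<Rightarrow> real) \<Rightarrow> complex \<Rightarrow> complex" where
  "J w x = (\<integral>t. of_real (w t) / (1 - x * of_real t) \<partial>M)"

definition J' :: "(real \<Rightarrow> real) \<Rightarrow> complex \<Rightarrow> complex" where
  "J' w x = (\<integral>t. of_real (w t * t) / (1 - x * of_real t)\<^sup>2 \<partial>M)"

lemma bounded_integrable:
  fixes g :: "real \<Rightarrow> 'b :: {banach, second_countable_topology}"
  assumes "integrable M w" "g \<in> borel_measurable borel"
    and "\<And>t. 0 < t \<Longrightarrow> t < 1 \<Longrightarrow> norm (g t) \<le> B * \<bar>w t\<bar>"
  shows "integrable M g"
proof (rule Bochner_Integration.integrable_bound)
  show "integrable M (\<lambda>t. B * \<bar>w t\<bar>)" using assms(1) by auto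
  show "AE t in M. norm (g t) \<le> norm (B * \<bar>w t\<bar>)"
    using supp by eventually_elim (metis assms(3) abs_ge_self order_trans real_norm_def)
qed (use assms in simp)

lemma J_integrable:
  assumes w: "integrable M w" and x: "x \<in> slit_plane"
  shows "integrable M (\<lambda>t. of_real (w t) / (1 - x * of_real t) :: complex)"
proof -
  obtain k where k: "k > 0" "\<And>x' t. dist x' x < k \<Longrightarrow> 0 \<le> t \<Longrightarrow> t \<le> 1 \<Longrightarrow> k \<le> cmod (1 - x' * of_real t)"
    using slit_plane_lower_bound[OF x] by blast
  have wm: "w \<in> borel_measurable borel" using borel_measurable_integrable[OF w] by simp
  show ?thesis
  proof (rule bounded_integrable[OF w, where B = "1 / k"])
    fix t :: real assume t: "0 < t" "t < 1"
    have "\<bar>w t\<bar> / cmod (1 - x * of_real t) \<le> \<bar>w t\<bar> / k"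
      using k(2)[of x t] k(1) t by (intro divide_left_mono mult_pos_pos) auto
    thus "cmod (of_real (w t) / (1 - x * of_real t)) \<le> 1 / k * \<bar>w t\<bar>" by (simp only: norm_divide norm_of_real) simp
  qed (use wm in measurable)
qed

lemma J_deriv:
  assumes w: "integrable M w" and x: "x \<in> slit_plane"
  shows "(J w has_field_derivative J' w x) (at x)"
proof -
  obtain k where k: "k > 0" "\<And>x' t. dist x' x < k \<Longrightarrow> 0 \<le> t \<Longrightarrow> t \<le> 1 \<Longrightarrow> k \<le> cmod (1 - x' * of_real t)"
    using slit_plane_lower_bound[OF x] by blast
  obtain e where e: "e > 0" "ball x e \<subseteq> slit_plane" using open_slit_plane x by (meson openE)
  define S where "S = ball x (min e k)"
  have wm[measurable]: "w \<in> borel_measurable borel" using borel_measurable_integrable[OF w] by simp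
  have D: "((\<lambda>x'. \<integral>t. of_real (w t * t) / ((1 - x' * of_real t) * (1 - x * of_real t)) \<partial>M)
          \<longlongrightarrow> (\<integral>t. of_real (w t * t) / ((1 - x * of_real t) * (1 - x * of_real t)) \<partial>M)) (at x within S)"
  proof (rule integral_dominated_convergence_within[where D = "\<lambda>t. \<bar>w t\<bar> / k\<^sup>2"])
    show "AE t in M. ((\<lambda>x'. of_real (w t * t) / ((1 - x' * of_real t) * (1 - x * of_real t)) :: complex) \<longlongrightarrow>
              of_real (w t * t) / ((1 - x * of_real t) * (1 - x * of_real t))) (at x within S)"
      using supp by eventually_elim (use slit_plane_nonzero[OF x] in \<open>auto intro!: tendsto_intros\<close>)
    fix x' assume x': "x' \<in> S - {x}"
    show "AE t in M. cmod (of_real (w t * t) / ((1 - x' * of_real t) * (1 - x * of_real t))) \<le> \<bar>w t\<bar> / k\<^sup>2"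
      using supp
    proof eventually_elim
      case (elim t)
      have "k * k \<le> cmod (1 - x' * of_real t) * cmod (1 - x * of_real t)"
        using k x' elim by (intro mult_mono) (auto simp: S_def dist_commute)
      moreover have "\<bar>w t\<bar> * t \<le> \<bar>w t\<bar>" using elim by (simp add: mult_left_le)
      ultimately have "\<bar>w t\<bar> * t / (cmod (1 - x' * of_real t) * cmod (1 - x * of_real t)) \<le> \<bar>w t\<bar> / (k * k)"
        using k(1) by (intro frac_le) auto
      thus ?case using elim by (simp add: norm_divide norm_mult power2_eq_square abs_mult)
    qed
  qed (use w in \<open>auto\<close>)
  have "\<forall>\<^sub>F x' in at x within S. (\<integral>t. of_real (w t * t) / ((1 - x' * of_real t) * (1 - x * of_real t)) \<partial>M)
          = (J w x' - J w x) / (x' - x)"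
    unfolding eventually_at_filter
  proof (intro always_eventually allI impI)
    fix x' assume x': "x' \<noteq> x" "x' \<in> S"
    have x'2: "x' \<in> slit_plane" using x' e by (auto simp: S_def)
    have "(J w x' - J w x) = (\<integral>t. of_real (w t) / (1 - x' * of_real t) - of_real (w t) / (1 - x * of_real t) \<partial>M)"
      unfolding J_def by (rule Bochner_Integration.integral_diff[symmetric]) (intro J_integrable w x x'2)+
    also have "\<dots> = (\<integral>t. (x' - x) * (of_real (w t * t) / ((1 - x' * of_real t) * (1 - x * of_real t))) \<partial>M)"
    proof (rule integral_cong_AE)
      show "AE t in M. of_real (w t) / (1 - x' * of_real t) - of_real (w t) / (1 - x * of_real t) =
            (x' - x) * (of_real (w t * t) / ((1 - x' * of_real t) * (1 - x * of_real t)))"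
        using supp
      proof eventually_elim
        case (elim t)
        have "1 - x' * of_real t \<noteq> 0" "1 - x * of_real t \<noteq> 0" using slit_plane_nonzero x x'2 elim by auto
        thus ?case by (simp add: field_simps)
      qed
    qed auto
    also have "\<dots> = (x' - x) * (\<integral>t. of_real (w t * t) / ((1 - x' * of_real t) * (1 - x * of_real t)) \<partial>M)"
      by (rule integral_mult_right_zero)
    finally show "(\<integral>t. of_real (w t * t) / ((1 - x' * of_real t) * (1 - x * of_real t)) \<partial>M)
          = (J w x' - J w x) / (x' - x)" using x' by (simp add: field_simps)
  qed
  from tendsto_cong[THEN iffD1, OF this D]
  have "(J w has_field_derivative J' w x) (at x within S)"
    by (simp add: has_field_derivative_iff J'_def power2_eq_square)
  moreover have "at x within S = at x" unfolding S_def using e k by (intro at_within_open) auto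
  ultimately show ?thesis by simp
qed

lemma J_holomorphic:
  assumes "integrable M w"
  shows "J w holomorphic_on slit_plane"
proof (rule holomorphic_onI)
  fix x assume "x \<in> slit_plane"
  from has_field_derivative_at_within[OF J_deriv[OF assms this]]
  show "J w field_differentiable at x within slit_plane" unfolding field_differentiable_def by blast
qed

lemma integrable_mult_power:
  assumes w: "integrable M w"
  shows "integrable M (\<lambda>t. w t * t ^ n)"
proof (rule bounded_integrable[OF w, where B = 1])
  have [measurable]: "w \<in> borel_measurable borel" using borel_measurable_integrable[OF w] by simp
  show "(\<lambda>t. w t * t ^ n) \<in> borel_measurable borel" by measurable
  show "norm (w t * t ^ n) \<le> 1 * \<bar>w t\<bar>" if "0 < t" "t < 1" for t
    using that power_le_one[of t n] by (simp add: abs_mult mult_left_le)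
qed

lemma J_sums:
  assumes w: "integrable M w" and x: "cmod x < 1"
  shows "(\<lambda>n. of_real (\<integral>t. w t * t ^ n \<partial>M) * x ^ n) sums J w x"
proof -
  define F where "F n t = of_real (w t * t ^ n) * x ^ n" for n t
  have F: "integrable M (F n)" for n unfolding F_def
    by (intro integrable_mult_left integrable_of_real integrable_mult_power w)
  have nF: "norm (F n t) = \<bar>w t * t ^ n\<bar> * cmod x ^ n" for n t 
    unfolding F_def norm_mult norm_power norm_of_real ..
  have "(\<lambda>n. \<integral>t. F n t \<partial>M) sums (\<integral>t. (\<Sum>n. F n t) \<partial>M)"
  proof (rule sums_integral[OF F])
    show "AE t in M. summable (\<lambda>n. norm (F n t))"
      using supp
    proof eventually_elim
      case (elim t)
      have "summable (\<lambda>n. \<bar>w t\<bar> * (t * cmod x) ^ n)"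
      proof (intro summable_mult summable_geometric)
        have "t * cmod x \<le> 1 * cmod x" using elim by (intro mult_right_mono) auto
        thus "norm (t * cmod x) < 1" using elim x by (simp add: abs_mult)
      qed
      moreover have "norm (F n t) = \<bar>w t\<bar> * (t * cmod x) ^ n" for n
        using elim by (simp add: nF abs_mult power_mult_distrib)
      ultimately show ?case by simp
    qed
    show "summable (\<lambda>n. \<integral>t. norm (F n t) \<partial>M)"
    proof (rule summable_comparison_test')
      show "summable (\<lambda>n. (\<integral>t. \<bar>w t\<bar> \<partial>M) * cmod x ^ n)" using x by (intro summable_mult summable_geometric) auto
      fix n :: nat
      have "(\<integral>t. \<bar>w t * t ^ n\<bar> \<partial>M) \<le> (\<integral>t. \<bar>w t\<bar> \<partial>M)"
      proof (rule integral_mono_AE)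
        show "AE t in M. \<bar>w t * t ^ n\<bar> \<le> \<bar>w t\<bar>"
          using supp by eventually_elim (simp add: abs_mult mult_left_le power_le_one)
      qed (use w integrable_mult_power[OF w] in auto)
      moreover have "(\<integral>t. norm (F n t) \<partial>M) = (\<integral>t. \<bar>w t * t ^ n\<bar> \<partial>M) * cmod x ^ n"
        unfolding nF by (rule integral_mult_left_zero)
      ultimately show "norm (\<integral>t. norm (F n t) \<partial>M) \<le> (\<integral>t. \<bar>w t\<bar> \<partial>M) * cmod x ^ n"
        by (auto intro!: mult_right_mono)
    qed
  qed
  moreover have "(\<integral>t. F n t \<partial>M) = of_real (\<integral>t. w t * t ^ n \<partial>M) * x ^ n" for n
    unfolding F_def by (simp add: integral_complex_of_real flip: of_real_mult of_real_power)
  moreover have "(\<integral>t. (\<Sum>n. F n t) \<partial>M) = J w x" unfolding J_def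
  proof (rule integral_cong_AE)
    have [measurable]: "w \<in> borel_measurable borel" using borel_measurable_integrable[OF w] by simp
    show "(\<lambda>t. \<Sum>n. F n t) \<in> borel_measurable M" unfolding F_def meas_eq by measurable
    show "(\<lambda>t. of_real (w t) / (1 - x * of_real t) :: complex) \<in> borel_measurable M" unfolding meas_eq by measurable
    show "AE t in M. (\<Sum>n. F n t) = of_real (w t) / (1 - x * of_real t)"
      using supp
    proof eventually_elim
      case (elim t)
      have "cmod x * t \<le> cmod x * 1" using elim by (intro mult_left_mono) auto
      hence "cmod (x * of_real t) < 1" using elim x by (simp add: norm_mult)
      from sums_mult[OF geometric_sums[OF this], of "of_real (w t)"]
      show ?case by (simp add: F_def sums_iff power_mult_distrib mult_ac)
    qed
  qed
  ultimately show ?thesis by simp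
qed

lemma J_has_fps_expansion:
  assumes w: "integrable M w" and C: "C > 0"
  shows "(\<lambda>z. J w (of_real C * z)) has_fps_expansion Abs_fps (\<lambda>n. of_real (C ^ n * (\<integral>t. w t * t ^ n \<partial>M)))"
    (is "_ has_fps_expansion ?F")
proof -
  have sums: "(\<lambda>n. fps_nth ?F n * z ^ n) sums J w (of_real C * z)" if "cmod z < 1 / C" for z
  proof -
    have "cmod (of_real C * z) < 1" using that C by (simp add: norm_mult field_simps)
    from J_sums[OF w this] show ?thesis by (simp add: power_mult_distrib mult_ac)
  qed
  have "fps_conv_radius ?F \<ge> ereal (1 / C)" unfolding fps_conv_radius_def
  proof (rule conv_radius_geI_ex)
    fix r :: real assume "0 < r" "ereal r < ereal (1 / C)"
    thus "\<exists>z. norm z = r \<and> summable (\<lambda>n. fps_nth ?F n * z ^ n)"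
      using sums_summable[OF sums[of "of_real r"]] by (intro exI[of _ "of_real r"]) auto
  qed
  moreover have "ereal (1 / C) > 0" using C by simp
  ultimately have "fps_conv_radius ?F > 0" by (rule less_le_trans[rotated])
  moreover have "\<forall>\<^sub>F z in nhds 0. eval_fps ?F z = J w (of_real C * z)"
  proof -
    have "\<forall>\<^sub>F z in nhds (0 :: complex). z \<in> ball 0 (1 / C)" using C by (intro eventually_nhds_in_open) auto
    thus ?thesis
    proof eventually_elim
      case (elim z)
      hence "cmod z < 1 / C" by simp
      from sums[OF this] show ?case unfolding eval_fps_def by (simp only: sums_iff)
    qed
  qed
  ultimately show ?thesis by (simp add: has_fps_expansion_def)
qed

lemma integral_pos:
  assumes "integrable M g" "\<And>t. 0 < t \<Longrightarrow> t < 1 \<Longrightarrow> g t > (0::real)"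
  shows "(\<integral>t. g t \<partial>M) > 0"
proof -
  have "(\<integral>t. 0 \<partial>M) < (\<integral>t. g t \<partial>M)"
  proof (rule integral_less_AE_space)
    show "AE t in M. 0 < g t" using supp by eventually_elim (use assms in auto)
    show "emeasure M (space M) \<noteq> 0" using mass by (simp add: emeasure_eq_measure)
  qed (use assms in auto)
  thus ?thesis by simp
qed

text \<open>
  If \<open>Re x < 1\<close>, the integrand has positive real part; otherwise its imaginary part has the sign of
  \<open>Im x \<noteq> 0\<close>.
\<close>

lemma J_1_nonzero:
  assumes x: "x \<in> slit_plane"
  shows "J (\<lambda>_. 1) x \<noteq> 0"
proof -
  have i: "integrable M (\<lambda>t. 1 / (1 - x * of_real t))" using J_integrable[OF _ x, of "\<lambda>_. 1"] by simp
  show ?thesis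
  proof (cases "Re x < 1")
    case True
    have "0 < (\<integral>t. Re (1 / (1 - x * of_real t)) \<partial>M)"
    proof (rule integral_pos)
      fix t :: real assume t: "0 < t" "t < 1"
      have "Re x * t < 1"
      proof -
        have "Re x * t < 1 * t" using t True by (intro mult_strict_right_mono) auto
        with t show ?thesis by linarith
      qed
      hence "Re (1 - x * of_real t) > 0" by simp
      moreover have "Re (1 / z) = Re z / (cmod z)\<^sup>2" for z by (simp add: Re_divide cmod_power2)
      moreover have "cmod (1 - x * of_real t) > 0" using slit_plane_nonzero[OF x, of t] t by simp
      ultimately show "Re (1 / (1 - x * of_real t)) > 0" by (simp only: zero_less_power divide_pos_pos)
    qed (rule integrable_Re[OF i])
    also have "\<dots> = Re (J (\<lambda>_. 1) x)" unfolding J_def of_real_1 by (rule integral_Re[OF i])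
    finally show ?thesis by auto
  next
    case False
    hence im: "Im x \<noteq> 0" using x by (auto simp: slit_plane_def)
    have "0 < (\<integral>t. Im x * Im (1 / (1 - x * of_real t)) \<partial>M)"
    proof (rule integral_pos)
      fix t :: real assume t: "0 < t" "t < 1"
      have "Im (1 / z) = - Im z / (cmod z)\<^sup>2" for z by (simp add: Im_divide cmod_power2)
      hence "Im x * Im (1 / (1 - x * of_real t)) = (Im x)\<^sup>2 * t / (cmod (1 - x * of_real t))\<^sup>2"
        by (simp add: power2_eq_square)
      also have "\<dots> > 0" using im t slit_plane_nonzero[OF x, of t] by (intro divide_pos_pos mult_pos_pos) auto
      finally show "Im x * Im (1 / (1 - x * of_real t)) > 0" .
    qed (intro integrable_mult_right integrable_Im i)
    also have "\<dots> = Im x * Im (J (\<lambda>_. 1) x)" unfolding J_def of_real_1 integral_mult_right_zero integral_Im[OF i] ..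
    finally show ?thesis by auto
  qed
qed

lemma J_of_real:
  "J w (of_real y) = of_real (\<integral>t. w t / (1 - y * t) \<partial>M)"
proof -
  have "J w (of_real y) = (\<integral>t. complex_of_real (w t / (1 - y * t)) \<partial>M)" unfolding J_def by simp
  thus ?thesis by (simp only: integral_complex_of_real)
qed

end

text \<open>
  For \<open>0 \<le> c < 1\<close> this is the sector \<open>\<bar>arg u\<bar> < \<pi> - arccos c\<close> without its vertex; as \<open>c\<close> tends to 1, it
  exhausts the plane cut along the negative real axis.
\<close>

definition sector :: "real \<Rightarrow> complex set" where
  "sector c = {u. Re u > - c * cmod u}"

section \<open>Asymptotics at the singularity\<close>

text \<open>
  On a sector the kernel at \<open>x = 1 - u\<close> is comparable with the real kernel at \<open>y = 1 - \<bar>u\<bar>\<close>. With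
  \<open>s = 1 - t\<close> and \<open>v = \<bar>u\<bar> t\<close> the difference of the squares of the two sides is at least
  \<open>(1 + c) / 2 * (s - v)\<^sup>2\<close>.
\<close>

lemma cone_bound:
  assumes c: "0 \<le> c" "c < 1" and u: "u \<in> sector c" and t: "0 \<le> t" "t \<le> 1"
  shows "sqrt ((1 - c) / 2) * (1 - (1 - cmod u) * t) \<le> cmod (1 - (1 - u) * of_real t)"
proof (rule power2_le_imp_le)
  define s where "s = 1 - t"
  define v where "v = cmod u * t"
  have sv: "0 \<le> s" "0 \<le> v" using t by (auto simp: s_def v_def)
  have "- (c * cmod u) * t \<le> Re u * t" using u t by (intro mult_right_mono) (auto simp: sector_def)
  hence Re: "- c * v \<le> Re u * t" by (simp add: v_def mult_ac)
  have "(cmod (1 - (1 - u) * of_real t))\<^sup>2 = (s + Re u * t)\<^sup>2 + (Im u * t)\<^sup>2"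
    by (simp add: cmod_power2 s_def algebra_simps)
  also have "\<dots> = s\<^sup>2 + 2 * s * (Re u * t) + v\<^sup>2"
    unfolding v_def power_mult_distrib cmod_power2 by (simp add: power2_eq_square algebra_simps)
  also have "\<dots> \<ge> s\<^sup>2 + 2 * s * (- c * v) + v\<^sup>2"
    using Re sv by (intro add_mono mult_left_mono order_refl) auto
  finally have 1: "s\<^sup>2 + 2 * s * (- c * v) + v\<^sup>2 \<le> (cmod (1 - (1 - u) * of_real t))\<^sup>2" .
  have "0 \<le> (1 + c) / 2 * (s - v)\<^sup>2" using c by simp
  also have "\<dots> = s\<^sup>2 + 2 * s * (- c * v) + v\<^sup>2 - (1 - c) / 2 * (s + v)\<^sup>2"
    by (simp add: power2_eq_square field_simps)
  finally have "(1 - c) / 2 * (s + v)\<^sup>2 \<le> s\<^sup>2 + 2 * s * (- c * v) + v\<^sup>2" by simp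
  moreover have "s + v = 1 - (1 - cmod u) * t" by (simp add: s_def v_def algebra_simps)
  ultimately show "(sqrt ((1 - c) / 2) * (1 - (1 - cmod u) * t))\<^sup>2 \<le> (cmod (1 - (1 - u) * of_real t))\<^sup>2"
    using 1 c by (simp add: power_mult_distrib)
qed simp

lemma cone_slit_plane:
  assumes "c < 1" "u \<in> sector c"
  shows "1 - u \<in> slit_plane"
proof (cases "Im u = 0")
  case True
  hence "cmod u = \<bar>Re u\<bar>" by (simp add: cmod_def)
  hence *: "Re u > - c * \<bar>Re u\<bar>" using assms by (simp add: sector_def)
  have "Re u > 0"
  proof (rule ccontr)
    assume "\<not> Re u > 0"
    hence "Re u > c * Re u" "Re u \<le> 0" using * by auto
    moreover have "1 * Re u \<le> c * Re u" using assms(1) \<open>Re u \<le> 0\<close> by (intro mult_right_mono_neg) auto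
    ultimately show False by simp
  qed
  thus ?thesis by (simp add: slit_plane_def)
qed (simp add: slit_plane_def)

lemma neg_ln_bound:
  assumes "0 < t" "t < (1::real)"
  shows "\<bar>ln t\<bar> * t / (1 - t) \<le> 1"
proof -
  have "ln (1 / t) \<le> 1 / t - 1" using assms by (intro ln_le_minus_one) auto
  hence "- ln t \<le> 1 / t - 1" using assms by (simp add: ln_div)
  moreover have "\<bar>ln t\<bar> = - ln t" using assms by simp
  ultimately have "\<bar>ln t\<bar> * t \<le> (1 / t - 1) * t" using assms by (intro mult_right_mono) auto
  also have "\<dots> = 1 - t" using assms by (simp add: field_simps)
  finally have le: "\<bar>ln t\<bar> * t \<le> 1 - t" .
  have p: "0 < 1 - t" using assms by simp
  show ?thesis unfolding pos_divide_le_eq[OF p] mult_1_left by (rule le)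
qed

text \<open>
  The quadratic decay of the moments is what makes \<open>1 / (1 - t)\<close> integrable, so that the transforms of 1
  and \<open>ln\<close> remain finite at \<open>x = 1\<close>.
\<close>

locale quadratic_moment_measure = moment_measure +
  assumes ln_int: "integrable M ln"
    and mom: "(\<integral>t. t ^ n \<partial>M) \<le> 1 / (real n + 1)\<^sup>2"
begin

lemma integrable_power: "integrable M (\<lambda>t. t ^ n)"
  using integrable_mult_power[of "\<lambda>_. 1" n] by simp

text \<open>
  The terms dominate the bound \<open>1 / (n + k + 1)\<^sup>2\<close> for the moments.
\<close>

lemma telescope_sums: "(\<lambda>n. 2 / (real (n + k) + 1) - 2 / (real (n + k) + 2)) sums (2 / (real k + 1))"
proof -
  have "(\<lambda>n. 2 / (real n + (real k + 1))) \<longlonglongrightarrow> 0" by real_asymp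
  from telescope_sums'[OF this] show ?thesis by (simp add: algebra_simps)
qed

text \<open>
  A termwise form of monotone convergence that also bounds the integral.
\<close>

lemma series_integral_le:
  fixes F :: "nat \<Rightarrow> real \<Rightarrow> real"
  assumes F: "\<And>n. integrable M (F n)" "\<And>n t. 0 < t \<Longrightarrow> t < 1 \<Longrightarrow> 0 \<le> F n t"
    and S: "\<And>t. 0 < t \<Longrightarrow> t < 1 \<Longrightarrow> (\<lambda>n. F n t) sums S t" "S \<in> borel_measurable borel"
    and le: "\<And>n. (\<integral>t. F n t \<partial>M) \<le> b n" and b: "b sums B"
  shows "integrable M S" "(\<integral>t. S t \<partial>M) \<le> B"
proof -
  have nonneg: "0 \<le> (\<integral>t. F n t \<partial>M)" for n
  proof (rule integral_nonneg_AE)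
    show "AE t in M. 0 \<le> F n t" using supp by eventually_elim (rule F, auto)
  qed
  have summ: "summable (\<lambda>n. \<integral>t. F n t \<partial>M)"
    by (rule summable_comparison_test'[OF sums_summable[OF b]]) (use le nonneg in auto)
  have nrm: "(\<integral>t. norm (F n t) \<partial>M) = (\<integral>t. F n t \<partial>M)" for n
  proof (rule integral_cong_AE)
    show "F n \<in> borel_measurable M" by (rule borel_measurable_integrable[OF F(1)])
    show "(\<lambda>t. norm (F n t)) \<in> borel_measurable M" by (rule borel_measurable_integrable[OF integrable_norm[OF F(1)]])
    show "AE t in M. norm (F n t) = F n t"
      using supp
    proof eventually_elim
      case (elim t)
      thus ?case using F(2)[of t n] by simp
    qed
  qed
  have AEs: "AE t in M. summable (\<lambda>n. norm (F n t))"
    using supp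
  proof eventually_elim
    case (elim t)
    thus ?case using sums_summable[OF S(1), of t] F(2) by simp
  qed
  have AEq: "AE t in M. (\<Sum>n. F n t) = S t"
    using supp by eventually_elim (use S(1) sums_unique in metis)
  note * = integrable_suminf[OF F(1) AEs, unfolded nrm, OF summ]
    sums_integral[OF F(1) AEs, unfolded nrm, OF summ]
  have m1: "(\<lambda>t. \<Sum>n. F n t) \<in> borel_measurable M" using borel_measurable_integrable[OF *(1)] .
  have m2: "S \<in> borel_measurable M" using S(2) by simp
  show "integrable M S" using integrable_cong_AE[OF m1 m2 AEq] *(1) by simp
  have "(\<lambda>n. \<integral>t. F n t \<partial>M) sums (\<integral>t. S t \<partial>M)"
    using *(2) integral_cong_AE[OF m1 m2 AEq] by simp
  thus "(\<integral>t. S t \<partial>M) \<le> B" by (rule sums_le[OF le _ b])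
qed

lemma inverse_moments:
  "integrable M (\<lambda>t. t ^ k / (1 - t))" "(\<integral>t. t ^ k / (1 - t) \<partial>M) \<le> 2 / (real k + 1)"
proof -
  have le: "(\<integral>t. t ^ (n + k) \<partial>M) \<le> 2 / (real (n + k) + 1) - 2 / (real (n + k) + 2)" for n
  proof -
    have "1 / (x + 1)\<^sup>2 \<le> 2 / (x + 1) - 2 / (x + 2)" if "x \<ge> 0" for x :: real
      using that by (simp add: divide_simps power2_eq_square)
    from this[of "real (n + k)"] mom[of "n + k"] show ?thesis by simp
  qed
  have geo: "(\<lambda>n. t ^ (n + k)) sums (t ^ k / (1 - t))" if "0 < t" "t < 1" for t :: real
    using sums_mult[OF geometric_sums[of t], of "t ^ k"] that by (simp add: power_add mult_ac)
  show "integrable M (\<lambda>t. t ^ k / (1 - t))" "(\<integral>t. t ^ k / (1 - t) \<partial>M) \<le> 2 / (real k + 1)"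
    by (rule series_integral_le[OF integrable_power _ geo _ le telescope_sums]; simp)+
qed

lemma inv1_int: "integrable M (\<lambda>t. 1 / (1 - t))"
  using inverse_moments(1)[of 0] by simp

text \<open>
  Expanding \<open>(1 - y t)\<^sup>-\<^sup>2\<close> in powers of \<open>t\<close> bounds the integral by \<open>\<Sum> 2 y\<^sup>n\<close>. For the function
  \<open>K(y) = \<integral> t / ((1 - t) (1 - y t)) dM\<close> it follows that \<open>(1 - y) K'(y)\<close> stays bounded as \<open>y\<close> tends to 1,
  even if \<open>K(y)\<close> does not.
\<close>

lemma slow_variation:
  assumes y: "0 \<le> y" "y < 1"
  shows "integrable M (\<lambda>t. 1 / ((1 - t) * (1 - y * t)\<^sup>2))"
    and "(1 - y) * (\<integral>t. 1 / ((1 - t) * (1 - y * t)\<^sup>2) \<partial>M) \<le> 2"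
proof -
  define F where "F n t = (real n + 1) * y ^ n * (t ^ n / (1 - t))" for n t
  have F: "integrable M (F n)" for n unfolding F_def by (intro integrable_mult_right inverse_moments)
  have F0: "0 \<le> F n t" if "0 < t" "t < 1" for n t using that y by (simp add: F_def)
  have le: "(\<integral>t. F n t \<partial>M) \<le> 2 * y ^ n" for n
  proof -
    have "(\<integral>t. F n t \<partial>M) = (real n + 1) * y ^ n * (\<integral>t. t ^ n / (1 - t) \<partial>M)"
      unfolding F_def by (rule integral_mult_right_zero)
    also have "\<dots> \<le> (real n + 1) * y ^ n * (2 / (real n + 1))"
      using y by (intro mult_left_mono inverse_moments) auto
    also have "\<dots> = 2 * y ^ n" by (simp add: field_simps)
    finally show ?thesis .
  qed
  have geo: "(\<lambda>n. 2 * y ^ n) sums (2 * (1 / (1 - y)))" by (intro sums_mult geometric_sums) (use y in auto)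
  have der: "(\<lambda>n. F n t) sums (1 / ((1 - t) * (1 - y * t)\<^sup>2))" if "0 < t" "t < 1" for t
  proof -
    have "y * t < 1" using that y mult_strict_mono[of y 1 t 1] by simp
    hence "norm (y * t) < 1" using that y by (simp add: abs_mult)
    from sums_divide[OF geometric_deriv_sums[OF this], of "1 - t"]
    show ?thesis by (simp add: F_def power_mult_distrib mult_ac add_ac)
  qed
  have m: "(\<lambda>t. 1 / ((1 - t) * (1 - y * t)\<^sup>2)) \<in> borel_measurable (borel :: real measure)" by measurable
  note * = series_integral_le[OF F F0 der m le geo]
  show "integrable M (\<lambda>t. 1 / ((1 - t) * (1 - y * t)\<^sup>2))" by (rule *(1))
  show "(1 - y) * (\<integral>t. 1 / ((1 - t) * (1 - y * t)\<^sup>2) \<partial>M) \<le> 2" using *(2) y by (simp add: field_simps)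
qed

text \<open>
  These are the values at \<open>x = 1\<close> of the transforms of 1 and of \<open>ln\<close>; the quotient of the second by the
  first is there \<open>- lam\<close>.
\<close>

definition f1 :: real where "f1 = (\<integral>t. 1 / (1 - t) \<partial>M)"
definition e1 :: real where "e1 = (\<integral>t. ln t / (1 - t) \<partial>M)"
definition lam :: real where "lam = - e1 / f1"
definition kern :: "real \<Rightarrow> real" where "kern t = t / (1 - t)"
text \<open>
  This weight has the property that \<open>- (1 - x) J wt x / J 1 x\<close> is the difference between \<open>J ln / J 1\<close> at
  \<open>x\<close> and its value at 1, see \<open>quotient_at_1\<close>.
\<close>

definition wt :: "real \<Rightarrow> real" where "wt t = (lam + ln t) * kern t"

lemma meas_kern_wt [measurable]: "kern \<in> borel_measurable borel" "wt \<in> borel_measurable borel"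
  unfolding kern_def wt_def by measurable

lemma ln_diwt_int: "integrable M (\<lambda>t. ln t / (1 - t))"
proof (rule bounded_integrable[where w = "\<lambda>t. \<bar>ln t\<bar> + 1" and B = 1])
  show "integrable M (\<lambda>t. \<bar>ln t\<bar> + 1)" using ln_int by auto
  fix t :: real assume t: "0 < t" "t < 1"
  have "\<bar>ln t\<bar> / (1 - t) = \<bar>ln t\<bar> + \<bar>ln t\<bar> * t / (1 - t)" using t by (simp add: field_simps)
  also have "\<dots> \<le> \<bar>ln t\<bar> + 1" using neg_ln_bound[OF t] by simp
  finally show "norm (ln t / (1 - t)) \<le> 1 * \<bar>\<bar>ln t\<bar> + 1\<bar>" using t by (simp only: norm_divide real_norm_def) simp
qed measurable

lemma f1_pos: "f1 > 0" unfolding f1_def by (rule integral_pos[OF inv1_int]) auto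

lemma lam_pos: "lam > 0"
proof -
  have "0 < (\<integral>t. - (ln t / (1 - t)) \<partial>M)"
  proof (rule integral_pos)
    show "integrable M (\<lambda>t. - (ln t / (1 - t)))" using ln_diwt_int by auto
    show "- (ln t / (1 - t)) > 0" if "0 < t" "t < 1" for t :: real
      using that ln_less_zero[of t] by (simp add: divide_neg_pos)
  qed
  hence "e1 < 0" by (simp add: e1_def)
  thus ?thesis using f1_pos by (simp add: lam_def divide_neg_pos)
qed

lemma lam_int: "integrable M (\<lambda>t. (lam + ln t) / (1 - t))" "(\<integral>t. (lam + ln t) / (1 - t) \<partial>M) = 0"
proof -
  have eq: "(\<lambda>t. (lam + ln t) / (1 - t)) = (\<lambda>t. lam * (1 / (1 - t)) + ln t / (1 - t))"
    by (simp add: fun_eq_iff add_divide_distrib)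
  show "integrable M (\<lambda>t. (lam + ln t) / (1 - t))"
    unfolding eq by (intro Bochner_Integration.integrable_add integrable_mult_right inv1_int ln_diwt_int)
  have "(\<integral>t. (lam + ln t) / (1 - t) \<partial>M) = (\<integral>t. lam * (1 / (1 - t)) \<partial>M) + e1"
    unfolding eq e1_def
    by (rule Bochner_Integration.integral_add) (intro integrable_mult_right inv1_int ln_diwt_int)+
  also have "\<dots> = lam * f1 + e1" unfolding f1_def integral_mult_right_zero ..
  also have "\<dots> = 0" using f1_pos by (simp add: lam_def)
  finally show "(\<integral>t. (lam + ln t) / (1 - t) \<partial>M) = 0" .
qed

lemma wt_bound:
  assumes "0 < t" "t < 1"
  shows "\<bar>wt t\<bar> \<le> lam * kern t + 1"
proof -
  have "\<bar>wt t\<bar> = \<bar>lam + ln t\<bar> * kern t" using assms by (simp add: wt_def kern_def abs_mult)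
  also have "\<dots> \<le> (lam + \<bar>ln t\<bar>) * kern t" 
    using assms lam_pos abs_triangle_ineq[of lam "ln t"] by (intro mult_right_mono) (simp_all add: kern_def)
  also have "\<dots> = lam * kern t + \<bar>ln t\<bar> * t / (1 - t)" by (simp add: kern_def algebra_simps)
  also have "\<dots> \<le> lam * kern t + 1" using neg_ln_bound[OF assms] by simp
  finally show ?thesis .
qed

lemma kern_int: "integrable M kern" unfolding kern_def using inverse_moments(1)[of 1] by simp

lemma wt_int: "integrable M wt"
proof (rule bounded_integrable[where w = "\<lambda>t. lam * kern t + 1" and B = 1])
  show "integrable M (\<lambda>t. lam * kern t + 1)" using kern_int by auto
  show "norm (wt t) \<le> 1 * \<bar>lam * kern t + 1\<bar>" if "0 < t" "t < 1" for t using wt_bound[OF that] by simp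
qed measurable

text \<open>
  Integrate \<open>1 / (1 - x t) = 1 / (1 - t) - (1 - x) t / ((1 - t) (1 - x t))\<close>.
\<close>

lemma J_expand_at_1:
  assumes w: "integrable M (\<lambda>t. w t / (1 - t))" and wi: "integrable M w" "integrable M (\<lambda>t. w t * kern t)"
    and x: "x \<in> slit_plane"
  shows "J w x = of_real (\<integral>t. w t / (1 - t) \<partial>M) - (1 - x) * J (\<lambda>t. w t * kern t) x"
proof -
  have [measurable]: "w \<in> borel_measurable borel" using borel_measurable_integrable[OF wi(1)] by simp
  have "J w x = (\<integral>t. of_real (w t / (1 - t)) - (1 - x) * (of_real (w t * kern t) / (1 - x * of_real t)) \<partial>M)"
    unfolding J_def
  proof (rule integral_cong_AE)
    show "AE t in M. of_real (w t) / (1 - x * of_real t) = of_real (w t / (1 - t)) - (1 - x) * (of_real (w t * kern t) / (1 - x * of_real t))"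
      using supp
    proof eventually_elim
      case (elim t)
      have a: "1 - x * of_real t \<noteq> 0" using slit_plane_nonzero x elim by auto
      have b: "(1 - of_real t :: complex) \<noteq> 0" using elim by (simp add: complex_eq_iff)
      have c: "1 / (1 - x * of_real t) = 1 / (1 - of_real t) - (1 - x) * (of_real t / (1 - of_real t) / (1 - x * of_real t))"
        using a b by (simp add: divide_simps) (simp add: algebra_simps)
      have "of_real (w t) / (1 - x * of_real t) = of_real (w t) * (1 / (1 - x * of_real t))" by simp
      also have "\<dots> = of_real (w t / (1 - t)) - (1 - x) * (of_real (w t * kern t) / (1 - x * of_real t))"
        unfolding c by (simp add: kern_def algebra_simps)
      finally show ?case .
    qed
    show "(\<lambda>t. of_real (w t) / (1 - x * of_real t) :: complex) \<in> borel_measurable M" unfolding meas_eq by measurable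
    show "(\<lambda>t. of_real (w t / (1 - t)) - (1 - x) * (of_real (w t * kern t) / (1 - x * of_real t)) :: complex) \<in> borel_measurable M"
      unfolding meas_eq by measurable
  qed
  also have "\<dots> = (\<integral>t. complex_of_real (w t / (1 - t)) \<partial>M) - (\<integral>t. (1 - x) * (of_real (w t * kern t) / (1 - x * of_real t)) \<partial>M)"
    by (rule Bochner_Integration.integral_diff) (intro integrable_of_real w integrable_mult_right J_integrable wi x)+
  also have "\<dots> = of_real (\<integral>t. w t / (1 - t) \<partial>M) - (1 - x) * J (\<lambda>t. w t * kern t) x"
    unfolding J_def integral_complex_of_real integral_mult_right_zero ..
  finally show ?thesis .
qed

lemma J_add_scale:
  assumes "integrable M w1" "integrable M w2" "x \<in> slit_plane"
  shows "J (\<lambda>t. a * w1 t + w2 t) x = of_real a * J w1 x + J w2 x"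
proof -
  have "J (\<lambda>t. a * w1 t + w2 t) x =
     (\<integral>t. of_real a * (of_real (w1 t) / (1 - x * of_real t)) + of_real (w2 t) / (1 - x * of_real t) \<partial>M)"
    unfolding J_def by (simp add: add_divide_distrib)
  also have "\<dots> = (\<integral>t. of_real a * (of_real (w1 t) / (1 - x * of_real t)) \<partial>M) + J w2 x"
    unfolding J_def by (rule Bochner_Integration.integral_add) (intro integrable_mult_right J_integrable assms)+
  finally show ?thesis unfolding J_def integral_mult_right_zero .
qed

lemma quotient_at_1:
  assumes x: "x \<in> slit_plane"
  shows "J ln x / J (\<lambda>_. 1) x = - of_real lam - (1 - x) * (J wt x / J (\<lambda>_. 1) x)"
proof -
  have "of_real lam * J (\<lambda>_. 1) x + J ln x = J (\<lambda>t. lam * 1 + ln t) x"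
    by (rule J_add_scale[symmetric]) (use ln_int x in auto)
  also have "\<dots> = J (\<lambda>t. lam + ln t) x" by simp
  also have "\<dots> = - ((1 - x) * J wt x)"
  proof -
    have "integrable M (\<lambda>t. (lam + ln t) * kern t)" using wt_int by (simp add: wt_def[abs_def])
    from J_expand_at_1[OF lam_int(1) _ this x] show ?thesis using ln_int by (simp add: lam_int wt_def[abs_def])
  qed
  finally have "J ln x = - of_real lam * J (\<lambda>_. 1) x - (1 - x) * J wt x" by (simp add: algebra_simps)
  thus ?thesis using J_1_nonzero[OF x] by (simp add: field_simps)
qed

lemma norm_integral_le:
  fixes h :: "real \<Rightarrow> complex"
  assumes g: "integrable M g" and h: "h \<in> borel_measurable borel"
    and le: "\<And>t. 0 < t \<Longrightarrow> t < 1 \<Longrightarrow> cmod (h t) \<le> g t"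
  shows "cmod (\<integral>t. h t \<partial>M) \<le> (\<integral>t. g t \<partial>M)"
proof -
  have hi: "integrable M h"
    by (rule bounded_integrable[OF g h, where B = 1]) (use le abs_ge_self order_trans in \<open>fastforce\<close>)
  have "cmod (\<integral>t. h t \<partial>M) \<le> (\<integral>t. cmod (h t) \<partial>M)" by (rule integral_norm_bound)
  also have "\<dots> \<le> (\<integral>t. g t \<partial>M)"
  proof (rule integral_mono_AE)
    show "AE t in M. cmod (h t) \<le> g t" using supp by eventually_elim (rule le, auto)
  qed (use hi g in auto)
  finally show ?thesis .
qed

text \<open>
  Division by \<open>n\<close> makes the transform of \<open>wt\<close> converge on the sector and its derivative negligible
  compared with \<open>1 / u\<close>. The two relevant cases are \<open>n = 1\<close>, \<open>\<nu> = 1\<close> and \<open>n\<close> tending to infinity, \<open>\<nu> = 0\<close>.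
  The condition \<open>\<alpha> + \<nu> > 0\<close> will keep the derivative of \<open>q\<close> away from 0.
\<close>

definition normaliser :: "real \<Rightarrow> (complex \<Rightarrow> real) \<Rightarrow> real \<Rightarrow> real \<Rightarrow> bool" where
  "normaliser b n \<nu> \<alpha> \<longleftrightarrow> (\<forall>u. n u > 0) \<and> \<nu> \<ge> 0 \<and> \<alpha> \<ge> 0 \<and> \<alpha> + \<nu> > 0 \<and>
     ((\<lambda>u. complex_of_real (1 / n u)) \<longlongrightarrow> of_real \<nu>) (at 0 within sector b) \<and>
     ((\<lambda>u. J wt (1 - u) / of_real (n u)) \<longlongrightarrow> of_real \<alpha>) (at 0 within sector b) \<and>
     ((\<lambda>u. u * J' wt (1 - u) / of_real (n u)) \<longlongrightarrow> 0) (at 0 within sector b)"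

text \<open>
  The transform of \<open>kern\<close> on the real axis. If it is unbounded near 1, then
  \<open>1 + Kr (1 - \<bar>u\<bar>)\<close> serves as normaliser.
\<close>

definition Kr :: "real \<Rightarrow> real" where "Kr y = (\<integral>t. kern t / (1 - y * t) \<partial>M)"

context
  fixes c \<kappa> :: real
  assumes c: "0 \<le> c" "c < 1" and \<kappa>: "\<kappa> = sqrt ((1 - c) / 2)"
begin

lemma \<kappa>_pos: "\<kappa> > 0" using c \<kappa> by simp

lemma cone_lower:
  assumes u: "u \<in> sector c" and t: "0 < t" "t < 1"
  shows "\<kappa> * (1 - (1 - cmod u) * t) \<le> cmod (1 - (1 - u) * of_real t)"
    and "\<kappa> * (1 - t) \<le> cmod (1 - (1 - u) * of_real t)"
    and "\<kappa> * (cmod u * t) \<le> cmod (1 - (1 - u) * of_real t)"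
proof -
  show 1: "\<kappa> * (1 - (1 - cmod u) * t) \<le> cmod (1 - (1 - u) * of_real t)"
    unfolding \<kappa> using cone_bound[OF c u] t by simp
  have "1 - (1 - cmod u) * t = (1 - t) + cmod u * t" by (simp add: algebra_simps)
  moreover have "0 \<le> cmod u * t" "0 \<le> 1 - t" using t by auto
  ultimately have "1 - t \<le> 1 - (1 - cmod u) * t" "cmod u * t \<le> 1 - (1 - cmod u) * t" by linarith+
  from this[THEN mult_left_mono, of \<kappa>] 1 \<kappa>_pos
  show "\<kappa> * (1 - t) \<le> cmod (1 - (1 - u) * of_real t)"
    and "\<kappa> * (cmod u * t) \<le> cmod (1 - (1 - u) * of_real t)" by linarith+
qed

lemma kernel_tendsto:
  assumes "0 < t" "t < 1"
  shows "((\<lambda>u. a / (1 - (1 - u) * of_real t)) \<longlongrightarrow> a / (1 - of_real t :: complex)) (at 0 within S)"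
    and "((\<lambda>u. u * (a / (1 - (1 - u) * of_real t)\<^sup>2)) \<longlongrightarrow> 0) (at 0 within S)"
proof -
  have nz: "1 - complex_of_real t \<noteq> 0" using assms by (simp add: complex_eq_iff)
  show "((\<lambda>u. a / (1 - (1 - u) * of_real t)) \<longlongrightarrow> a / (1 - of_real t :: complex)) (at 0 within S)"
    and "((\<lambda>u. u * (a / (1 - (1 - u) * of_real t)\<^sup>2)) \<longlongrightarrow> 0) (at 0 within S)"
    using nz by (auto intro!: tendsto_eq_intros)
qed

text \<open>
  Dominated convergence: on the sector \<open>\<bar>1 - x t\<bar> \<ge> \<kappa> (1 - t)\<close>.
\<close>

lemma J_cone_limit:
  assumes w: "integrable M (\<lambda>t. w t / (1 - t))" and [measurable]: "w \<in> borel_measurable borel"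
  shows "((\<lambda>u. J w (1 - u)) \<longlongrightarrow> of_real (\<integral>t. w t / (1 - t) \<partial>M)) (at 0 within sector c)"
  unfolding J_def integral_complex_of_real[symmetric]
proof (rule integral_dominated_convergence_within[where D = "\<lambda>t. 1 / \<kappa> * \<bar>w t / (1 - t)\<bar>"])
  show "integrable M (\<lambda>t. 1 / \<kappa> * \<bar>w t / (1 - t)\<bar>)" by (intro integrable_mult_right integrable_abs w)
  show "AE t in M. ((\<lambda>u. of_real (w t) / (1 - (1 - u) * of_real t)) \<longlongrightarrow> complex_of_real (w t / (1 - t))) (at 0 within sector c)"
    using supp
  proof eventually_elim
    case (elim t)
    from kernel_tendsto(1)[of t "of_real (w t)" "sector c"] elim show ?case by simp
  qed
  fix u assume u: "u \<in> sector c - {0}"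
  show "AE t in M. cmod (of_real (w t) / (1 - (1 - u) * of_real t)) \<le> 1 / \<kappa> * \<bar>w t / (1 - t)\<bar>"
    using supp
  proof eventually_elim
    case (elim t)
    have "\<bar>w t\<bar> / cmod (1 - (1 - u) * of_real t) \<le> \<bar>w t\<bar> / (\<kappa> * (1 - t))"
      using cone_lower(2)[of u t] u elim \<kappa>_pos by (intro frac_le) auto
    also have "\<dots> = 1 / \<kappa> * \<bar>w t / (1 - t)\<bar>" using elim by (simp add: abs_divide)
    finally show ?case unfolding norm_divide norm_of_real .
  qed
qed (unfold meas_eq, measurable)

text \<open>
  The product of the lower bounds \<open>\<kappa> (1 - t)\<close> and \<open>\<kappa> \<bar>u\<bar> t\<close> for \<open>\<bar>1 - x t\<bar>\<close> absorbs the factor \<open>u t\<close>.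
\<close>

lemma J'_cone_limit:
  assumes w: "integrable M (\<lambda>t. w t / (1 - t))" and [measurable]: "w \<in> borel_measurable borel"
  shows "((\<lambda>u. u * J' w (1 - u)) \<longlongrightarrow> 0) (at 0 within sector c)"
proof -
  have "((\<lambda>u. \<integral>t. u * (of_real (w t * t) / (1 - (1 - u) * of_real t)\<^sup>2) \<partial>M) \<longlongrightarrow> (\<integral>t. 0 \<partial>M)) (at 0 within sector c)"
  proof (rule integral_dominated_convergence_within[where D = "\<lambda>t. 1 / \<kappa>\<^sup>2 * \<bar>w t / (1 - t)\<bar>"])
    show "integrable M (\<lambda>t. 1 / \<kappa>\<^sup>2 * \<bar>w t / (1 - t)\<bar>)" by (intro integrable_mult_right integrable_abs w)
    show "AE t in M. ((\<lambda>u. u * (of_real (w t * t) / (1 - (1 - u) * of_real t)\<^sup>2)) \<longlongrightarrow> 0) (at 0 within sector c)"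
      using supp by eventually_elim (rule kernel_tendsto, auto)
    fix u assume u: "u \<in> sector c - {0}"
    show "AE t in M. cmod (u * (of_real (w t * t) / (1 - (1 - u) * of_real t)\<^sup>2)) \<le> 1 / \<kappa>\<^sup>2 * \<bar>w t / (1 - t)\<bar>"
      using supp
    proof eventually_elim
      case (elim t)
      define d where "d = cmod (1 - (1 - u) * of_real t)"
      have "(\<kappa> * (1 - t)) * (\<kappa> * (cmod u * t)) \<le> d * d"
        using cone_lower(2,3)[of u t] u elim \<kappa>_pos unfolding d_def by (intro mult_mono) auto
      hence "(cmod u * t) * \<bar>w t\<bar> / d\<^sup>2 \<le> (cmod u * t) * \<bar>w t\<bar> / ((\<kappa> * (1 - t)) * (\<kappa> * (cmod u * t)))"
        using u elim \<kappa>_pos by (intro frac_le) (auto simp: power2_eq_square)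
      also have "\<dots> = 1 / \<kappa>\<^sup>2 * \<bar>w t / (1 - t)\<bar>" using u elim \<kappa>_pos by (simp add: abs_divide field_simps power2_eq_square)
      finally show ?case using elim by (simp add: norm_mult norm_divide norm_power abs_mult d_def mult_ac)
    qed
  qed (unfold meas_eq, measurable)
  thus ?thesis unfolding J'_def integral_mult_right_zero by simp
qed

text \<open>
  Chebyshev's argument: with respect to \<open>dM / (1 - t)\<close> the increasing function \<open>lam + ln t\<close> has integral 0.
  Subtracting from the increasing function \<open>kern t\<close> its value at the zero \<open>s\<close> of \<open>lam + ln\<close> therefore
  does not change the integral and makes the integrand nonnegative.
\<close>

lemma limit_integral_nonneg:
  assumes i: "integrable M (\<lambda>t. wt t / (1 - t))"
  shows "0 \<le> (\<integral>t. wt t / (1 - t) \<partial>M)"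
proof -
  define s where "s = exp (- lam)"
  have s: "0 < s" "s < 1" "ln s = - lam" using lam_pos by (auto simp: s_def)
  have "0 \<le> (\<integral>t. wt t / (1 - t) - kern s * ((lam + ln t) / (1 - t)) \<partial>M)"
  proof (rule integral_nonneg_AE)
    show "AE t in M. 0 \<le> wt t / (1 - t) - kern s * ((lam + ln t) / (1 - t))"
      using supp
    proof eventually_elim
      case (elim t)
      have mono: "kern x \<le> kern y" if "0 < x" "x \<le> y" "y < 1" for x y :: real
        unfolding kern_def using that by (intro frac_le) auto
      have "0 \<le> (lam + ln t) * (kern t - kern s)"
      proof (cases "s \<le> t")
        case True
        have "ln s \<le> ln t" using s(1) elim True by (subst ln_le_cancel_iff) auto
        thus ?thesis using s mono[of s t] True elim by (intro mult_nonneg_nonneg) auto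
      next
        case False
        have "ln t \<le> ln s" using s(1) elim False by (subst ln_le_cancel_iff) auto
        thus ?thesis using s mono[of t s] False elim by (intro mult_nonpos_nonpos) auto
      qed
      hence "0 \<le> (lam + ln t) * (kern t - kern s) / (1 - t)" using elim by simp
      thus ?case by (simp add: wt_def algebra_simps diff_divide_distrib add_divide_distrib)
    qed
  qed
  also have "\<dots> = (\<integral>t. wt t / (1 - t) \<partial>M) - (\<integral>t. kern s * ((lam + ln t) / (1 - t)) \<partial>M)"
    by (rule Bochner_Integration.integral_diff[OF i]) (intro integrable_mult_right lam_int)
  also have "(\<integral>t. kern s * ((lam + ln t) / (1 - t)) \<partial>M) = 0" unfolding integral_mult_right_zero lam_int by simp
  finally show ?thesis by simp
qed

lemma normaliser_finite:
  assumes i: "integrable M (\<lambda>t. kern t / (1 - t))"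
  shows "\<exists>n \<nu> \<alpha>. normaliser c n \<nu> \<alpha>"
proof -
  have vi: "integrable M (\<lambda>t. wt t / (1 - t))"
  proof (rule bounded_integrable[where w = "\<lambda>t. lam * (kern t / (1 - t)) + 1 / (1 - t)" and B = 1])
    show "integrable M (\<lambda>t. lam * (kern t / (1 - t)) + 1 / (1 - t))"
      by (intro Bochner_Integration.integrable_add integrable_mult_right i inv1_int)
    fix t :: real assume t: "0 < t" "t < 1"
    have "\<bar>wt t / (1 - t)\<bar> = \<bar>wt t\<bar> / (1 - t)" using t by (simp add: abs_divide)
    also have "\<dots> \<le> (lam * kern t + 1) / (1 - t)" using wt_bound[OF t] t by (intro divide_right_mono) auto
    also have "\<dots> = lam * (kern t / (1 - t)) + 1 / (1 - t)" by (simp add: add_divide_distrib)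
    finally show "norm (wt t / (1 - t)) \<le> 1 * \<bar>lam * (kern t / (1 - t)) + 1 / (1 - t)\<bar>"
      unfolding real_norm_def mult_1_left by linarith
  qed measurable
  show ?thesis unfolding normaliser_def
  proof (rule exI[of _ "\<lambda>_. 1"], rule exI[of _ 1], rule exI[of _ "\<integral>t. wt t / (1 - t) \<partial>M"], intro conjI)
    show "((\<lambda>u. J wt (1 - u) / of_real 1) \<longlongrightarrow> of_real (\<integral>t. wt t / (1 - t) \<partial>M)) (at 0 within sector c)"
      using J_cone_limit[OF vi] by simp
    show "((\<lambda>u. u * J' wt (1 - u) / of_real 1) \<longlongrightarrow> 0) (at 0 within sector c)"
      using J'_cone_limit[OF vi] by simp
  qed (use limit_integral_nonneg[OF vi] in auto)
qed

lemma Kr_int: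
  assumes "0 \<le> y" "y < 1" shows "integrable M (\<lambda>t. kern t / (1 - y * t))"
proof -
  have "integrable M (\<lambda>t. Re (of_real (kern t) / (1 - of_real y * of_real t)))"
    by (intro integrable_Re J_integrable kern_int) (use assms in \<open>simp add: slit_plane_def\<close>)
  moreover have "Re (of_real (kern t) / (1 - of_real y * of_real t)) = kern t / (1 - y * t)" for t
  proof -
    have "of_real (kern t) / (1 - of_real y * of_real t) = complex_of_real (kern t / (1 - y * t))" by simp
    thus ?thesis by (simp only: Re_complex_of_real)
  qed
  ultimately show ?thesis by simp
qed

lemma Kr_nonneg:
  assumes "0 \<le> y" "y \<le> 1" shows "0 \<le> Kr y"
  unfolding Kr_def
proof (rule integral_nonneg_AE)
  show "AE t in M. 0 \<le> kern t / (1 - y * t)"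
    using supp
  proof eventually_elim
    case (elim t)
    have "y * t \<le> 1" using assms elim by (intro mult_le_one) auto
    thus ?case using elim by (simp add: kern_def)
  qed
qed

lemma one_minus_pos: "0 < 1 - y * t" if "0 \<le> y" "y \<le> 1" "0 < t" "t < 1" for y t :: real
proof -
  have "y * t \<le> 1 * t" using that by (intro mult_right_mono) auto
  with that show ?thesis by linarith
qed

lemma Kr_mono:
  assumes "0 \<le> y" "y \<le> z" "z < 1" shows "Kr y \<le> Kr z"
  unfolding Kr_def
proof (rule integral_mono_AE)
  show "AE t in M. kern t / (1 - y * t) \<le> kern t / (1 - z * t)"
    using supp
  proof eventually_elim
    case (elim t)
    have "y * t \<le> z * t" using assms elim by (intro mult_right_mono) auto
    moreover have "0 < 1 - z * t" using one_minus_pos[of z t] assms elim by simp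
    ultimately show ?case using elim by (intro frac_le) (auto simp: kern_def)
  qed
qed (use Kr_int assms in auto)

text \<open>
  By monotone convergence as \<open>y\<close> increases to 1, a bound for \<open>Kr\<close> would make the limit integrable.
\<close>

lemma Kr_unbounded:
  assumes ni: "\<not> integrable M (\<lambda>t. kern t / (1 - t))"
  shows "\<exists>y\<ge>0. y < 1 \<and> Kr y > B"
proof (rule ccontr)
  assume "\<not> ?thesis"
  hence B: "Kr y \<le> B" if "0 \<le> y" "y < 1" for y using that by force
  define y where "y i = 1 - 1 / (real i + 1)" for i
  have y: "0 \<le> y i" "y i < 1" for i by (auto simp: y_def field_simps)
  have ymono: "y i \<le> y j" if "i \<le> j" for i j using that by (auto simp: y_def intro!: frac_le)
  have ylim: "y \<longlonglongrightarrow> 1" unfolding y_def by real_asymp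
  have "incseq (\<lambda>i. Kr (y i))" using Kr_mono y ymono by (auto simp: incseq_def)
  moreover have "\<forall>i. Kr (y i) \<le> B" using B y by blast
  ultimately obtain L where L: "(\<lambda>i. Kr (y i)) \<longlonglongrightarrow> L" using incseq_convergent by metis
  have "integrable M (\<lambda>t. kern t / (1 - t))"
  proof (rule integrable_monotone_convergence)
    show "integrable M (\<lambda>t. kern t / (1 - y i * t))" for i using Kr_int y by blast
    show "AE t in M. mono (\<lambda>i. kern t / (1 - y i * t))"
      using supp
    proof eventually_elim
      case (elim t)
      show ?case
      proof (rule monoI)
        fix i j :: nat assume "i \<le> j"
        hence "y i * t \<le> y j * t" using elim ymono by (intro mult_right_mono) auto
        moreover have "0 < 1 - y j * t" using one_minus_pos[of "y j" t] y[of j] elim by simp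
        ultimately show "kern t / (1 - y i * t) \<le> kern t / (1 - y j * t)" using elim by (intro frac_le) (auto simp: kern_def)
      qed
    qed
    show "AE t in M. (\<lambda>i. kern t / (1 - y i * t)) \<longlonglongrightarrow> kern t / (1 - t)"
      using supp by eventually_elim (use ylim in \<open>auto intro!: tendsto_eq_intros\<close>)
    show "(\<lambda>i. \<integral>t. kern t / (1 - y i * t) \<partial>M) \<longlonglongrightarrow> L" using L by (simp add: Kr_def)
    show "(\<lambda>t. kern t / (1 - t)) \<in> borel_measurable M" unfolding meas_eq by measurable
  qed
  thus False using ni by contradiction
qed

text \<open>
  The points \<open>1 - u\<close> and \<open>1 - \<bar>u\<bar>\<close> have distance at most \<open>2 \<bar>u\<bar>\<close>, so \<open>slow_variation\<close> bounds the change
  of the transform between them.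
\<close>

lemma J_kern_bound:
  assumes u: "u \<in> sector c" "u \<noteq> 0" "cmod u \<le> 1"
  shows "cmod (J kern (1 - u) - of_real (Kr (1 - cmod u))) \<le> 4 / \<kappa>"
proof -
  define y where "y = 1 - cmod u"
  have y: "0 \<le> y" "y < 1" using u by (auto simp: y_def)
  have x1: "1 - u \<in> slit_plane" by (rule cone_slit_plane[OF c(2) u(1)])
  have x2: "complex_of_real y \<in> slit_plane" using y by (simp add: slit_plane_def)
  have "J kern (1 - u) - of_real (Kr y) = J kern (1 - u) - J kern (of_real y)"
    unfolding Kr_def J_of_real ..
  also have "\<dots> = (\<integral>t. of_real (kern t) / (1 - (1 - u) * of_real t) - of_real (kern t) / (1 - of_real y * of_real t) \<partial>M)"
    unfolding J_def by (rule Bochner_Integration.integral_diff[symmetric]) (intro J_integrable kern_int x1 x2)+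
  also have "cmod \<dots> \<le> (\<integral>t. 2 / \<kappa> * cmod u * (1 / ((1 - t) * (1 - y * t)\<^sup>2)) \<partial>M)"
  proof (rule norm_integral_le)
    show "integrable M (\<lambda>t. 2 / \<kappa> * cmod u * (1 / ((1 - t) * (1 - y * t)\<^sup>2)))"
      by (intro integrable_mult_right slow_variation y)
    fix t :: real assume t: "0 < t" "t < 1"
    define D where "D = 1 - (1 - u) * of_real t"
    have D0: "D \<noteq> 0" unfolding D_def using slit_plane_nonzero[OF x1, of t] t by simp
    have e: "0 < 1 - y * t" using one_minus_pos[of y t] y t by simp
    have e0: "1 - of_real y * of_real t \<noteq> (0::complex)" using slit_plane_nonzero[OF x2, of t] t by simp
    have "of_real (kern t) / D - of_real (kern t) / (1 - of_real y * of_real t) =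
       of_real (kern t * t) * (1 - u - of_real y) / (D * (1 - of_real y * of_real t))"
      using D0 e0 by (simp add: divide_simps) (simp add: D_def algebra_simps)
    also have "cmod \<dots> = kern t * t * cmod (1 - u - of_real y) / (cmod D * (1 - y * t))"
    proof -
      have "1 - of_real y * of_real t = complex_of_real (1 - y * t)" by simp
      hence "cmod (1 - of_real y * of_real t) = 1 - y * t" using e by (simp only: norm_of_real)
      moreover have "0 \<le> kern t * t" using t by (simp add: kern_def)
      ultimately show ?thesis by (simp only: norm_divide norm_mult norm_of_real abs_of_nonneg)
    qed
    also have "\<dots> \<le> (1 / (1 - t)) * (2 * cmod u) / ((\<kappa> * (1 - y * t)) * (1 - y * t))"
    proof (rule frac_le)
      have eq: "1 - u - of_real y = of_real (cmod u) - u" by (simp add: y_def)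
      have "cmod (1 - u - of_real y) \<le> 2 * cmod u" unfolding eq using norm_triangle_ineq4[of "of_real (cmod u)" u] by simp
      moreover have "kern t * t \<le> 1 / (1 - t)" using t mult_le_one[of t t] by (simp add: kern_def divide_right_mono)
      ultimately show "kern t * t * cmod (1 - u - of_real y) \<le> (1 / (1 - t)) * (2 * cmod u)"
        using t by (intro mult_mono) (auto simp: kern_def)
      show "0 < \<kappa> * (1 - y * t) * (1 - y * t)" using \<kappa>_pos e by simp
      show "\<kappa> * (1 - y * t) * (1 - y * t) \<le> cmod D * (1 - y * t)"
        using cone_lower(1)[OF u(1) t] e unfolding D_def y_def by (intro mult_right_mono) auto
    qed (use t in auto)
    also have "\<dots> = 2 / \<kappa> * cmod u * (1 / ((1 - t) * (1 - y * t)\<^sup>2))" by (simp add: power2_eq_square)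
    finally show "cmod (of_real (kern t) / (1 - (1 - u) * of_real t) - of_real (kern t) / (1 - of_real y * of_real t))
       \<le> 2 / \<kappa> * cmod u * (1 / ((1 - t) * (1 - y * t)\<^sup>2))" unfolding D_def .
  qed measurable
  also have "\<dots> = 2 / \<kappa> * ((1 - y) * (\<integral>t. 1 / ((1 - t) * (1 - y * t)\<^sup>2) \<partial>M))"
    unfolding integral_mult_right_zero by (simp add: y_def)
  also have "\<dots> \<le> 2 / \<kappa> * 2" using slow_variation(2)[OF y] \<kappa>_pos by (intro mult_left_mono) auto
  finally show ?thesis by (simp add: y_def)
qed

lemma J_lnk_bound:
  assumes u: "u \<in> sector c"
  shows "cmod (J (\<lambda>t. ln t * kern t) (1 - u)) \<le> f1 / \<kappa>"
proof -
  have "cmod (J (\<lambda>t. ln t * kern t) (1 - u)) \<le> (\<integral>t. 1 / \<kappa> * (1 / (1 - t)) \<partial>M)"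
    unfolding J_def
  proof (rule norm_integral_le)
    show "integrable M (\<lambda>t. 1 / \<kappa> * (1 / (1 - t)))" by (intro integrable_mult_right inv1_int)
    fix t :: real assume t: "0 < t" "t < 1"
    have "\<bar>ln t * kern t\<bar> \<le> 1" using neg_ln_bound[OF t] t by (simp add: kern_def abs_mult)
    hence "\<bar>ln t * kern t\<bar> / cmod (1 - (1 - u) * of_real t) \<le> 1 / (\<kappa> * (1 - t))"
      using cone_lower(2)[OF u t] \<kappa>_pos t by (intro frac_le) auto
    thus "cmod (of_real (ln t * kern t) / (1 - (1 - u) * of_real t)) \<le> 1 / \<kappa> * (1 / (1 - t))"
      unfolding norm_divide norm_of_real by simp
  qed measurable
  also have "\<dots> = f1 / \<kappa>" unfolding integral_mult_right_zero f1_def by simp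
  finally show ?thesis .
qed

lemma J'_wt_bound:
  assumes u: "u \<in> sector c" "u \<noteq> 0" "cmod u \<le> 1"
  shows "cmod (u * J' wt (1 - u)) \<le> (2 * lam + f1) / \<kappa>\<^sup>2"
proof -
  define y where "y = 1 - cmod u"
  have y: "0 \<le> y" "y < 1" using u by (auto simp: y_def)
  have "u * J' wt (1 - u) = (\<integral>t. u * (of_real (wt t * t) / (1 - (1 - u) * of_real t)\<^sup>2) \<partial>M)"
    unfolding J'_def integral_mult_right_zero ..
  also have "cmod \<dots> \<le> (\<integral>t. lam * cmod u / \<kappa>\<^sup>2 * (1 / ((1 - t) * (1 - y * t)\<^sup>2)) + 1 / \<kappa>\<^sup>2 * (1 / (1 - t)) \<partial>M)"
  proof (rule norm_integral_le)
    show "integrable M (\<lambda>t. lam * cmod u / \<kappa>\<^sup>2 * (1 / ((1 - t) * (1 - y * t)\<^sup>2)) + 1 / \<kappa>\<^sup>2 * (1 / (1 - t)))"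
      by (intro Bochner_Integration.integrable_add integrable_mult_right slow_variation y inv1_int)
    fix t :: real assume t: "0 < t" "t < 1"
    define d where "d = cmod (1 - (1 - u) * of_real t)"
    define e where "e = 1 - y * t"
    have e: "0 < e" using one_minus_pos[of y t] y t by (simp add: e_def)
    have eq: "e = (1 - t) + cmod u * t" by (simp add: e_def y_def algebra_simps)
    have de: "\<kappa> * e \<le> d" using cone_lower(1)[OF u(1) t] by (simp add: d_def e_def y_def)
    have "cmod (u * (of_real (wt t * t) / (1 - (1 - u) * of_real t)\<^sup>2)) = cmod u * (\<bar>wt t\<bar> * t) / d\<^sup>2"
      using t by (simp add: norm_mult norm_divide norm_power d_def abs_mult)
    also have "\<dots> \<le> cmod u * ((lam * kern t + 1) * t) / (\<kappa> * e)\<^sup>2"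
      using wt_bound[OF t] t de e \<kappa>_pos by (intro frac_le mult_left_mono mult_right_mono power_mono) auto
    also have "\<dots> = lam * cmod u / \<kappa>\<^sup>2 * (kern t * t / e\<^sup>2) + 1 / \<kappa>\<^sup>2 * (cmod u * t / e\<^sup>2)"
      by (simp add: power_mult_distrib add_divide_distrib distrib_left distrib_right)
    also have "\<dots> \<le> lam * cmod u / \<kappa>\<^sup>2 * (1 / (1 - t) / e\<^sup>2) + 1 / \<kappa>\<^sup>2 * (1 / (1 - t))"
    proof (intro add_mono mult_left_mono)
      have "kern t * t \<le> 1 / (1 - t)" using t mult_le_one[of t t] by (simp add: kern_def divide_right_mono)
      thus "kern t * t / e\<^sup>2 \<le> 1 / (1 - t) / e\<^sup>2" by (intro divide_right_mono) auto
      have "(1 - t) * (cmod u * t) \<le> e * e" unfolding eq using t by (intro mult_mono) auto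
      hence "cmod u * t / e\<^sup>2 \<le> cmod u * t / ((1 - t) * (cmod u * t))"
        using t u by (intro frac_le) (auto simp: power2_eq_square)
      also have "\<dots> = 1 / (1 - t)" using t u by simp
      finally show "cmod u * t / e\<^sup>2 \<le> 1 / (1 - t)" .
    qed (use lam_pos in auto)
    finally show "cmod (u * (of_real (wt t * t) / (1 - (1 - u) * of_real t)\<^sup>2)) \<le>
       lam * cmod u / \<kappa>\<^sup>2 * (1 / ((1 - t) * (1 - y * t)\<^sup>2)) + 1 / \<kappa>\<^sup>2 * (1 / (1 - t))"
      unfolding e_def divide_divide_eq_left .
  qed measurable
  also have "\<dots> = (\<integral>t. lam * cmod u / \<kappa>\<^sup>2 * (1 / ((1 - t) * (1 - y * t)\<^sup>2)) \<partial>M) + (\<integral>t. 1 / \<kappa>\<^sup>2 * (1 / (1 - t)) \<partial>M)"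
    by (rule Bochner_Integration.integral_add[OF integrable_mult_right[OF slow_variation(1)[OF y]] integrable_mult_right[OF inv1_int]])
  also have "\<dots> = lam / \<kappa>\<^sup>2 * ((1 - y) * (\<integral>t. 1 / ((1 - t) * (1 - y * t)\<^sup>2) \<partial>M)) + f1 / \<kappa>\<^sup>2"
    unfolding integral_mult_right_zero f1_def y_def by simp
  also have "\<dots> \<le> lam / \<kappa>\<^sup>2 * 2 + f1 / \<kappa>\<^sup>2"
    using slow_variation(2)[OF y] lam_pos by (intro add_mono mult_left_mono) auto
  also have "\<dots> = (2 * lam + f1) / \<kappa>\<^sup>2" by (simp add: add_divide_distrib)
  finally show ?thesis .
qed

text \<open>
  Up to bounded terms \<open>J wt\<close> is \<open>lam * J kern\<close>, and \<open>J kern\<close> is its real value at \<open>1 - \<bar>u\<bar>\<close>. That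
  value tends to infinity, so the quotient by it tends to \<open>lam\<close>.
\<close>

lemma normaliser_infinite:
  assumes ni: "\<not> integrable M (\<lambda>t. kern t / (1 - t))"
  shows "\<exists>n \<nu> \<alpha>. normaliser c n \<nu> \<alpha>"
proof -
  define n where "n u = (if cmod u \<le> 1 then 1 + Kr (1 - cmod u) else 1)" for u :: complex
  have n_pos: "n u > 0" for u using Kr_nonneg[of "1 - cmod u"] by (auto simp: n_def)
  have n_top: "filterlim n at_top (at 0 within sector c)"
    unfolding filterlim_at_top
  proof
    fix B :: real
    obtain y where y: "0 \<le> y" "y < 1" "Kr y > B" using Kr_unbounded[OF ni] by blast
    have "\<forall>\<^sub>F u in at 0 within sector c. cmod u < 1 - y \<and> u \<noteq> 0"
      using y unfolding eventually_at by (intro exI[of _ "1 - y"]) (auto simp: dist_norm)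
    thus "\<forall>\<^sub>F u in at 0 within sector c. B \<le> n u"
    proof eventually_elim
      case (elim u)
      hence "Kr y \<le> Kr (1 - cmod u)" using y by (intro Kr_mono) auto
      moreover have "cmod u \<le> 1" using elim y by linarith
      ultimately show ?case using y unfolding n_def by simp
    qed
  qed
  have inv0: "((\<lambda>u. 1 / n u) \<longlongrightarrow> 0) (at 0 within sector c)"
    using tendsto_inverse_0_at_top[OF n_top] by (simp add: inverse_eq_divide)
  have bounded_quot: "((\<lambda>u. g u / of_real (n u)) \<longlongrightarrow> 0) (at 0 within sector c)"
    if "\<And>u. u \<in> sector c \<Longrightarrow> u \<noteq> 0 \<Longrightarrow> cmod u \<le> 1 \<Longrightarrow> cmod (g u) \<le> B" for g B
  proof (rule Lim_null_comparison)
    have "\<forall>\<^sub>F u in at 0 within sector c. u \<in> sector c \<and> u \<noteq> 0 \<and> cmod u \<le> 1"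
      unfolding eventually_at by (intro exI[of _ 1]) (auto simp: dist_norm)
    thus "\<forall>\<^sub>F u in at 0 within sector c. cmod (g u / of_real (n u)) \<le> B * (1 / n u)"
    proof eventually_elim
      case (elim u)
      show ?case using that[of u] elim n_pos[of u] by (simp add: norm_divide divide_right_mono)
    qed
    show "((\<lambda>u. B * (1 / n u)) \<longlongrightarrow> 0) (at 0 within sector c)" using tendsto_mult_right_zero[OF inv0] .
  qed
  have "((\<lambda>u. (J wt (1 - u) - of_real (lam * n u)) / of_real (n u)) \<longlongrightarrow> 0) (at 0 within sector c)"
  proof (rule bounded_quot[where B = "lam * (4 / \<kappa>) + f1 / \<kappa> + lam"])
    fix u assume u: "u \<in> sector c" "u \<noteq> 0" "cmod u \<le> 1"
    have x: "1 - u \<in> slit_plane" by (rule cone_slit_plane[OF c(2) u(1)])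
    have lnk: "integrable M (\<lambda>t. ln t * kern t)"
    proof -
      have "(\<lambda>t. ln t * kern t) = (\<lambda>t. wt t - lam * kern t)" by (simp add: fun_eq_iff wt_def algebra_simps)
      thus ?thesis using wt_int kern_int by simp
    qed
    have "J wt (1 - u) = J (\<lambda>t. lam * kern t + ln t * kern t) (1 - u)" by (simp add: wt_def[abs_def] algebra_simps)
    also have "\<dots> = of_real lam * J kern (1 - u) + J (\<lambda>t. ln t * kern t) (1 - u)"
      by (rule J_add_scale[OF kern_int lnk x])
    finally have "J wt (1 - u) - of_real (lam * n u) =
      of_real lam * (J kern (1 - u) - of_real (Kr (1 - cmod u))) + J (\<lambda>t. ln t * kern t) (1 - u) - of_real lam"
      using u by (simp add: n_def algebra_simps)
    also have "cmod \<dots> \<le> cmod (of_real lam * (J kern (1 - u) - of_real (Kr (1 - cmod u)))) + cmod (J (\<lambda>t. ln t * kern t) (1 - u)) + cmod (of_real lam)"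
      by (rule order_trans[OF norm_triangle_ineq4 add_right_mono[OF norm_triangle_ineq]])
    also have "\<dots> \<le> lam * (4 / \<kappa>) + f1 / \<kappa> + lam"
      unfolding norm_mult norm_of_real using lam_pos J_kern_bound[OF u] J_lnk_bound[OF u(1)]
      by (intro add_mono mult_mono) auto
    finally show "cmod (J wt (1 - u) - of_real (lam * n u)) \<le> lam * (4 / \<kappa>) + f1 / \<kappa> + lam" .
  qed
  moreover have "(J wt (1 - u) - of_real (lam * n u)) / of_real (n u) = J wt (1 - u) / of_real (n u) - of_real lam" for u
  proof -
    have "complex_of_real (n u) \<noteq> 0" using n_pos[of u] by simp
    thus ?thesis by (simp add: diff_divide_distrib)
  qed
  ultimately have 1: "((\<lambda>u. J wt (1 - u) / of_real (n u)) \<longlongrightarrow> of_real lam) (at 0 within sector c)"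
    by (simp only: LIM_zero_cancel)
  have 2: "((\<lambda>u. u * J' wt (1 - u) / of_real (n u)) \<longlongrightarrow> 0) (at 0 within sector c)"
    by (rule bounded_quot[OF J'_wt_bound])
  have 3: "((\<lambda>u. complex_of_real (1 / n u)) \<longlongrightarrow> of_real 0) (at 0 within sector c)"
    by (rule tendsto_of_real[OF inv0])
  show ?thesis unfolding normaliser_def
    by (rule exI[of _ n], rule exI[of _ 0], rule exI[of _ lam], intro conjI allI n_pos 1 2 3) (use lam_pos in simp_all)
qed

end

end

lemma one_minus_exp_quotient:
  "((\<lambda>d :: complex. if d = 0 then 1 else (1 - exp (- d)) / d) \<longlongrightarrow> 1) (nhds 0)"
proof -
  have "((\<lambda>d :: complex. 1 - exp (- d)) has_field_derivative 1) (at 0)"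
    by (auto intro!: derivative_eq_intros)
  hence "((\<lambda>d :: complex. (1 - exp (- d)) / d) \<longlongrightarrow> 1) (at 0)"
    by (simp add: has_field_derivative_iff)
  hence "((\<lambda>d :: complex. if d = 0 then 1 else (1 - exp (- d)) / d) \<longlongrightarrow> 1) (at 0)"
    by (rule Lim_transform_eventually) (auto simp: eventually_at_filter)
  thus ?thesis by (subst tendsto_nhds_iff) simp
qed

context quadratic_moment_measure
begin

definition ratio :: "complex \<Rightarrow> complex" where
  "ratio u = J wt (1 - u) / J (\<lambda>_. 1) (1 - u)"

text \<open>
  With \<open>x = 1 - u\<close>, this is \<open>1 - q(z) / q\<^sub>1\<close>.
\<close>

definition gap :: "complex \<Rightarrow> complex" where
  "gap u = 1 - (1 - u) * exp (- (u * ratio u))"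

lemma gap_deriv:
  assumes x: "1 - u \<in> slit_plane"
  shows "(gap has_field_derivative exp (- (u * ratio u)) + (1 - u) * exp (- (u * ratio u)) *
     (ratio u - (u * J' wt (1 - u) / J (\<lambda>_. 1) (1 - u) -
        ratio u * (u * J' (\<lambda>_. 1) (1 - u)) / J (\<lambda>_. 1) (1 - u)))) (at u)"
proof -
  have dv: "((\<lambda>u. J wt (1 - u)) has_field_derivative J' wt (1 - u) * (- 1)) (at u)"
    by (rule DERIV_chain2[where f = "J wt" and g = "\<lambda>u. 1 - u", OF J_deriv[OF wt_int x]]) (auto intro!: derivative_eq_intros)
  have df: "((\<lambda>u. J (\<lambda>_. 1) (1 - u)) has_field_derivative J' (\<lambda>_. 1) (1 - u) * (- 1)) (at u)"
    by (rule DERIV_chain2[where f = "J (\<lambda>_. 1)" and g = "\<lambda>u. 1 - u", OF J_deriv[OF _ x]]) (auto intro!: derivative_eq_intros)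
  define f where "f = J (\<lambda>_. 1) (1 - u)"
  have f0: "f \<noteq> 0" unfolding f_def by (rule J_1_nonzero[OF x])
  define R where "R = (J' wt (1 - u) * (- 1) * f - J wt (1 - u) * (J' (\<lambda>_. 1) (1 - u) * (- 1))) / (f * f)"
  have dr: "(ratio has_field_derivative R) (at u)"
    unfolding ratio_def[abs_def] R_def f_def by (rule DERIV_divide[OF dv df J_1_nonzero[OF x]])
  have d: "(gap has_field_derivative
      0 - ((0 - 1) * exp (- (u * ratio u)) + exp (- (u * ratio u)) * (- (1 * ratio u + R * u)) * (1 - u))) (at u)"
    unfolding gap_def[abs_def]
    by (intro DERIV_diff DERIV_const DERIV_mult DERIV_ident DERIV_minus DERIV_fun_exp dr)
  have ratf: "ratio u = J wt (1 - u) / f" by (simp add: ratio_def f_def)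
  have Ru: "R * u = - (u * J' wt (1 - u) / f - ratio u * (u * J' (\<lambda>_. 1) (1 - u)) / f)"
    unfolding R_def ratf using f0 by (simp add: field_simps)
  show ?thesis unfolding f_def[symmetric]
    by (rule DERIV_cong[OF d], unfold Ru) (simp add: algebra_simps diff_divide_distrib add_divide_distrib)
qed

text \<open>
  Divided by the normaliser, \<open>gap u / u\<close> and \<open>gap' u\<close> both tend to the positive number \<open>\<alpha> / f1 + \<nu>\<close>.
\<close>

lemma gap_asymptotics:
  assumes c: "0 \<le> c" "c < 1"
  shows "\<forall>\<^sub>F u in at 0 within sector c. Re (gap u / u) > 0"
    and "((\<lambda>u. u * deriv gap u / gap u) \<longlongrightarrow> 1) (at 0 within sector c)"
    and "(gap \<longlongrightarrow> 0) (at 0 within sector c)"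
proof -
  define F where "F = at (0::complex) within sector c"
  define \<kappa> where "\<kappa> = sqrt ((1 - c) / 2)"
  obtain n \<nu> \<alpha> where "normaliser c n \<nu> \<alpha>"
    using normaliser_finite[OF c \<kappa>_def] normaliser_infinite[OF c \<kappa>_def] by blast
  hence n: "\<And>u. n u > 0" and \<nu>\<alpha>: "\<nu> \<ge> 0" "\<alpha> \<ge> 0" "\<alpha> + \<nu> > 0"
    and n1: "((\<lambda>u. complex_of_real (1 / n u)) \<longlongrightarrow> of_real \<nu>) F"
    and nV: "((\<lambda>u. J wt (1 - u) / of_real (n u)) \<longlongrightarrow> of_real \<alpha>) F"
    and nV': "((\<lambda>u. u * J' wt (1 - u) / of_real (n u)) \<longlongrightarrow> 0) F"
    by (auto simp: normaliser_def F_def)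
  have f: "((\<lambda>u. J (\<lambda>_. 1) (1 - u)) \<longlongrightarrow> of_real f1) F"
    using J_cone_limit[OF c \<kappa>_def, of "\<lambda>_. 1"] inv1_int by (simp add: F_def f1_def)
  have f10: "complex_of_real f1 \<noteq> 0" using f1_pos by simp
  have f': "((\<lambda>u. u * J' (\<lambda>_. 1) (1 - u)) \<longlongrightarrow> 0) F"
    using J'_cone_limit[OF c \<kappa>_def, of "\<lambda>_. 1"] inv1_int by (simp add: F_def)
  have g: "((\<lambda>u. J ln (1 - u)) \<longlongrightarrow> of_real e1) F"
    using J_cone_limit[OF c \<kappa>_def ln_diwt_int] by (simp add: F_def e1_def)
  have nz: "\<forall>\<^sub>F u in F. u \<noteq> 0 \<and> 1 - u \<in> slit_plane"
    unfolding F_def eventually_at_filter using cone_slit_plane[OF c(2)] by (intro always_eventually) auto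
  have "((\<lambda>u. - of_real lam - J ln (1 - u) / J (\<lambda>_. 1) (1 - u)) \<longlongrightarrow> - of_real lam - of_real e1 / of_real f1) F"
    by (intro tendsto_diff tendsto_const tendsto_divide g f f10)
  moreover have "\<forall>\<^sub>F u in F. - of_real lam - J ln (1 - u) / J (\<lambda>_. 1) (1 - u) = u * ratio u"
    using nz by eventually_elim (use quotient_at_1 in \<open>simp add: ratio_def\<close>)
  ultimately have uA: "((\<lambda>u. u * ratio u) \<longlongrightarrow> 0) F" by (simp add: lam_def tendsto_cong)
  have nA: "((\<lambda>u. ratio u / of_real (n u)) \<longlongrightarrow> of_real (\<alpha> / f1)) F"
    using tendsto_divide[OF nV f f10] by (simp add: ratio_def mult_ac)
  define L where "L = \<alpha> / f1 + \<nu>"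
  have L: "L > 0"
  proof (cases "\<alpha> = 0")
    case False
    hence "\<alpha> / f1 > 0" using \<nu>\<alpha> f1_pos by simp
    thus ?thesis using \<nu>\<alpha> by (simp add: L_def)
  qed (use \<nu>\<alpha> in \<open>simp add: L_def\<close>)
  have e: "((\<lambda>u. exp (- (u * ratio u))) \<longlongrightarrow> 1) F"
    using tendsto_exp[OF tendsto_minus[OF uA]] by simp
  have id: "((\<lambda>u. u) \<longlongrightarrow> 0) F" unfolding F_def by (rule tendsto_ident_at)
  have "((\<lambda>u. 1 - (1 - u) * exp (- (u * ratio u))) \<longlongrightarrow> 1 - (1 - 0) * 1) F"
    by (intro tendsto_diff tendsto_mult tendsto_const id e)
  thus "(gap \<longlongrightarrow> 0) (at 0 within sector c)" by (simp add: gap_def[abs_def] F_def)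
  define \<phi> where "\<phi> d = (if d = 0 then 1 else (1 - exp (- d)) / d)" for d :: complex
  have \<phi>: "((\<lambda>u. \<phi> (u * ratio u)) \<longlongrightarrow> 1) F"
    using filterlim_compose[OF one_minus_exp_quotient uA] by (simp add: \<phi>_def[abs_def])
  have \<phi>_eq: "1 - exp (- d) = d * \<phi> d" for d by (simp add: \<phi>_def)
  have "((\<lambda>u. ratio u / of_real (n u) * \<phi> (u * ratio u) + exp (- (u * ratio u)) * of_real (1 / n u)) \<longlongrightarrow>
        of_real (\<alpha> / f1) * 1 + 1 * of_real \<nu>) F"
    by (intro tendsto_add tendsto_mult nA \<phi> e n1)
  moreover have "\<forall>\<^sub>F u in F. ratio u / of_real (n u) * \<phi> (u * ratio u) + exp (- (u * ratio u)) * of_real (1 / n u) =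
        gap u / u / of_real (n u)"
    using nz
  proof eventually_elim
    case (elim u)
    have n0: "complex_of_real (n u) \<noteq> 0" using n[of u] by simp
    have "gap u = (1 - exp (- (u * ratio u))) + u * exp (- (u * ratio u))" by (simp add: gap_def algebra_simps)
    also have "\<dots> = u * (ratio u * \<phi> (u * ratio u) + exp (- (u * ratio u)))" unfolding \<phi>_eq by (simp add: algebra_simps)
    finally have "gap u / u = ratio u * \<phi> (u * ratio u) + exp (- (u * ratio u))" using elim by simp
    thus ?case using n0 by (simp add: add_divide_distrib)
  qed
  ultimately have gq: "((\<lambda>u. gap u / u / of_real (n u)) \<longlongrightarrow> of_real L) F"
    by (simp add: L_def tendsto_cong)
  have "((\<lambda>u. exp (- (u * ratio u)) * of_real (1 / n u) + (1 - u) * exp (- (u * ratio u)) *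
      (ratio u / of_real (n u) - (u * J' wt (1 - u) / of_real (n u) / J (\<lambda>_. 1) (1 - u) -
        ratio u / of_real (n u) * (u * J' (\<lambda>_. 1) (1 - u)) / J (\<lambda>_. 1) (1 - u)))) \<longlongrightarrow>
     1 * of_real \<nu> + (1 - 0) * 1 * (of_real (\<alpha> / f1) - (0 / of_real f1 - of_real (\<alpha> / f1) * 0 / of_real f1))) F"
    by (intro tendsto_add tendsto_diff tendsto_mult tendsto_divide tendsto_const e n1 id nA nV' f' f f10)
  moreover have "\<forall>\<^sub>F u in F. exp (- (u * ratio u)) * of_real (1 / n u) + (1 - u) * exp (- (u * ratio u)) *
      (ratio u / of_real (n u) - (u * J' wt (1 - u) / of_real (n u) / J (\<lambda>_. 1) (1 - u) -
        ratio u / of_real (n u) * (u * J' (\<lambda>_. 1) (1 - u)) / J (\<lambda>_. 1) (1 - u))) = deriv gap u / of_real (n u)"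
    using nz
  proof eventually_elim
    case (elim u)
    have n0: "complex_of_real (n u) \<noteq> 0" using n[of u] by simp
    show ?case unfolding DERIV_imp_deriv[OF gap_deriv[OF conjunct2[OF elim]]]
      using n0 J_1_nonzero[OF conjunct2[OF elim]] by (simp add: divide_simps)
  qed
  ultimately have g': "((\<lambda>u. deriv gap u / of_real (n u)) \<longlongrightarrow> of_real L) F"
    by (simp add: L_def tendsto_cong add.commute)
  have L0: "complex_of_real L \<noteq> 0" using L by simp
  have "((\<lambda>u. (deriv gap u / of_real (n u)) / (gap u / u / of_real (n u))) \<longlongrightarrow> of_real L / of_real L) F"
    by (rule tendsto_divide[OF g' gq L0])
  moreover have "(deriv gap u / of_real (n u)) / (gap u / u / of_real (n u)) = u * deriv gap u / gap u" for u
    using n[of u] by simp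
  ultimately have "((\<lambda>u. u * deriv gap u / gap u) \<longlongrightarrow> of_real L / of_real L) F" by (simp only:)
  thus "((\<lambda>u. u * deriv gap u / gap u) \<longlongrightarrow> 1) (at 0 within sector c)"
    by (simp only: F_def divide_self[OF L0])
  have "((\<lambda>u. Re (gap u / u / of_real (n u))) \<longlongrightarrow> L) F" using tendsto_Re[OF gq] by simp
  hence "\<forall>\<^sub>F u in F. 0 < Re (gap u / u / of_real (n u))" using L by (rule order_tendstoD)
  thus "\<forall>\<^sub>F u in at 0 within sector c. Re (gap u / u) > 0" unfolding F_def
  proof eventually_elim
    case (elim u)
    have "Re (gap u / u / of_real (n u)) = Re (gap u / u) / n u" by (rule Re_divide_of_real)
    thus ?case using elim n[of u] by (simp add: zero_less_divide_iff)
  qed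
qed

end

section \<open>Inverting a function near the tip of a sector\<close>

lemma half_strip_eq:
  "{s. Re s < a \<and> \<bar>Im s\<bar> < b} = {s. Re s < a} \<inter> {s. Im s < b} \<inter> {s. Im s > - b}"
  by auto

lemma open_half_strip: "open {s. Re s < a \<and> \<bar>Im s\<bar> < b}"
  unfolding half_strip_eq by (intro open_Int open_halfspace_Re_lt open_halfspace_Im_lt open_halfspace_Im_gt)

lemma convex_half_strip: "convex {s. Re s < a \<and> \<bar>Im s\<bar> < b}"
  unfolding half_strip_eq by (intro convex_Int convex_halfspace_Re_lt convex_halfspace_Im_lt convex_halfspace_Im_gt)

text \<open>
  On a convex set a bound for \<open>T' - 1\<close> makes \<open>T - id\<close> a contraction, so \<open>T\<close> is injective far to the left.
  To solve \<open>T s = \<tau>\<close>, the intermediate value theorem gives a real \<open>x\<close> with \<open>T x = Re \<tau>\<close>; then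
  \<open>s \<mapsto> s - T s + \<tau>\<close> moves the point \<open>x + \<i> Im \<tau>\<close> by at most \<open>\<delta> \<bar>Im \<tau>\<bar>\<close> and hence maps a small disc
  around it into itself.
\<close>

lemma holomorphic_near_identity_half_strip:
  fixes T :: "complex \<Rightarrow> complex"
  assumes hol: "T holomorphic_on {s. Re s < \<sigma> \<and> \<bar>Im s\<bar> < \<beta>}"
    and real: "\<And>x. x < \<sigma> \<Longrightarrow> T (of_real x) \<in> \<real>"
    and close: "\<And>\<delta>. \<delta> > 0 \<Longrightarrow> \<exists>m. \<forall>s. Re s < m \<longrightarrow> \<bar>Im s\<bar> < \<beta> \<longrightarrow> cmod (deriv T s - 1) \<le> \<delta>"
    and \<beta>: "0 < \<beta>0" "\<beta>0 < \<beta>"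
  obtains m \<phi> where "\<phi> holomorphic_on {\<tau>. Re \<tau> < m \<and> \<bar>Im \<tau>\<bar> < \<beta>0}"
    and "\<And>\<tau>. Re \<tau> < m \<Longrightarrow> \<bar>Im \<tau>\<bar> < \<beta>0 \<Longrightarrow>
           Re (\<phi> \<tau>) < \<sigma> \<and> \<bar>Im (\<phi> \<tau>)\<bar> < \<beta> \<and> T (\<phi> \<tau>) = \<tau>"
    and "\<And>x. x < m \<Longrightarrow> \<phi> (of_real x) \<in> \<real>"
proof -
  define \<eta> where "\<eta> = min 1 (\<beta> - \<beta>0)"
  have \<eta>: "\<eta> > 0" "\<eta> \<le> 1" "\<eta> \<le> \<beta> - \<beta>0" using \<beta> by (auto simp: \<eta>_def)
  \<comment> \<open>The choice makes \<open>\<delta> * \<beta> + \<delta> * \<eta> \<le> \<eta>\<close>, which is what the contraction below needs.\<close>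
  define \<delta> where "\<delta> = min (1/2) (\<eta> / (2 * \<beta>))"
  have \<beta>_pos: "\<beta> > 0" using \<beta> by simp
  have \<delta>: "\<delta> > 0" "\<delta> \<le> 1/2" using \<beta>_pos \<eta>(1) by (simp_all add: \<delta>_def)
  have "\<delta> * \<beta> \<le> \<eta> / (2 * \<beta>) * \<beta>" using \<beta>_pos by (intro mult_right_mono) (simp_all add: \<delta>_def)
  hence \<delta>\<beta>: "\<delta> * \<beta> \<le> \<eta> / 2" using \<beta>_pos by simp
  obtain m0 where m0: "\<And>s. Re s < m0 \<Longrightarrow> \<bar>Im s\<bar> < \<beta> \<Longrightarrow> cmod (deriv T s - 1) \<le> \<delta>"
    using close[OF \<delta>(1)] by blast
  define m1 where "m1 = min m0 \<sigma>"
  define Z where "Z = {s. Re s < m1 \<and> \<bar>Im s\<bar> < \<beta>}"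
  have opZ: "open Z" and cvZ: "convex Z" unfolding Z_def by (rule open_half_strip convex_half_strip)+
  have holZ: "T holomorphic_on Z" by (rule holomorphic_on_subset[OF hol]) (auto simp: Z_def m1_def)
  have dT: "(T has_field_derivative deriv T s) (at s)" if "s \<in> Z" for s
    using holomorphic_derivI[OF holZ opZ that] .
  have lip: "cmod ((T s - s) - (T s' - s')) \<le> \<delta> * cmod (s - s')" if "s \<in> Z" "s' \<in> Z" for s s'
  proof (rule field_differentiable_bound[OF cvZ _ _ that, where f' = "\<lambda>s. deriv T s - 1"])
    fix z assume z: "z \<in> Z"
    show "((\<lambda>s. T s - s) has_field_derivative deriv T z - 1) (at z within Z)"
      by (intro DERIV_diff DERIV_ident has_field_derivative_at_within[OF dT[OF z]])
    show "cmod (deriv T z - 1) \<le> \<delta>" using z m0 by (auto simp: Z_def m1_def)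
  qed
  have inj: "inj_on T Z"
  proof
    fix s s' assume s: "s \<in> Z" "s' \<in> Z" "T s = T s'"
    have "cmod (s - s') \<le> \<delta> * cmod (s - s')" using lip[OF s(1,2)] s(3) by (simp add: norm_minus_commute)
    also have "\<dots> \<le> 1/2 * cmod (s - s')" using \<delta> by (intro mult_right_mono) auto
    finally show "s = s'" by simp
  qed
  obtain \<phi> where \<phi>: "\<phi> holomorphic_on T ` Z" "\<And>z. z \<in> Z \<Longrightarrow> \<phi> (T z) = z"
    using holomorphic_has_inverse[OF holZ opZ inj] by metis
  define sa where "sa = m1 - 1"
  define m where "m = Re (T (of_real sa))"
  have re_in: "of_real x \<in> Z" if "x \<le> sa" for x using that \<beta> by (auto simp: Z_def sa_def)
  have Tre: "T (of_real x) = of_real (Re (T (of_real x)))" if "x \<le> sa" for x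
    using real[of x] that by (auto simp: sa_def m1_def complex_is_Real_iff complex_eq_iff)
  have ivt: "\<exists>x<sa. T (of_real x) = of_real t" if t: "t < m" for t
  proof -
    define sb where "sb = sa - 2 * (m - t)"
    have sb: "sb < sa" using t by (simp add: sb_def)
    have "cmod ((T sa - sa) - (T sb - sb)) \<le> \<delta> * cmod (of_real sa - of_real sb :: complex)"
      using lip[OF re_in re_in, of sa sb] sb by simp
    also have "\<dots> \<le> 1/2 * cmod (of_real sa - of_real sb :: complex)" using \<delta> by (intro mult_right_mono) auto
    finally have a: "cmod ((T sa - sa) - (T sb - sb)) \<le> 1/2 * (sa - sb)"
      using sb by (simp flip: of_real_diff)
    have "Re ((T sb - sb) - (T sa - sa)) \<le> cmod ((T sb - sb) - (T sa - sa))" by (rule complex_Re_le_cmod)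
    hence "Re (T sb) - sb - (Re (T sa) - sa) \<le> 1/2 * (sa - sb)"
      using a by (simp add: norm_minus_commute)
    hence "Re (T sb) \<le> t" by (simp add: m_def sb_def field_simps)
    moreover have "t \<le> Re (T sa)" using t by (simp add: m_def)
    moreover have "continuous_on {sb..sa} (\<lambda>x. Re (T (of_real x)))"
    proof (intro continuous_intros continuous_on_compose2[OF holomorphic_on_imp_continuous_on[OF holZ]])
      show "complex_of_real ` {sb..sa} \<subseteq> Z" using re_in by auto
    qed
    ultimately obtain x where x: "sb \<le> x" "x \<le> sa" "Re (T (of_real x)) = t"
      using IVT'[of "\<lambda>x. Re (T (of_real x))" sb t sa] sb by auto
    moreover have "x \<noteq> sa" using x t by (auto simp: m_def)
    ultimately show ?thesis using Tre[of x] by (intro exI[of _ x]) auto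
  qed
  have surj: "\<tau> \<in> T ` Z" if \<tau>: "Re \<tau> < m" "\<bar>Im \<tau>\<bar> < \<beta>0" for \<tau>
  proof -
    obtain x where x: "x < sa" "T (of_real x) = of_real (Re \<tau>)" using ivt[OF \<tau>(1)] by blast
    define c where "c = Complex x (Im \<tau>)"
    have cb: "cball c \<eta> \<subseteq> Z"
    proof
      fix s assume "s \<in> cball c \<eta>"
      hence s: "cmod (s - c) \<le> \<eta>" by (simp add: dist_norm norm_minus_commute)
      have "\<bar>Re (s - c)\<bar> \<le> \<eta>" "\<bar>Im (s - c)\<bar> \<le> \<eta>"
        using s abs_Re_le_cmod[of "s-c"] abs_Im_le_cmod[of "s-c"] by linarith+
      thus "s \<in> Z" using x(1) \<eta> \<tau>(2) by (auto simp: Z_def c_def sa_def)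
    qed
    have cZ: "c \<in> Z" using cb \<eta> by auto
    have xZ: "of_real x \<in> Z" using x re_in by auto
    define f where "f = (\<lambda>s. s - T s + \<tau>)"
    have fc: "cmod (f c - c) \<le> \<eta> / 2"
    proof -
      have eq: "c - of_real x = \<tau> - T (of_real x)" by (simp add: x c_def complex_eq_iff)
      have "f c - c = (T (of_real x) - of_real x) - (T c - c)" using eq by (simp add: f_def algebra_simps)
      hence "cmod (f c - c) \<le> \<delta> * cmod (of_real x - c)" using lip[OF xZ cZ] by metis
      also have "cmod (of_real x - c) = \<bar>Im \<tau>\<bar>" by (simp add: c_def cmod_def)
      also have "\<delta> * \<bar>Im \<tau>\<bar> \<le> \<delta> * \<beta>" using \<tau> \<beta> \<delta> by (intro mult_left_mono) auto
      finally show ?thesis using \<delta>\<beta> by simp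
    qed
    have fl: "cmod (f s - f s') \<le> 1/2 * cmod (s - s')" if "s \<in> cball c \<eta>" "s' \<in> cball c \<eta>" for s s'
    proof -
      have "f s - f s' = - ((T s - s) - (T s' - s'))" by (simp add: f_def)
      hence "cmod (f s - f s') \<le> \<delta> * cmod (s - s')" using lip[of s s'] that cb by (simp only: norm_minus_cancel) blast
      also have "\<dots> \<le> 1/2 * cmod (s - s')" using \<delta> by (intro mult_right_mono) auto
      finally show ?thesis .
    qed
    have "\<exists>!s\<in>cball c \<eta>. f s = s"
    proof (rule Banach_fix[where c = "1/2"])
      show "f ` cball c \<eta> \<subseteq> cball c \<eta>"
      proof safe
        fix s assume s: "s \<in> cball c \<eta>"
        have "cmod (f s - c) \<le> cmod (f s - f c) + cmod (f c - c)" using norm_triangle_ineq[of "f s - f c" "f c - c"] by simp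
        also have "\<dots> \<le> 1/2 * cmod (s - c) + \<eta>/2" using fl[OF s, of c] fc \<eta> by auto
        also have "\<dots> \<le> \<eta>" using s by (simp add: dist_norm norm_minus_commute)
        finally show "f s \<in> cball c \<eta>" by (simp add: dist_norm norm_minus_commute)
      qed
    qed (use fl \<eta> in \<open>auto simp: dist_norm complete_eq_closed\<close>)
    then obtain s where "s \<in> cball c \<eta>" "f s = s" by blast
    hence "s \<in> Z" "T s = \<tau>" using cb by (auto simp: f_def)
    thus ?thesis by blast
  qed
  show ?thesis
  proof
    show "\<phi> holomorphic_on {\<tau>. Re \<tau> < m \<and> \<bar>Im \<tau>\<bar> < \<beta>0}"
      by (rule holomorphic_on_subset[OF \<phi>(1)]) (use surj in auto)
    show "Re (\<phi> \<tau>) < \<sigma> \<and> \<bar>Im (\<phi> \<tau>)\<bar> < \<beta> \<and> T (\<phi> \<tau>) = \<tau>" if \<tau>: "Re \<tau> < m" "\<bar>Im \<tau>\<bar> < \<beta>0" for \<tau>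
    proof -
      obtain s where "s \<in> Z" "T s = \<tau>" using surj[OF \<tau>] by blast
      thus ?thesis using \<phi>(2)[of s] by (auto simp: Z_def m1_def)
    qed
    show "\<phi> (of_real x) \<in> \<real>" if "x < m" for x
      using ivt[OF that] \<phi>(2) re_in by (metis Reals_of_real less_imp_le)
  qed
qed

text \<open>
  In logarithmic coordinates \<open>P\<close> becomes \<open>T s = s + Ln (P (exp s) / exp s)\<close>, which is a branch of
  \<open>ln (P (exp s))\<close> and has the derivative \<open>exp s * P' (exp s) / P (exp s)\<close>. The half strip takes the
  place of the sector, which need not be convex.
\<close>

lemma sector_inverse:
  fixes P :: "complex \<Rightarrow> complex"
  assumes hol: "P holomorphic_on W" "open W"
    and sub: "\<And>s. Re s < \<sigma> \<Longrightarrow> \<bar>Im s\<bar> < \<beta> \<Longrightarrow> exp s \<in> W"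
    and pos: "\<And>s. Re s < \<sigma> \<Longrightarrow> \<bar>Im s\<bar> < \<beta> \<Longrightarrow> Re (P (exp s) / exp s) > 0"
    and real: "\<And>x. x < \<sigma> \<Longrightarrow> P (of_real (exp x)) \<in> \<real>"
    and close: "\<And>\<delta>. \<delta> > 0 \<Longrightarrow> \<exists>m. \<forall>s. Re s < m \<longrightarrow> \<bar>Im s\<bar> < \<beta> \<longrightarrow>
                   cmod (exp s * deriv P (exp s) / P (exp s) - 1) \<le> \<delta>"
    and \<beta>: "0 < \<beta>0" "\<beta>0 < \<beta>"
  obtains m \<phi> where "\<phi> holomorphic_on {\<tau>. Re \<tau> < m \<and> \<bar>Im \<tau>\<bar> < \<beta>0}"
    and "\<And>\<tau>. Re \<tau> < m \<Longrightarrow> \<bar>Im \<tau>\<bar> < \<beta>0 \<Longrightarrow>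
           Re (\<phi> \<tau>) < \<sigma> \<and> \<bar>Im (\<phi> \<tau>)\<bar> < \<beta> \<and> P (exp (\<phi> \<tau>)) = exp \<tau>"
    and "\<And>x. x < m \<Longrightarrow> \<phi> (of_real x) \<in> \<real>"
proof -
  define T where "T = (\<lambda>s. s + Ln (P (exp s) / exp s))"
  have nz: "P (exp s) / exp s \<notin> \<real>\<^sub>\<le>\<^sub>0" if "Re s < \<sigma>" "\<bar>Im s\<bar> < \<beta>" for s
    using pos[OF that] by (auto simp: complex_nonpos_Reals_iff)
  have P0: "P (exp s) \<noteq> 0" if "Re s < \<sigma>" "\<bar>Im s\<bar> < \<beta>" for s
    using pos[OF that] by auto
  have dP: "((\<lambda>s. P (exp s)) has_field_derivative deriv P (exp s) * exp s) (at s)"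
    if "Re s < \<sigma>" "\<bar>Im s\<bar> < \<beta>" for s
    by (rule DERIV_chain2[where f = P and g = exp, OF holomorphic_derivI[OF hol sub[OF that]]]) (auto intro!: derivative_eq_intros)
  have dT: "(T has_field_derivative exp s * deriv P (exp s) / P (exp s)) (at s)"
    if "Re s < \<sigma>" "\<bar>Im s\<bar> < \<beta>" for s
    unfolding T_def using nz[OF that] P0[OF that]
    by (auto intro!: derivative_eq_intros dP that simp: field_simps)
  have holT: "T holomorphic_on {s. Re s < \<sigma> \<and> \<bar>Im s\<bar> < \<beta>}"
    by (rule holomorphic_onI) (use dT in \<open>auto simp: field_differentiable_def intro: has_field_derivative_at_within\<close>)
  have Treal: "T (of_real x) \<in> \<real>" if "x < \<sigma>" for x
  proof -
    define p where "p = Re (P (of_real (exp x)))"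
    have p: "P (of_real (exp x)) = of_real p" using real[OF that] by (simp add: p_def)
    have "P (exp (of_real x)) / exp (of_real x) = of_real (p / exp x)" using p by (simp add: exp_of_real)
    moreover from this have "p / exp x > 0" using pos[of "of_real x"] that \<beta> by simp
    ultimately show ?thesis by (simp add: T_def Ln_of_real)
  qed
  have cl: "\<exists>m. \<forall>s. Re s < m \<longrightarrow> \<bar>Im s\<bar> < \<beta> \<longrightarrow> cmod (deriv T s - 1) \<le> \<delta>" if \<delta>: "\<delta> > 0" for \<delta>
  proof -
    obtain m where m: "\<forall>s. Re s < m \<longrightarrow> \<bar>Im s\<bar> < \<beta> \<longrightarrow> cmod (exp s * deriv P (exp s) / P (exp s) - 1) \<le> \<delta>"
      using close[OF \<delta>] by blast
    show ?thesis using m DERIV_imp_deriv[OF dT] by (intro exI[of _ "min m \<sigma>"]) auto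
  qed
  obtain m \<phi> where *: "\<phi> holomorphic_on {\<tau>. Re \<tau> < m \<and> \<bar>Im \<tau>\<bar> < \<beta>0}"
    "\<And>\<tau>. Re \<tau> < m \<Longrightarrow> \<bar>Im \<tau>\<bar> < \<beta>0 \<Longrightarrow>
           Re (\<phi> \<tau>) < \<sigma> \<and> \<bar>Im (\<phi> \<tau>)\<bar> < \<beta> \<and> T (\<phi> \<tau>) = \<tau>"
    "\<And>x. x < m \<Longrightarrow> \<phi> (of_real x) \<in> \<real>"
    by (rule holomorphic_near_identity_half_strip[OF holT Treal cl \<beta>]) (assumption, assumption, rule that)
  have expT: "exp (T s) = P (exp s)" if "Re s < \<sigma>" "\<bar>Im s\<bar> < \<beta>" for s
    unfolding T_def exp_add using P0[OF that] by (subst exp_Ln) auto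
  show ?thesis
  proof (rule that[OF *(1) _ *(3)])
    fix \<tau> assume \<tau>: "Re \<tau> < m" "\<bar>Im \<tau>\<bar> < \<beta>0"
    show "Re (\<phi> \<tau>) < \<sigma> \<and> \<bar>Im (\<phi> \<tau>)\<bar> < \<beta> \<and> P (exp (\<phi> \<tau>)) = exp \<tau>"
      using *(2)[OF \<tau>] expT[of "\<phi> \<tau>"] by auto
  qed
qed

section \<open>Gluing local inverses\<close>

text \<open>
  By the identity theorem the pieces agree on their overlaps. The order on the index type only serves to
  impose the conditions once for each pair.
\<close>

lemma glue_holomorphic:
  fixes U :: "'i :: linorder \<Rightarrow> complex set"
  assumes op: "\<And>y. y \<in> I \<Longrightarrow> open (U y)"
    and hol: "\<And>y. y \<in> I \<Longrightarrow> \<psi> y holomorphic_on U y"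
    and conn: "\<And>y1 y2. y1 \<in> I \<Longrightarrow> y2 \<in> I \<Longrightarrow> y1 < y2 \<Longrightarrow> connected (U y1 \<inter> U y2)"
    and agree: "\<And>y1 y2. y1 \<in> I \<Longrightarrow> y2 \<in> I \<Longrightarrow> y1 < y2 \<Longrightarrow> U y1 \<inter> U y2 \<noteq> {} \<Longrightarrow>
        \<exists>A p. A \<subseteq> U y1 \<inter> U y2 \<and> p \<in> U y1 \<inter> U y2 \<and> p islimpt A \<and> (\<forall>a\<in>A. \<psi> y1 a = \<psi> y2 a)"
  obtains \<Psi> where "\<Psi> holomorphic_on (\<Union>y\<in>I. U y)" "\<And>y z. y \<in> I \<Longrightarrow> z \<in> U y \<Longrightarrow> \<Psi> z = \<psi> y z"
proof -
  have lt: "\<psi> y1 z = \<psi> y2 z" if y: "y1 \<in> I" "y2 \<in> I" "y1 < y2" and z: "z \<in> U y1 \<inter> U y2" for y1 y2 z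
  proof -
    obtain A p where A: "A \<subseteq> U y1 \<inter> U y2" "p \<in> U y1 \<inter> U y2" "p islimpt A" "\<forall>a\<in>A. \<psi> y1 a = \<psi> y2 a"
      using agree[OF y] z by blast
    have "\<psi> y1 z - \<psi> y2 z = 0"
    proof (rule analytic_continuation[where f = "\<lambda>z. \<psi> y1 z - \<psi> y2 z", OF _ _ conn[OF y] A(1-3) _ z])
      show "(\<lambda>z. \<psi> y1 z - \<psi> y2 z) holomorphic_on U y1 \<inter> U y2"
        by (intro holomorphic_on_diff holomorphic_on_subset[OF hol[OF y(1)]] holomorphic_on_subset[OF hol[OF y(2)]]) auto
    qed (use A op y in auto)
    thus ?thesis by simp
  qed
  have eq: "\<psi> y1 z = \<psi> y2 z" if "y1 \<in> I" "y2 \<in> I" "z \<in> U y1" "z \<in> U y2" for y1 y2 z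
  proof (cases y1 y2 rule: linorder_cases)
    case less
    show ?thesis by (rule lt[OF that(1,2) less]) (use that in blast)
  next
    case greater
    show ?thesis by (rule lt[OF that(2,1) greater, symmetric]) (use that in blast)
  qed simp
  define \<Psi> where "\<Psi> z = \<psi> (SOME y. y \<in> I \<and> z \<in> U y) z" for z
  have \<Psi>: "\<Psi> z = \<psi> y z" if "y \<in> I" "z \<in> U y" for y z
  proof -
    have "(SOME y. y \<in> I \<and> z \<in> U y) \<in> I \<and> z \<in> U (SOME y. y \<in> I \<and> z \<in> U y)"
      by (rule someI[of "\<lambda>y. y \<in> I \<and> z \<in> U y"]) (use that in auto)
    thus ?thesis unfolding \<Psi>_def using that by (intro eq) auto
  qed
  have "\<Psi> holomorphic_on U y" if "y \<in> I" for y
    by (rule holomorphic_transform[OF hol[OF that]]) (use \<Psi> that in auto)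
  hence "\<Psi> holomorphic_on (\<Union>y\<in>I. U y)" using op by (intro holomorphic_on_UN_open) auto
  thus ?thesis using \<Psi> by (rule that)
qed

lemma exp_in_cone:
  assumes "\<bar>Im s\<bar> < pi - \<epsilon>" "0 < \<epsilon>"
  shows "exp s \<in> sector (cos \<epsilon>)"
proof -
  have "cos (pi - \<epsilon>) < cos \<bar>Im s\<bar>" using assms by (intro cos_monotone_0_pi) auto
  hence "- cos \<epsilon> < cos (Im s)" by simp
  hence "exp (Re s) * (- cos \<epsilon>) < exp (Re s) * cos (Im s)" by (intro mult_strict_left_mono) auto
  thus ?thesis by (simp add: sector_def Re_exp mult.commute)
qed

lemma exp_off_nonpos:
  assumes "\<bar>Im s\<bar> < pi"
  shows "Im (exp s) \<noteq> 0 \<or> Re (exp s) > 0"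
proof (cases "Im s = 0")
  case False
  have "sin (Im s) \<noteq> 0"
    using sin_gt_zero[of "Im s"] sin_gt_zero[of "- Im s"] False assms by (cases "Im s > 0") auto
  thus ?thesis by (simp add: Im_exp)
qed (simp add: Re_exp)

text \<open>
  Under \<open>\<tau> \<mapsto> a - exp \<tau>\<close> slit neighbourhoods correspond to half strips, from which they inherit openness
  and connectedness.
\<close>

lemma right_slit_nbhd_conv_image:
  assumes "0 < \<epsilon>" "\<epsilon> < pi"
  shows "right_slit_nbhd a (exp m) \<epsilon> = (\<lambda>\<tau>. a - exp \<tau>) ` {\<tau>. Re \<tau> < m \<and> \<bar>Im \<tau>\<bar> < pi - \<epsilon>}"
    (is "?L = ?f ` ?Z")
proof (intro equalityI subsetI)
  fix z assume "z \<in> ?L"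
  hence z: "cmod (z - a) < exp m" "\<bar>Arg (z - a)\<bar> > \<epsilon>" by (auto simp: right_slit_nbhd_def)
  have nz: "z - a \<noteq> 0" using z assms by (auto simp: Arg_zero)
  have A: "Arg (a - z) = (if Arg (z - a) \<le> 0 then Arg (z - a) + pi else Arg (z - a) - pi)"
    using Arg_minus[OF nz] by simp
  have "ln (cmod (a - z)) < ln (exp m)"
    using z nz by (subst ln_less_cancel_iff) (auto simp: norm_minus_commute)
  hence "ln (cmod (a - z)) < m" by simp
  moreover have "\<bar>Arg (a - z)\<bar> < pi - \<epsilon>"
    using z(2) A Arg_le_pi[of "z - a"] mpi_less_Arg[of "z - a"] assms by (auto split: if_splits)
  ultimately have "Ln (a - z) \<in> ?Z" using nz by (simp add: Arg_eq_Im_Ln)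
  moreover have "z = ?f (Ln (a - z))" using nz by simp
  ultimately show "z \<in> ?f ` ?Z" by blast
next
  fix z assume "z \<in> ?f ` ?Z"
  then obtain \<tau> where \<tau>: "Re \<tau> < m" "\<bar>Im \<tau>\<bar> < pi - \<epsilon>" "z = a - exp \<tau>" by auto
  have "Arg (exp \<tau>) = Im \<tau>" using \<tau>(2) assms by (subst Arg_eq_Im_Ln) auto
  moreover have "z - a = - exp \<tau>" by (simp add: \<tau>)
  ultimately have "\<bar>Arg (z - a)\<bar> > \<epsilon>" using \<tau>(2) Arg_minus[of "exp \<tau>"] by auto
  thus "z \<in> ?L" using \<tau> by (simp add: right_slit_nbhd_def)
qed

lemma open_connected_right_slit_nbhd:
  assumes "0 < \<epsilon>" "\<epsilon> < pi"
  shows "open (right_slit_nbhd a (exp m) \<epsilon>)" "connected (right_slit_nbhd a (exp m) \<epsilon>)"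
proof -
  define Z where "Z = {\<tau>. Re \<tau> < m \<and> \<bar>Im \<tau>\<bar> < pi - \<epsilon>}"
  have opZ: "open Z" and cvZ: "convex Z" unfolding Z_def by (rule open_half_strip convex_half_strip)+
  have inj: "inj_on (\<lambda>\<tau>. a - exp \<tau>) Z"
  proof
    fix s t assume "s \<in> Z" "t \<in> Z" "a - exp s = a - exp t"
    hence e: "exp s = exp t" and s: "\<bar>Im s\<bar> < pi" "\<bar>Im t\<bar> < pi" using assms by (auto simp: Z_def)
    have "s = Ln (exp s)" using s by (intro Ln_exp[symmetric]) auto
    also have "\<dots> = t" unfolding e using s by (intro Ln_exp) auto
    finally show "s = t" .
  qed
  have hol: "(\<lambda>\<tau>. a - exp \<tau>) holomorphic_on Z" by (intro holomorphic_intros)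
  show "open (right_slit_nbhd a (exp m) \<epsilon>)"
    unfolding right_slit_nbhd_conv_image[OF assms] using open_mapping_thm3[OF hol opZ inj] by (simp add: Z_def)
  show "connected (right_slit_nbhd a (exp m) \<epsilon>)"
    unfolding right_slit_nbhd_conv_image[OF assms]
    using connected_continuous_image[OF holomorphic_on_imp_continuous_on[OF hol] convex_connected[OF cvZ]]
    by (simp add: Z_def)
qed

text \<open>
  The pieces are discs around the points of \<open>[0, q1)\<close>, on which \<open>q\<close> has a local inverse because its
  derivative is at least 1 in real part there, and a slit neighbourhood of \<open>q1\<close>, on which
  \<open>sector_inverse\<close> applies to \<open>P\<close>.
\<close>

theorem inverse_continues_to_slit_nbhd:
  fixes q :: "complex \<Rightarrow> complex" and S M :: "complex fps" and \<rho> q1 :: real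
  assumes \<rho>: "\<rho> > 0"
    and q_exp: "q has_fps_expansion S" and S0: "fps_nth S 0 = 0" and MS: "M oo S = fps_X"
    and holq: "q holomorphic_on {z. Im z \<noteq> 0 \<or> Re z < \<rho>}"
    and real: "\<And>x. 0 \<le> x \<Longrightarrow> x < \<rho> \<Longrightarrow> q (of_real x) \<in> \<real>"
    and expand: "\<And>a b. 0 \<le> a \<Longrightarrow> a \<le> b \<Longrightarrow> b < \<rho> \<Longrightarrow> b - a \<le> Re (q (of_real b)) - Re (q (of_real a))"
    and lim: "((\<lambda>x. Re (q (of_real x))) \<longlongrightarrow> q1) (at_left \<rho>)"
    and P: "P = (\<lambda>u. of_real q1 - q (of_real \<rho> * (1 - u)))"
    and sec_pos: "\<And>c. 0 \<le> c \<Longrightarrow> c < 1 \<Longrightarrow> \<forall>\<^sub>F u in at 0 within sector c. Re (P u / u) > 0"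
    and sec_lim: "\<And>c. 0 \<le> c \<Longrightarrow> c < 1 \<Longrightarrow> ((\<lambda>u. u * deriv P u / P u) \<longlongrightarrow> 1) (at 0 within sector c)"
    and \<epsilon>: "\<epsilon> > 0"
  shows "\<exists>r>0. \<exists>D. continuable_to M D \<and> closed_segment 0 (of_real q1) - {of_real q1} \<subseteq> D \<and>
           right_slit_nbhd (of_real q1) r \<epsilon> \<subseteq> D"
proof -
  define \<epsilon>' where "\<epsilon>' = min \<epsilon> 1"
  have \<epsilon>': "0 < \<epsilon>'" "\<epsilon>' \<le> 1" "\<epsilon>' \<le> \<epsilon>" using \<epsilon> by (auto simp: \<epsilon>'_def)
  have \<epsilon>pi: "\<epsilon>' < pi / 2" "\<epsilon>' < pi" using \<epsilon>' pi_gt3 by auto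
  define slit where "slit = {z :: complex. Im z \<noteq> 0 \<or> Re z < \<rho>}"
  have slit_eq: "slit = {z. Im z < 0} \<union> {z. Im z > 0} \<union> {z. Re z < \<rho>}" by (auto simp: slit_def)
  have opslit: "open slit" unfolding slit_eq by (intro open_Un open_halfspace_Re_lt open_halfspace_Im_lt open_halfspace_Im_gt)
  have holq': "q holomorphic_on slit" using holq by (simp add: slit_def)
  define Q where "Q x = Re (q (of_real x))" for x
  have qQ: "q (of_real x) = of_real (Q x)" if "0 \<le> x" "x < \<rho>" for x
    using real[OF that] by (simp add: Q_def)
  have Qexp: "b - a \<le> Q b - Q a" if "0 \<le> a" "a \<le> b" "b < \<rho>" for a b using expand[OF that] by (simp add: Q_def)
  have q0: "q 0 = 0" using has_fps_expansion_imp_0_eq_fps_nth_0[OF q_exp] S0 by simp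
  have Q0: "Q 0 = 0" by (simp add: Q_def q0)
  have Qcont: "continuous_on {0..<\<rho>} Q" unfolding Q_def
    by (intro continuous_intros continuous_on_compose2[OF holomorphic_on_imp_continuous_on[OF holq']]) (auto simp: slit_def)
  have Qlt: "Q x < q1" if "0 \<le> x" "x < \<rho>" for x
  proof -
    define x' where "x' = (x + \<rho>) / 2"
    have x': "x < x'" "x' < \<rho>" using that by (auto simp: x'_def)
    have "Q x < Q x'" using Qexp[of x x'] x' that by simp
    also have "Q x' \<le> q1"
    proof (rule tendsto_lowerbound[OF lim])
      show "\<forall>\<^sub>F y in at_left \<rho>. Q x' \<le> Re (q (of_real y))"
        using eventually_at_left_real[OF x'(2)]
      proof eventually_elim
        case (elim y)
        have "y - x' \<le> Q y - Q x'" by (rule Qexp) (use elim x' that in auto)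
        thus ?case using elim by (simp add: Q_def)
      qed
    qed simp
    finally show ?thesis .
  qed
  have q1: "q1 > 0" using Qlt[of 0] \<rho> Q0 by simp
  have ex\<xi>: "\<exists>x. 0 \<le> x \<and> x < \<rho> \<and> Q x = t" if t: "0 \<le> t" "t < q1" for t
  proof -
    have "\<forall>\<^sub>F y in at_left \<rho>. t < Re (q (of_real y))" using lim t(2) by (rule order_tendstoD)
    moreover have "\<forall>\<^sub>F y in at_left \<rho>. y \<in> {0<..<\<rho>}" using eventually_at_left_real[OF \<rho>] .
    ultimately have "\<forall>\<^sub>F y in at_left \<rho>. t < Q y \<and> y \<in> {0<..<\<rho>}" by eventually_elim (simp add: Q_def)
    then obtain b where b: "t < Q b" "0 < b" "b < \<rho>" using eventually_happens'[OF trivial_limit_at_left_real] by fastforce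
    have "\<exists>x\<ge>0. x \<le> b \<and> Q x = t"
      by (rule IVT') (use b t Q0 in \<open>auto intro!: continuous_on_subset[OF Qcont]\<close>)
    thus ?thesis using b by force
  qed
  define \<xi> where "\<xi> t = (SOME x. 0 \<le> x \<and> x < \<rho> \<and> Q x = t)" for t
  have \<xi>: "0 \<le> \<xi> t" "\<xi> t < \<rho>" "Q (\<xi> t) = t" if "0 \<le> t" "t < q1" for t
    using someI_ex[OF ex\<xi>[OF that]] unfolding \<xi>_def by blast+
  have Qinj: "x = y" if "0 \<le> x" "x < \<rho>" "0 \<le> y" "y < \<rho>" "Q x = Q y" for x y
    using Qexp[OF that(1) _ that(4)] Qexp[OF that(3) _ that(2)] that(5) by linarith
  have \<xi>lip: "\<bar>\<xi> s - \<xi> t\<bar> \<le> \<bar>s - t\<bar>" if "0 \<le> s" "s < q1" "0 \<le> t" "t < q1" for s t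
  proof (cases "\<xi> s \<le> \<xi> t")
    case True
    show ?thesis using Qexp[OF \<xi>(1)[OF that(1,2)] True \<xi>(2)[OF that(3,4)]] True
      unfolding \<xi>(3)[OF that(1,2)] \<xi>(3)[OF that(3,4)] by linarith
  next
    case False
    hence le: "\<xi> t \<le> \<xi> s" by simp
    show ?thesis using Qexp[OF \<xi>(1)[OF that(3,4)] le \<xi>(2)[OF that(1,2)]] le
      unfolding \<xi>(3)[OF that(1,2)] \<xi>(3)[OF that(3,4)] by linarith
  qed
  have dq: "deriv q (of_real x) \<noteq> 0" if x: "0 \<le> x" "x < \<rho>" for x
  proof -
    have "(q has_field_derivative deriv q (of_real x)) (at (of_real x))"
      by (rule holomorphic_derivI[OF holq' opslit]) (use x in \<open>auto simp: slit_def\<close>)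
    hence L: "((\<lambda>h. (q (of_real x + h) - q (of_real x)) / h) \<longlongrightarrow> deriv q (of_real x)) (at 0)"
      by (simp add: DERIV_def)
    have "filterlim complex_of_real (at 0) (at_right 0)"
      by (auto simp: filterlim_at eventually_at_filter intro!: tendsto_eq_intros)
    from filterlim_compose[OF L this]
    have "((\<lambda>h. Re ((q (of_real x + of_real h) - q (of_real x)) / of_real h)) \<longlongrightarrow> Re (deriv q (of_real x))) (at_right 0)"
      by (rule tendsto_Re)
    moreover have "\<forall>\<^sub>F h in at_right 0. 1 \<le> Re ((q (of_real x + of_real h) - q (of_real x)) / of_real h)"
    proof -
      have "0 < \<rho> - x" using x by simp
      from eventually_at_right_real[OF this] show ?thesis
      proof eventually_elim
      case (elim h)
      hence 1: "0 < h" "x + h < \<rho>" by auto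
      have "q (of_real x + of_real h) = of_real (Q (x + h))" using qQ[of "x + h"] 1 x by simp
      moreover have "h \<le> Q (x + h) - Q x" using Qexp[of x "x+h"] 1 x by simp
      ultimately show ?case using 1 qQ[OF x] by (simp flip: of_real_diff of_real_divide)
      qed
    qed
    ultimately have "1 \<le> Re (deriv q (of_real x))" by (intro tendsto_lowerbound) auto
    thus ?thesis by auto
  qed
  have "\<exists>\<delta> g. 0 < \<delta> \<and> \<delta> \<le> q1 - y \<and> g holomorphic_on ball (of_real y) \<delta> \<and>
      (\<forall>z\<in>ball (of_real y) \<delta>. q (g z) = z) \<and>
      (\<forall>t. 0 \<le> t \<longrightarrow> t < q1 \<longrightarrow> \<bar>t - y\<bar> < \<delta> \<longrightarrow> g (of_real t) = of_real (\<xi> t))"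
    if y: "0 \<le> y" "y < q1" for y
  proof -
    define x where "x = \<xi> y"
    have x: "0 \<le> x" "x < \<rho>" "Q x = y" using \<xi>[OF y] by (auto simp: x_def)
    have "of_real x \<in> slit" using x by (simp add: slit_def)
    then obtain r where r: "r > 0" "ball (of_real x) r \<subseteq> slit" "inj_on q (ball (of_real x) r)"
      using has_complex_derivative_locally_injective[OF holq' _ opslit dq[OF x(1,2)]] by metis
    have holb: "q holomorphic_on ball (of_real x) r" using holq' r(2) by (rule holomorphic_on_subset)
    obtain g where g: "g holomorphic_on q ` ball (of_real x) r" "\<And>z. z \<in> ball (of_real x) r \<Longrightarrow> g (q z) = z"
      using holomorphic_has_inverse[OF holb open_ball r(3)] by metis
    have "open (q ` ball (of_real x) r)" by (rule open_mapping_thm3[OF holb open_ball r(3)])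
    moreover have "of_real y \<in> q ` ball (of_real x) r" using qQ[OF x(1,2)] r(1) x(3) by (intro image_eqI[of _ _ "of_real x"]) auto
    ultimately obtain d where d: "d > 0" "ball (of_real y) d \<subseteq> q ` ball (of_real x) r"
      by (meson openE)
    \<comment> \<open>The bound \<open>q1 - y\<close> keeps the disc to the left of \<open>q1\<close>, the bound \<open>r\<close> keeps \<open>\<xi>\<close> in the disc where \<open>q\<close> is injective.\<close>
    define \<delta> where "\<delta> = min d (min (q1 - y) r)"
    have \<delta>: "\<delta> > 0" "\<delta> \<le> d" "\<delta> \<le> q1 - y" "\<delta> \<le> r" using d r y by (auto simp: \<delta>_def)
    have sub: "ball (of_real y) \<delta> \<subseteq> q ` ball (of_real x) r" using d(2) \<delta>(2) subset_ball by blast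
    have "g (of_real t) = of_real (\<xi> t)" if t: "0 \<le> t" "t < q1" "\<bar>t - y\<bar> < \<delta>" for t
    proof -
      have "\<bar>\<xi> t - x\<bar> < r" using \<xi>lip[of t y] t y \<delta> by (simp add: x_def)
      hence "of_real (\<xi> t) \<in> ball (complex_of_real x) r"
        by (simp add: dist_norm abs_minus_commute flip: of_real_diff)
      from g(2)[OF this] show ?thesis using qQ[of "\<xi> t"] \<xi>[OF t(1,2)] by simp
    qed
    moreover have "q (g z) = z" if "z \<in> ball (of_real y) \<delta>" for z using that sub g(2) by force
    ultimately show ?thesis using \<delta> holomorphic_on_subset[OF g(1) sub] by blast
  qed
  then obtain \<delta> g where \<delta>g: "\<And>y. 0 \<le> y \<Longrightarrow> y < q1 \<Longrightarrow> 0 < \<delta> y \<and> \<delta> y \<le> q1 - y \<and> g y holomorphic_on ball (of_real y) (\<delta> y) \<and>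
      (\<forall>z\<in>ball (of_real y) (\<delta> y). q (g y z) = z) \<and>
      (\<forall>t. 0 \<le> t \<longrightarrow> t < q1 \<longrightarrow> \<bar>t - y\<bar> < \<delta> y \<longrightarrow> g y (of_real t) = of_real (\<xi> t))"
    by metis
  have germ: "g 0 has_fps_expansion M"
  proof -
    have d0: "\<delta> 0 > 0" and hol0: "g 0 holomorphic_on ball 0 (\<delta> 0)" and inv0: "\<And>z. z \<in> ball 0 (\<delta> 0) \<Longrightarrow> q (g 0 z) = z"
      and g00: "g 0 0 = 0"
      using \<delta>g[of 0] q1 \<xi>[of 0] Qinj[of "\<xi> 0" 0] Q0 by (auto dest!: spec[of _ 0])
    define G where "G = fps_expansion (g 0) 0"
    have G: "g 0 has_fps_expansion G" unfolding G_def
      by (rule has_fps_expansion_fps_expansion[OF _ _ hol0]) (use d0 in auto)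
    have G0: "fps_nth G 0 = 0" using has_fps_expansion_imp_0_eq_fps_nth_0[OF G] g00 by simp
    have "(q \<circ> g 0) has_fps_expansion (S oo G)" by (rule has_fps_expansion_compose[OF q_exp G G0])
    moreover have "(q \<circ> g 0) has_fps_expansion fps_X"
    proof -
      have "\<forall>\<^sub>F z in nhds 0. (q \<circ> g 0) z = z"
        using eventually_nhds_in_open[of "ball 0 (\<delta> 0)" 0] d0 by (auto elim!: eventually_mono simp: inv0)
      thus ?thesis using has_fps_expansion_cong[of "q \<circ> g 0" "\<lambda>z. z" fps_X fps_X] has_fps_expansion_fps_X by auto
    qed
    \<comment> \<open>Composing with \<open>M\<close> from the left turns this into \<open>G = M\<close>.\<close>
    ultimately have "S oo G = fps_X" by (rule fps_expansion_unique_complex)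
    hence "M = M oo (S oo G)" by simp
    also have "\<dots> = (M oo S) oo G" by (rule fps_compose_assoc[OF G0 S0])
    also have "\<dots> = G" using MS G0 by (simp add: fps_X_fps_compose_startby0)
    finally show ?thesis using G by simp
  qed
  define \<beta> where "\<beta> = pi - \<epsilon>'/2"
  define c where "c = cos (\<epsilon>'/2)"
  have c0: "0 \<le> c" unfolding c_def using \<epsilon>' \<epsilon>pi by (intro cos_ge_zero) auto
  have c: "c < 1" unfolding c_def using cos_monotone_0_pi[of 0 "\<epsilon>'/2"] \<epsilon>' \<epsilon>pi by simp
  have incone: "exp s \<in> sector c" if "\<bar>Im s\<bar> < \<beta>" for s
    using exp_in_cone[of s "\<epsilon>'/2"] that \<epsilon>' by (simp add: \<beta>_def c_def)
  obtain d where d: "d > 0" "\<And>u. u \<in> sector c \<Longrightarrow> u \<noteq> 0 \<Longrightarrow> cmod u < d \<Longrightarrow> Re (P u / u) > 0"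
    using sec_pos[OF c0 c] by (auto simp: eventually_at dist_norm)
  define \<sigma> where "\<sigma> = ln (min d 1)"
  have \<sigma>: "exp \<sigma> = min d 1" using d by (simp add: \<sigma>_def)
  have lt\<sigma>: "exp x < d" "exp x < 1" if "x < \<sigma>" for x :: real
    using that \<sigma> exp_less_mono[OF that] by auto
  define W where "W = {u :: complex. Im u \<noteq> 0 \<or> Re u > 0}"
  have W_eq: "W = {z. Im z < 0} \<union> {z. Im z > 0} \<union> {z. Re z > 0}" by (auto simp: W_def)
  have opW: "open W" unfolding W_eq by (intro open_Un open_halfspace_Re_gt open_halfspace_Im_lt open_halfspace_Im_gt)
  have holP: "P holomorphic_on W"
  proof -
    have "(q \<circ> (\<lambda>u. of_real \<rho> * (1 - u))) holomorphic_on W"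
      by (intro holomorphic_on_compose_gen[OF _ holq'] holomorphic_intros) (use \<rho> in \<open>auto simp: W_def slit_def\<close>)
    thus ?thesis unfolding P by (intro holomorphic_intros) (simp add: o_def)
  qed
  obtain m \<phi> where \<phi>: "\<phi> holomorphic_on {\<tau>. Re \<tau> < m \<and> \<bar>Im \<tau>\<bar> < pi - \<epsilon>'}"
    "\<And>\<tau>. Re \<tau> < m \<Longrightarrow> \<bar>Im \<tau>\<bar> < pi - \<epsilon>' \<Longrightarrow> Re (\<phi> \<tau>) < \<sigma> \<and> \<bar>Im (\<phi> \<tau>)\<bar> < \<beta> \<and> P (exp (\<phi> \<tau>)) = exp \<tau>"
    "\<And>x. x < m \<Longrightarrow> \<phi> (of_real x) \<in> \<real>"
  proof (rule sector_inverse[OF holP opW, where \<sigma> = \<sigma> and \<beta> = \<beta> and ?\<beta>0.0 = "pi - \<epsilon>'"])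
    show "exp s \<in> W" if "\<bar>Im s\<bar> < \<beta>" for s
      using exp_off_nonpos[of s] that \<epsilon>' by (auto simp: W_def \<beta>_def)
    show "0 < Re (P (exp s) / exp s)" if "Re s < \<sigma>" "\<bar>Im s\<bar> < \<beta>" for s
      using d(2)[OF incone[OF that(2)]] lt\<sigma>(1)[OF that(1)] by simp
    show "P (of_real (exp x)) \<in> \<real>" if "x < \<sigma>" for x
    proof -
      have "q (of_real (\<rho> * (1 - exp x))) \<in> \<real>"
        by (rule real) (use lt\<sigma>[OF that] \<rho> in auto)
      thus ?thesis unfolding P by simp
    qed
    show "\<exists>m. \<forall>s. Re s < m \<longrightarrow> \<bar>Im s\<bar> < \<beta> \<longrightarrow> cmod (exp s * deriv P (exp s) / P (exp s) - 1) \<le> \<delta>"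
      if \<delta>0: "\<delta> > 0" for \<delta>
    proof -
      obtain e where e: "e > 0" "\<And>u. u \<in> sector c \<Longrightarrow> u \<noteq> 0 \<Longrightarrow> cmod u < e \<Longrightarrow> cmod (u * deriv P u / P u - 1) < \<delta>"
        using tendstoD[OF sec_lim[OF c0 c] \<delta>0] by (auto simp: eventually_at dist_norm)
      show ?thesis
      proof (intro exI[of _ "ln e"] allI impI)
        fix s assume s: "Re s < ln e" "\<bar>Im s\<bar> < \<beta>"
        have "exp (Re s) < e" using s(1) e(1) by (metis exp_less_cancel_iff exp_ln)
        thus "cmod (exp s * deriv P (exp s) / P (exp s) - 1) \<le> \<delta>"
          using e(2)[OF incone[OF s(2)]] by (simp add: less_imp_le)
      qed
    qed
  qed (use \<epsilon>' \<epsilon>pi in \<open>auto simp: \<beta>_def\<close>)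
  define r where "r = exp m"
  define \<Delta> where "\<Delta> = right_slit_nbhd (of_real q1) r \<epsilon>'"
  define g\<Delta> where "g\<Delta> z = of_real \<rho> * (1 - exp (\<phi> (Ln (of_real q1 - z))))" for z
  have r: "r > 0" by (simp add: r_def)
  have \<Delta>_open: "open \<Delta>" and \<Delta>_conn: "connected \<Delta>"
    using open_connected_right_slit_nbhd[of \<epsilon>'] \<epsilon>' \<epsilon>pi by (auto simp: \<Delta>_def r_def)
  have Ln\<Delta>: "of_real q1 - z \<notin> \<real>\<^sub>\<le>\<^sub>0 \<and> Re (Ln (of_real q1 - z)) < m \<and> \<bar>Im (Ln (of_real q1 - z))\<bar> < pi - \<epsilon>'" if z: "z \<in> \<Delta>" for z
  proof -
    obtain \<tau> where \<tau>: "Re \<tau> < m" "\<bar>Im \<tau>\<bar> < pi - \<epsilon>'" "z = of_real q1 - exp \<tau>"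
      using z right_slit_nbhd_conv_image[of \<epsilon>'] \<epsilon>' \<epsilon>pi unfolding \<Delta>_def r_def by auto
    have "Ln (of_real q1 - z) = \<tau>" using \<tau> \<epsilon>' by (auto intro!: Ln_exp)
    moreover have "of_real q1 - z \<notin> \<real>\<^sub>\<le>\<^sub>0" using exp_off_nonpos[of \<tau>] \<tau> \<epsilon>' by (auto simp: complex_nonpos_Reals_iff)
    ultimately show ?thesis using \<tau> by simp
  qed
  have hol\<Delta>: "g\<Delta> holomorphic_on \<Delta>"
  proof -
    have "(\<phi> \<circ> (\<lambda>z. Ln (of_real q1 - z))) holomorphic_on \<Delta>"
      by (intro holomorphic_on_compose_gen[OF _ \<phi>(1)] holomorphic_intros) (use Ln\<Delta> in auto)
    thus ?thesis unfolding g\<Delta>_def by (intro holomorphic_intros) (simp add: o_def)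
  qed
  have \<Delta>_real: "g\<Delta> (of_real t) = of_real (\<xi> t)" if t: "0 \<le> t" "t < q1" "q1 - r < t" for t
  proof -
    have w: "of_real q1 - of_real t = complex_of_real (q1 - t)" by simp
    have L: "Ln (of_real q1 - of_real t) = of_real (ln (q1 - t))" unfolding w using t by (subst Ln_of_real) auto
    have lt: "ln (q1 - t) < m" using t by (metis diff_gt_0_iff_gt diff_less_eq exp_gt_zero less_diff_eq add.commute ln_exp ln_less_cancel_iff r_def)
    obtain s where s: "\<phi> (of_real (ln (q1 - t))) = of_real s" using \<phi>(3)[OF lt] by (auto elim: Reals_cases)
    have \<phi>s: "s < \<sigma>" "P (exp (of_real s)) = exp (of_real (ln (q1 - t)))"
      using \<phi>(2)[of "of_real (ln (q1 - t))"] lt \<epsilon>pi by (auto simp: s)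
    define x where "x = \<rho> * (1 - exp s)"
    have x: "0 \<le> x" "x < \<rho>" using lt\<sigma>[OF \<phi>s(1)] \<rho> by (auto simp: x_def)
    have "of_real q1 - q (of_real x) = of_real (q1 - t)" using \<phi>s(2) t unfolding P x_def by (simp add: exp_of_real)
    hence "of_real (q1 - Q x) = (of_real (q1 - t) :: complex)" unfolding qQ[OF x] by simp
    hence "Q x = t" by (simp only: of_real_eq_iff)
    hence "x = \<xi> t" using Qinj x \<xi>[OF t(1,2)] by simp
    moreover have "g\<Delta> (of_real t) = of_real x" unfolding g\<Delta>_def L s x_def by (simp add: exp_of_real)
    ultimately show ?thesis by simp
  qed
  \<comment> \<open>The index \<open>q1\<close> stands for the slit neighbourhood.\<close>
  define U where "U y = (if y < q1 then ball (complex_of_real y) (\<delta> y) else \<Delta>)" for y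
  define \<psi> where "\<psi> y = (if y < q1 then g y else g\<Delta>)" for y
  define R where "R y = (if y < q1 then \<delta> y else r)" for y
  \<comment> \<open>To the left of \<open>q1\<close> the slit is invisible, so there a slit neighbourhood is a disc as well.\<close>
  have inter: "U y1 \<inter> U y2 = ball (of_real y1) (R y1) \<inter> ball (of_real y2) (R y2)" if y: "0 \<le> y1" "y1 < y2" "y2 \<le> q1" for y1 y2
  proof (cases "y2 < q1")
    case True
    thus ?thesis using y by (simp add: U_def R_def)
  next
    case False
    hence [simp]: "y2 = q1" using y by simp
    have "z \<in> \<Delta> \<longleftrightarrow> z \<in> ball (of_real q1) r" if z: "z \<in> ball (of_real y1) (\<delta> y1)" for z
    proof -
      have "Re (z - of_real y1) < q1 - y1"
        using z \<delta>g[of y1] y complex_Re_le_cmod[of "z - of_real y1"] by (simp add: dist_norm norm_minus_commute)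
      hence neg: "Re (z - of_real q1) < 0" by simp
      have "\<bar>Arg (z - of_real q1)\<bar> > \<epsilon>'"
      proof (rule ccontr)
        assume "\<not> \<bar>Arg (z - of_real q1)\<bar> > \<epsilon>'"
        hence "cos (Arg (z - of_real q1)) \<ge> 0" using \<epsilon>pi by (intro cos_ge_zero) auto
        moreover have "Re (z - of_real q1) = cmod (z - of_real q1) * cos (Arg (z - of_real q1))"
          by (metis Re_rcis rcis_cmod_Arg)
        ultimately show False using neg by (metis mult_nonneg_nonneg norm_ge_zero not_less)
      qed
      thus ?thesis by (simp add: \<Delta>_def right_slit_nbhd_def dist_norm norm_minus_commute)
    qed
    thus ?thesis using y by (auto simp: U_def R_def)
  qed
  have \<psi>_real: "\<psi> y (of_real t) = of_real (\<xi> t)" if "0 \<le> y" "y \<le> q1" "0 \<le> t" "t < q1" "\<bar>t - y\<bar> < R y" for y t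
  proof (cases "y < q1")
    case True
    thus ?thesis using \<delta>g[of y] that by (simp add: \<psi>_def R_def)
  next
    case False
    thus ?thesis using \<Delta>_real[of t] that by (auto simp: \<psi>_def R_def)
  qed
  have agree: "\<exists>A p. A \<subseteq> U y1 \<inter> U y2 \<and> p \<in> U y1 \<inter> U y2 \<and> p islimpt A \<and> (\<forall>a\<in>A. \<psi> y1 a = \<psi> y2 a)"
    if y: "y1 \<in> {0..q1}" "y2 \<in> {0..q1}" "y1 < y2" and ne: "U y1 \<inter> U y2 \<noteq> {}" for y1 y2
  proof -
    define lo where "lo = max y1 (y2 - R y2)"
    define hi where "hi = min y2 (y1 + R y1)"
    obtain z where "z \<in> ball (complex_of_real y1) (R y1)" "z \<in> ball (complex_of_real y2) (R y2)"
      using ne inter[of y1 y2] y by auto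
    hence "dist (complex_of_real y1) (of_real y2) < R y1 + R y2"
      using dist_triangle[of "complex_of_real y1" "of_real y2" z] by (simp add: dist_commute)
    hence "y2 - y1 < R y1 + R y2" using y by (simp add: dist_norm flip: of_real_diff)
    moreover have "R y1 > 0" "R y2 > 0" using \<delta>g y r by (auto simp: R_def)
    ultimately have lohi: "lo < hi" using y by (auto simp: lo_def hi_def)
    define A where "A = complex_of_real ` {lo<..<hi}"
    define p where "p = complex_of_real ((lo + hi) / 2)"
    have pA: "p \<in> A" using lohi unfolding p_def A_def by (intro imageI) auto
    have p2: "complex_of_real ((3 * lo + hi) / 4) \<in> A" using lohi unfolding A_def by (intro imageI) auto
    have cA: "connected A" unfolding A_def by (intro connected_continuous_image continuous_intros) auto
    have ne2: "p \<noteq> complex_of_real ((3 * lo + hi) / 4)" unfolding p_def of_real_eq_iff using lohi by simp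
    have notsing: "A \<noteq> {x}" for x
    proof
      assume "A = {x}"
      thus False using pA p2 ne2 by (metis singletonD)
    qed
    have lp: "p islimpt A" by (rule connected_imp_perfect[OF cA pA notsing])
    have A_bounds: "\<bar>t - y1\<bar> < R y1" "\<bar>t - y2\<bar> < R y2" "0 \<le> t" "t < q1" if "t \<in> {lo<..<hi}" for t
      using that y by (auto simp: lo_def hi_def)
    have "complex_of_real t \<in> ball (of_real y1) (R y1) \<inter> ball (of_real y2) (R y2)" if t: "t \<in> {lo<..<hi}" for t
      using A_bounds(1,2)[OF t] by (simp add: dist_norm abs_minus_commute flip: of_real_diff)
    hence "A \<subseteq> U y1 \<inter> U y2" using inter[of y1 y2] y unfolding A_def by auto
    moreover have "\<psi> y1 (of_real t) = \<psi> y2 (of_real t)" if t: "t \<in> {lo<..<hi}" for t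
      using \<psi>_real[of y1 t] \<psi>_real[of y2 t] A_bounds[OF t] y by simp
    hence "\<forall>a\<in>A. \<psi> y1 a = \<psi> y2 a" unfolding A_def by blast
    ultimately show ?thesis using pA lp by blast
  qed
  have U_open: "open (U y)" for y using \<Delta>_open by (simp add: U_def)
  obtain \<Psi> where \<Psi>: "\<Psi> holomorphic_on (\<Union>y\<in>{0..q1}. U y)" "\<And>y z. y \<in> {0..q1} \<Longrightarrow> z \<in> U y \<Longrightarrow> \<Psi> z = \<psi> y z"
  proof (rule glue_holomorphic[of "{0..q1}" U \<psi>])
    show "\<psi> y holomorphic_on U y" if "y \<in> {0..q1}" for y
      using that \<delta>g[of y] hol\<Delta> by (auto simp: \<psi>_def U_def)
    show "connected (U y1 \<inter> U y2)" if "y1 \<in> {0..q1}" "y2 \<in> {0..q1}" "y1 < y2" for y1 y2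
      using inter[of y1 y2] that by (auto intro!: convex_connected convex_Int)
  qed (use U_open agree in auto)
  define D where "D = (\<Union>y\<in>{0..q1}. U y)"
  define seg where "seg = complex_of_real ` {0..<q1}"
  have inU: "of_real y \<in> U y" if "0 \<le> y" "y < q1" for y using that \<delta>g[of y] by (simp add: U_def)
  have segD: "seg \<subseteq> D" using inU by (force simp: seg_def D_def)
  have "connected (U y \<union> seg)" if y: "y \<in> {0..q1}" for y
  proof (rule connected_Un)
    show "connected (U y)" using \<Delta>_conn by (simp add: U_def)
    show "connected seg" unfolding seg_def by (intro connected_continuous_image continuous_intros) auto
    show "U y \<inter> seg \<noteq> {}"
    proof (cases "y < q1")
      case True
      thus ?thesis using inU[of y] y by (auto simp: seg_def)
    next
      case False
      define t where "t = q1 - min q1 (r / 2)"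
      have t: "0 \<le> t" "t < q1" "q1 - t < r" using q1 r by (auto simp: t_def)
      have "Arg (of_real t - of_real q1) = pi" using t by (simp add: Arg_eq_pi)
      moreover have "cmod (of_real t - of_real q1) = q1 - t" using t by (simp flip: of_real_diff)
      ultimately have "of_real t \<in> \<Delta>" using t \<epsilon>pi by (simp add: \<Delta>_def right_slit_nbhd_def)
      thus ?thesis using False t by (auto simp: U_def seg_def)
    qed
  qed
  hence "connected (\<Union>y\<in>{0..q1}. U y \<union> seg)" using q1
    by (intro connected_Union) (auto simp: seg_def)
  moreover have "(\<Union>y\<in>{0..q1}. U y \<union> seg) = D" using segD q1 by (auto simp: D_def)
  ultimately have connD: "connected D" by simp
  have zero: "0 \<in> D" using segD q1 by (force simp: seg_def)
  have "\<Psi> has_fps_expansion M"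
  proof -
    have "\<forall>\<^sub>F z in nhds 0. g 0 z = \<Psi> z"
      using eventually_nhds_in_open[OF U_open[of 0], of 0] inU[of 0] q1 \<Psi>(2)[of 0] by (auto elim!: eventually_mono simp: \<psi>_def)
    thus ?thesis using has_fps_expansion_cong[of "g 0" \<Psi> M M] germ by auto
  qed
  hence "continuable_to M D" unfolding continuable_to_def
    using connD zero \<Psi>(1) U_open by (auto simp: D_def)
  moreover have "closed_segment 0 (of_real q1) - {of_real q1} \<subseteq> D"
  proof
    fix z :: complex assume "z \<in> closed_segment 0 (of_real q1) - {of_real q1}"
    then obtain u where u: "0 \<le> u" "u \<le> 1" "z = of_real (u * q1)" "z \<noteq> of_real q1"
      by (auto simp: in_segment scaleR_conv_of_real)
    hence "u < 1" by (cases "u = 1") auto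
    hence "u * q1 \<in> {0..<q1}" using u q1 by auto
    hence "z \<in> seg" unfolding seg_def u(3) by (rule imageI)
    thus "z \<in> D" using segD by blast
  qed
  moreover have "right_slit_nbhd (of_real q1) r \<epsilon> \<subseteq> D"
  proof -
    have "right_slit_nbhd (of_real q1) r \<epsilon> \<subseteq> \<Delta>" using \<epsilon>'(3) by (auto simp: \<Delta>_def right_slit_nbhd_def)
    also have "\<Delta> = U q1" by (simp add: U_def)
    also have "U q1 \<subseteq> D" using q1 unfolding D_def by (intro UN_upper) simp
    finally show ?thesis .
  qed
  ultimately show ?thesis by (intro exI[of _ r] exI[of _ D] conjI r)
qed

section \<open>The mirror map\<close>

text \<open>
  The coefficient sequence of \<open>F\<close> is log-convex and \<open>G\<close> arises from it by multiplication with the increasing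
  sequence \<^term>\<open>H_coeff Ns\<close>, so \<open>kaluza_quotient\<close> applies to \<open>G / F\<close>.
\<close>

lemma canonical_coord_nonneg:
  assumes Ns: "\<forall>N\<in>set Ns. N \<ge> 2"
  shows "fps_nth (canonical_coord Ns) n \<in> \<real>\<^sub>\<ge>\<^sub>0"
proof -
  define F where "F = Abs_fps (B_coeff Ns)"
  define G where "G = Abs_fps (\<lambda>m. H_coeff Ns m * B_coeff Ns m)"
  have as: "0 < \<alpha> \<and> \<alpha> < 1" if "\<alpha> \<in> set (alphas Ns)" for \<alpha> using alphas_bounds[OF Ns that] by simp
  have C: "C_const Ns > 0" by (rule C_const_pos[OF Ns])
  have H0: "H_coeff Ns 0 = 0" by (simp add: H_coeff_eq harm_diff_0)
  have F0: "fps_nth F 0 = 1" by (simp add: F_def B_coeff_eq poch_ratio_0)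
  have pos: "fps_nth F m > 0" for m using C poch_ratio_pos[OF as] by (simp add: F_def B_coeff_eq)
  have step: "fps_nth F (Suc m) / fps_nth F m = C_const Ns * step_ratio (alphas Ns) m" for m
  proof -
    have "fps_nth F (Suc m) = C_const Ns * step_ratio (alphas Ns) m * fps_nth F m"
      by (simp add: F_def B_coeff_eq poch_ratio_Suc mult_ac)
    thus ?thesis using pos[of m] by simp
  qed
  have nn: "0 \<le> fps_nth (G / F) m" for m
  proof (rule kaluza_quotient[OF F0 pos])
    show "fps_nth F (Suc m) / fps_nth F m \<le> fps_nth F (Suc n) / fps_nth F n" if "m \<le> n" for m n
      unfolding step using step_ratio_mono[OF as that] C by (intro mult_left_mono) auto
    show "fps_nth G n = H_coeff Ns n * fps_nth F n" for n by (simp add: G_def F_def)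
    show "mono (H_coeff Ns)" using harm_diff_mono[OF as] by (simp add: H_coeff_eq[abs_def])
    show "H_coeff Ns 0 = 0" by (rule H0)
  qed
  have FS: "F_series Ns = Abs_fps (\<lambda>n. of_real (fps_nth F n))" by (simp add: F_series_def F_def)
  have GS: "G_series Ns = Abs_fps (\<lambda>n. of_real (fps_nth G n))"
    using H0 by (auto simp: G_series_def G_def fps_eq_iff)
  have "G_series Ns / F_series Ns = Abs_fps (\<lambda>n. of_real (fps_nth (G / F) n))"
    unfolding FS GS by (rule of_real_fps_divide) (simp add: F0)
  hence "fps_nth (G_series Ns / F_series Ns) m \<in> \<real>\<^sub>\<ge>\<^sub>0" for m using nn[of m] by simp
  from nonneg_fps_exp_compose[OF this] show ?thesis by (simp add: canonical_coord_def)
qed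

theorem mirror_map_continuation:
  fixes Ns :: "nat list"
  assumes Ns: "\<forall>N\<in>set Ns. N \<ge> 2" and Phi: "Phi Ns \<ge> 4" and \<epsilon>: "\<epsilon> > 0"
  shows "\<exists>r>0. \<exists>D. continuable_to (mirror_map Ns) D \<and>
             closed_segment 0 (q_crit Ns) - {q_crit Ns} \<subseteq> D \<and>
             right_slit_nbhd (q_crit Ns) r \<epsilon> \<subseteq> D"
proof -
  define as where "as = alphas Ns"
  define C where "C = C_const Ns"
  have C: "C > 0" unfolding C_def by (rule C_const_pos[OF Ns])
  have as: "0 < \<alpha> \<and> \<alpha> < 1" if "\<alpha> \<in> set as" for \<alpha> using alphas_bounds[OF Ns] that by (simp add: as_def)
  have "length as \<ge> 4" using Phi by (simp add: as_def length_alphas)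
  hence ne: "as \<noteq> []" by auto
  have "(\<Sum>\<alpha>\<leftarrow>as. 1 - \<alpha>) = real (length as) - sum_list as" by (induction as) simp_all
  also have "\<dots> = real (Phi Ns) / 2" by (simp add: as_def length_alphas sum_alphas[OF Ns])
  finally have two: "(\<Sum>\<alpha>\<leftarrow>as. 1 - \<alpha>) \<ge> 2" using Phi by simp
  obtain M where "log_moments M (\<lambda>m. \<Prod>\<alpha>\<leftarrow>as. pochhammer \<alpha> m / fact m) (\<lambda>m. \<Sum>\<alpha>\<leftarrow>as. harm_shift \<alpha> m - harm_shift 1 m)"
    using ex_log_moments[OF ne] as by blast
  hence M: "log_moments M (poch_ratio as) (harm_diff as)" by (simp add: poch_ratio_def[abs_def] harm_diff_def[abs_def])
  have pmom: "(\<integral>t. t ^ m \<partial>M) = poch_ratio as m" for m using M by (simp add: log_moments_def)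
  have lmom: "(\<integral>t. ln t * t ^ m \<partial>M) = poch_ratio as m * (harm_diff as m + (\<integral>t. ln t \<partial>M))" for m
    using M by (simp add: log_moments_def)
  interpret fm: finite_measure M using M by (simp add: log_moments_def)
  interpret quadratic_moment_measure M
  proof
    show "measure M (space M) = 1" using pmom[of 0] by (simp add: poch_ratio_0)
    show "(\<integral>t. t ^ n \<partial>M) \<le> 1 / (real n + 1)\<^sup>2" for n unfolding pmom by (rule poch_ratio_le[OF as two])
  qed (use M in \<open>auto simp: log_moments_def intro: fm.finite_measure_axioms\<close>)
  define l where "l = (\<integral>t. ln t \<partial>M)"
  define \<rho> where "\<rho> = 1 / C"
  have \<rho>: "\<rho> > 0" using C by (simp add: \<rho>_def)
  define f where "f z = J (\<lambda>_. 1) (of_real C * z)" for z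
  \<comment> \<open>Subtracting \<open>l\<close> removes the additive constant in the logarithmic moments.\<close>
  define g where "g z = J ln (of_real C * z) - of_real l * f z" for z
  define q where "q z = z * exp (g z / f z)" for z
  have f_exp: "f has_fps_expansion F_series Ns"
  proof -
    have "f has_fps_expansion Abs_fps (\<lambda>n. of_real (C ^ n * (\<integral>t. 1 * t ^ n \<partial>M)))"
      unfolding f_def[abs_def] by (rule J_has_fps_expansion[OF _ C]) simp
    thus ?thesis by (simp add: F_series_def B_coeff_eq C_def pmom as_def)
  qed
  have g_exp: "g has_fps_expansion G_series Ns"
  proof -
    have "(\<lambda>z. J ln (of_real C * z)) has_fps_expansion Abs_fps (\<lambda>n. of_real (C ^ n * (\<integral>t. ln t * t ^ n \<partial>M)))"
      by (rule J_has_fps_expansion[OF ln_int C])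
    hence "g has_fps_expansion Abs_fps (\<lambda>n. of_real (C ^ n * (\<integral>t. ln t * t ^ n \<partial>M))) - fps_const (of_real l) * F_series Ns"
      unfolding g_def[abs_def] by (intro has_fps_expansion_diff has_fps_expansion_cmult_left f_exp)
    also have "Abs_fps (\<lambda>n. of_real (C ^ n * (\<integral>t. ln t * t ^ n \<partial>M))) - fps_const (of_real l) * F_series Ns = G_series Ns"
      by (rule fps_ext)
         (auto simp: G_series_def F_series_def B_coeff_eq H_coeff_eq C_def lmom as_def l_def harm_diff_0 poch_ratio_0 algebra_simps)
    finally show ?thesis .
  qed
  have q_exp: "q has_fps_expansion canonical_coord Ns"
  proof -
    have "(\<lambda>z. g z / f z) has_fps_expansion G_series Ns / F_series Ns"
      by (rule has_fps_expansion_divide'[OF g_exp f_exp]) (simp add: fps_nth_F_series_0)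
    from has_fps_expansion_compose[OF has_fps_expansion_exp1 this fps_nth_G_div_F_0]
    have "(\<lambda>z. z * (exp \<circ> (\<lambda>z. g z / f z)) z) has_fps_expansion fps_X * (fps_exp 1 oo (G_series Ns / F_series Ns))"
      by (intro has_fps_expansion_mult has_fps_expansion_fps_X)
    thus ?thesis by (simp add: q_def[abs_def] canonical_coord_def)
  qed
  define slit where "slit = {z :: complex. Im z \<noteq> 0 \<or> Re z < \<rho>}"
  have Cslit: "of_real C * z \<in> slit_plane" if "z \<in> slit" for z
    using that C by (auto simp: slit_def slit_plane_def \<rho>_def field_simps)
  have f0: "f z \<noteq> 0" if "z \<in> slit" for z unfolding f_def by (rule J_1_nonzero[OF Cslit[OF that]])
  have J_hol: "(\<lambda>z. J w (of_real C * z)) holomorphic_on slit" if w: "integrable M w" for w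
  proof -
    have "(J w \<circ> (\<lambda>z. of_real C * z)) holomorphic_on slit"
      by (rule holomorphic_on_compose_gen[OF _ J_holomorphic[OF w]]) (use Cslit in \<open>auto intro!: holomorphic_intros\<close>)
    thus ?thesis by (simp add: o_def)
  qed
  have f_hol: "f holomorphic_on slit" unfolding f_def[abs_def] by (rule J_hol) simp
  have q_hol: "q holomorphic_on slit" unfolding q_def[abs_def] g_def
    by (intro holomorphic_intros J_hol ln_int f_hol f0)
  define q1 where "q1 = \<rho> * exp (- l - lam)"
  have q1: "q1 > 0" using \<rho> by (simp add: q1_def)
  define P where "P = (\<lambda>u. of_real q1 - q (of_real \<rho> * (1 - u)))"
  have P_eq: "P u = of_real q1 * gap u" if u: "1 - u \<in> slit_plane" for u
  proof -
    have Crho: "of_real C * (of_real \<rho> * (1 - u)) = 1 - u" using C by (simp add: \<rho>_def)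
    have "g (of_real \<rho> * (1 - u)) / f (of_real \<rho> * (1 - u)) = J ln (1 - u) / J (\<lambda>_. 1) (1 - u) - of_real l"
      unfolding g_def f_def Crho using J_1_nonzero[OF u] by (simp add: diff_divide_distrib)
    also have "\<dots> = of_real (- l - lam) + (- (u * ratio u))"
      unfolding quotient_at_1[OF u] ratio_def by simp
    finally have "q (of_real \<rho> * (1 - u)) = of_real \<rho> * (1 - u) * (exp (of_real (- l - lam)) * exp (- (u * ratio u)))"
      unfolding q_def by (simp only: exp_add)
    also have "\<dots> = of_real q1 * ((1 - u) * exp (- (u * ratio u)))"
      by (simp add: q1_def exp_of_real[symmetric])
    finally show ?thesis by (simp add: P_def gap_def algebra_simps)
  qed
  have P_deriv: "deriv P u = of_real q1 * deriv gap u" if u: "1 - u \<in> slit_plane" for u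
  proof -
    have "open ((\<lambda>u. 1 - u) -` slit_plane)"
      by (intro open_vimage open_slit_plane continuous_intros)
    hence "\<forall>\<^sub>F u in nhds u. u \<in> (\<lambda>u. 1 - u) -` slit_plane" using u by (intro eventually_nhds_in_open) auto
    hence "\<forall>\<^sub>F u in nhds u. P u = of_real q1 * gap u" by eventually_elim (use P_eq in auto)
    hence "deriv P u = deriv (\<lambda>u. of_real q1 * gap u) u" by (rule deriv_cong_ev) simp
    also have "\<dots> = of_real q1 * deriv gap u"
      by (rule deriv_cmult) (use gap_deriv[OF u] in \<open>auto simp: field_differentiable_def\<close>)
    finally show ?thesis .
  qed
  have in_slit: "\<forall>\<^sub>F u in at 0 within sector c. 1 - u \<in> slit_plane" if "c < 1" for c
    unfolding eventually_at_filter using cone_slit_plane[OF that] by (intro always_eventually) auto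
  have lim: "((\<lambda>x. Re (q (of_real x))) \<longlongrightarrow> q1) (at_left \<rho>)"
  proof -
    have fl: "filterlim (\<lambda>x. complex_of_real (1 - C * x)) (at 0 within sector 0) (at_left \<rho>)"
      unfolding filterlim_at
    proof
      show "\<forall>\<^sub>F x in at_left \<rho>. complex_of_real (1 - C * x) \<in> sector 0 \<and> complex_of_real (1 - C * x) \<noteq> 0"
        using eventually_at_left_real[OF \<rho>]
      proof eventually_elim
        case (elim x)
        hence "C * x < 1" using C by (simp add: \<rho>_def field_simps)
        hence "1 - C * x > 0" by simp
        thus ?case unfolding sector_def mem_Collect_eq Re_complex_of_real of_real_eq_0_iff by simp
      qed
      have "((\<lambda>x. complex_of_real (1 - C * x)) \<longlongrightarrow> of_real (1 - C * \<rho>)) (at_left \<rho>)" by (intro tendsto_intros)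
      thus "((\<lambda>x. complex_of_real (1 - C * x)) \<longlongrightarrow> 0) (at_left \<rho>)" using C by (simp add: \<rho>_def)
    qed
    have "((\<lambda>x. gap (complex_of_real (1 - C * x))) \<longlongrightarrow> 0) (at_left \<rho>)"
      by (rule filterlim_compose[OF gap_asymptotics(3) fl]) auto
    hence "((\<lambda>x. Re (of_real q1 - of_real q1 * gap (complex_of_real (1 - C * x)))) \<longlongrightarrow> Re (of_real q1 - of_real q1 * 0)) (at_left \<rho>)"
      by (intro tendsto_intros)
    hence "((\<lambda>x. Re (of_real q1 - of_real q1 * gap (complex_of_real (1 - C * x)))) \<longlongrightarrow> q1) (at_left \<rho>)" by simp
    moreover have "\<forall>\<^sub>F x in at_left \<rho>. Re (of_real q1 - of_real q1 * gap (complex_of_real (1 - C * x))) = Re (q (of_real x))"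
      using eventually_at_left_real[OF \<rho>]
    proof eventually_elim
      case (elim x)
      hence "C * x < 1" using C by (simp add: \<rho>_def field_simps)
      hence "1 - complex_of_real (1 - C * x) \<in> slit_plane" by (simp add: slit_plane_def)
      from P_eq[OF this] have "of_real q1 - q (of_real x) = of_real q1 * gap (complex_of_real (1 - C * x))"
        using C unfolding P_def by (simp add: \<rho>_def)
      hence "q (of_real x) = of_real q1 - of_real q1 * gap (complex_of_real (1 - C * x))" by (simp add: algebra_simps)
      thus ?case by (simp only:)
    qed
    ultimately show ?thesis by (rule Lim_transform_eventually)
  qed
  have q_hol_ball: "q holomorphic_on ball 0 \<rho>"
  proof (rule holomorphic_on_subset[OF q_hol], rule subsetI)
    fix z :: complex assume "z \<in> ball 0 \<rho>"
    hence "Re z < \<rho>" using complex_Re_le_cmod[of z] by (simp add: dist_norm)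
    thus "z \<in> slit" by (simp add: slit_def)
  qed
  note boundary = nonneg_power_series_boundary[OF \<rho> canonical_coord_nonneg[OF Ns] fps_nth_canonical_coord_1 q_exp q_hol_ball lim]
  have crit: "q_crit Ns = of_real q1" unfolding q_crit_def C_def[symmetric] \<rho>_def[symmetric] by (rule boundary(3))
  show ?thesis unfolding crit
  proof (rule inverse_continues_to_slit_nbhd[OF \<rho> q_exp fps_nth_canonical_coord_0 mirror_map_inverse(1) q_hol[unfolded slit_def]
        boundary(1) boundary(2) lim P_def _ _ \<epsilon>])
    fix c :: real assume c: "0 \<le> c" "c < 1"
    show "\<forall>\<^sub>F u in at 0 within sector c. 0 < Re (P u / u)"
      using in_slit[OF c(2)] gap_asymptotics(1)[OF c]
    proof eventually_elim
      case (elim u)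
      have eq: "P u / u = of_real q1 * (gap u / u)" using P_eq[OF elim(1)] by simp
      have "Re (of_real q1 * w) = q1 * Re w" for w by simp
      thus ?case unfolding eq using mult_pos_pos[OF q1 elim(2)] by (simp only:)
    qed
    show "((\<lambda>u. u * deriv P u / P u) \<longlongrightarrow> 1) (at 0 within sector c)"
    proof (rule Lim_transform_eventually[OF gap_asymptotics(2)[OF c]])
      show "\<forall>\<^sub>F u in at 0 within sector c. u * deriv gap u / gap u = u * deriv P u / P u"
        using in_slit[OF c(2)] by eventually_elim (use P_eq P_deriv q1 in simp)
    qed
  qed
qed

theorem proposition1p6:
  fixes Ns :: "nat list"
  assumes "length Ns \<ge> 1"
    and "\<forall>N\<in>set Ns. N \<ge> 2"
    and "Phi Ns \<ge> 4"
  shows "(\<exists>D. continuable_to (mirror_map Ns) D \<and>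
             closed_segment 0 (q_crit Ns) - {q_crit Ns} \<subseteq> D) \<and>
         (\<forall>\<epsilon>>0. \<exists>r>0. \<exists>D. continuable_to (mirror_map Ns) D \<and>
             closed_segment 0 (q_crit Ns) - {q_crit Ns} \<subseteq> D \<and>
             right_slit_nbhd (q_crit Ns) r \<epsilon> \<subseteq> D)"
proof (intro conjI allI impI)
  show "\<exists>D. continuable_to (mirror_map Ns) D \<and> closed_segment 0 (q_crit Ns) - {q_crit Ns} \<subseteq> D"
    using mirror_map_continuation[OF assms(2,3), of 1] by auto
qed (rule mirror_map_continuation[OF assms(2,3)])

end
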